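(* Let $(X_1,Y_1),\dots,(X_n,Y_n)$ be obtained independently from a logistic regression model with $X\in\mathbb{R}^d$, $Y\in\{-1,1\}$ and $$\log\Big(\frac{\Pr(Y=1|X=x)}{1-\Pr(Y=1|X=x)}\Big)=\beta_*^Tx$$ for some $\beta_*\in\mathbb{R}^d$, where $X$ has positive density almost everywhere with respect to Lebesgue measure on $\mathbb{R}^d$ and $\mathbb{E}\|X\|_2^2<\infty$. Let $$h(x,y;\beta)=\frac{-yx}{1+\exp(y\beta^Tx)}.$$ Let $q\in(1,\infty]$, $1/p+1/q=1$, consider the cost function $c((x,y),(u,v))=N_q((x,y),(u,v))$, and for $\beta\in\mathbb{R}^d$ let $$R_n(\beta)=\inf\big\{\mathcal{D}_c(\mathbb{P},\mathbb{P}_n):\ \mathbb{E}_{\mathbb{P}}[h(X,Y;\beta)]=\mathbf 0\big\}.$$ Then, as $n\to\infty$, $$\sqrt n\,R_n(\beta_* )\Rightarrow L_3:=\sup_{\xi\in A}\xi^TZ,$$ where $$Z\sim\mathcal{N}\bigg(\mathbf 0,\ \mathbb{E}\Big[\frac{XX^T}{(1+\exp(Y\beta_*^TX))^2}\Big]\bigg),\qquad A=\Big\{\xi\in\mathbb{R}^d:\ \operatorname*{ess\,sup}_{x,y}\big\|\xi^TD_xh(x,y;\beta_* )\big\|_p\le1\Big\}.$$ Moreover, $$L_3\overset{D}{\le}L_4:=\|\tilde Z\|_q,\qquad\text{where }\tilde Z\sim\mathcal{N}(\mathbf 0,\mathbb{E}[XX^T]).$$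
   Context: $h(x,y;\beta)$ is the gradient in $\beta$ of the loss $l(x,y;\beta)=\log(1+\exp(-y\beta^Tx))$; $D_xh$ is the $d\times d$ Jacobian of $h$ in $x$, with $(i,j)$ entry $\partial h_i/\partial x_j$. The essential supremum over $(x,y)$ is with respect to the law of $(X,Y)$ (equivalently Lebesgue measure in $x\in\mathbb{R}^d$ and both $y\in\{-1,1\}$). $\mathbb{P}_n=\frac1n\sum_{i=1}^n\delta_{(X_i,Y_i)}$. $N_q((x,y),(u,v))=\|x-u\|_q$ if $y=v$, and $=\infty$ otherwise. $\mathcal{D}_c(\mathbb{P},\mathbb{Q})=\inf\{\mathbb{E}_\pi[c(U,V)]\}$ over joint distributions $\pi$ on $\mathbb{R}^{d+1}\times\mathbb{R}^{d+1}$ with marginals $\pi_U=\mathbb{P}$, $\pi_V=\mathbb{Q}$. The infimum in $R_n$ is over Borel probability measures $\mathbb{P}$ on $\mathbb{R}^{d+1}$. $\Rightarrow$ denotes convergence in distribution. $A\overset{D}{\le}B$ for random variables means $\Pr(A\ge x)\le\Pr(B\ge x)$ for all $x\in\mathbb{R}$. *)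

theory Defs
  imports "HOL-Probability.Probability"
begin

text \<open>
  A data point \<open>(x, y)\<close> is an element of \<open>(real ^ 'd) \<times> real\<close>, i.e. of \<open>R^(d+1)\<close>.
  The label is a real number, so the distributions over which the profile function minimises are
  not restricted to labels in \<open>{-1, 1}\<close>; only the transport cost keeps labels fixed.
\<close>

definition lq_norm :: "ennreal \<Rightarrow> real ^ 'd \<Rightarrow> real" where
  "lq_norm q x =
     (if q = \<infinity> then infnorm x
      else (\<Sum>i\<in>UNIV. \<bar>x $ i\<bar> powr enn2real q) powr (1 / enn2real q))"

definition logistic_h :: "real ^ 'd \<Rightarrow> real \<Rightarrow> real ^ 'd \<Rightarrow> real ^ 'd" where
  "logistic_h x y b = (- y / (1 + exp (y * (b \<bullet> x)))) *\<^sub>R x"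

definition Dx_h :: "real ^ 'd \<Rightarrow> real \<Rightarrow> real ^ 'd \<Rightarrow> real ^ 'd ^ 'd" where
  "Dx_h x y b = matrix (frechet_derivative (\<lambda>x'. logistic_h x' y b) (at x))"

text \<open>
  \<open>D\<close> is the law of \<open>(X, Y)\<close>, so that \<open>X\<close> is \<^const>\<open>fst\<close> and \<open>Y\<close> is \<^const>\<open>snd\<close>. The conditional
  probability is the conditional expectation of the event \<open>Y = 1\<close> given the sigma-algebra
  generated by \<open>X\<close>. The bounds \<open>0 < p < 1\<close> say that the log-odds are well defined; they are needed
  because \<^const>\<open>ln\<close> and division are total.
\<close>

definition logistic_model :: "((real ^ 'd) \<times> real) measure \<Rightarrow> real ^ 'd \<Rightarrow> bool" where
  "logistic_model D b \<longleftrightarrow>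
     prob_space D \<and> sets D = sets borel \<and> (AE z in D. snd z \<in> {-1, 1}) \<and>
     (AE z in D.
        let p = real_cond_exp D (vimage_algebra UNIV fst borel) (indicator {w. snd w = 1}) z
        in 0 < p \<and> p < 1 \<and> ln (p / (1 - p)) = b \<bullet> fst z)"

definition N_cost :: "ennreal \<Rightarrow> (real ^ 'd) \<times> real \<Rightarrow> (real ^ 'd) \<times> real \<Rightarrow> ennreal" where
  "N_cost q z w = (if snd z = snd w then ennreal (lq_norm q (fst z - fst w)) else \<infinity>)"

definition couplings ::
    "'a::topological_space measure \<Rightarrow> 'a measure \<Rightarrow> ('a \<times> 'a) measure set" where
  "couplings P Q =
     {\<pi>. prob_space \<pi> \<and> sets \<pi> = sets (borel \<Otimes>\<^sub>M borel) \<and>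
         distr \<pi> borel fst = P \<and> distr \<pi> borel snd = Q}"

definition transport_cost ::
    "('a::topological_space \<Rightarrow> 'a \<Rightarrow> ennreal) \<Rightarrow> 'a measure \<Rightarrow> 'a measure \<Rightarrow> ennreal" where
  "transport_cost c P Q = (INF \<pi>\<in>couplings P Q. \<integral>\<^sup>+ w. c (fst w) (snd w) \<partial>\<pi>)"

definition empirical :: "nat \<Rightarrow> (nat \<Rightarrow> 'a::topological_space) \<Rightarrow> 'a measure" where
  "empirical n z = distr (uniform_count_measure {..<n}) borel z"

text \<open>
  Integrability is demanded explicitly because the integral of a non-integrable function is \<open>0\<close>
  in the library. When \<open>Q\<close> is an empirical measure of at least one point, the value is finite:
  moving every \<open>x\<close> to \<open>0\<close> makes the moment vanish. Hence \<^const>\<open>enn2real\<close> loses nothing there.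
\<close>

definition profile ::
    "ennreal \<Rightarrow> real ^ 'd \<Rightarrow> ((real ^ 'd) \<times> real) measure \<Rightarrow> ennreal" where
  "profile q b Q =
     (INF P\<in>{P. prob_space P \<and> sets P = sets borel \<and>
                integrable P (\<lambda>(x, y). logistic_h x y b) \<and>
                (\<integral>(x, y). logistic_h x y b \<partial>P) = 0}.
        transport_cost (N_cost q) P Q)"

definition outer :: "real ^ 'd \<Rightarrow> real ^ 'd \<Rightarrow> real ^ 'd ^ 'd" where
  "outer u v = (\<chi> i j. u $ i * v $ j)"

text \<open>
  A random vector \<open>Z\<close> has law \<open>N(0, S)\<close> if every linear functional \<open>u \<bullet> Z\<close> has the univariate
  normal law with mean \<open>0\<close> and variance \<open>u \<bullet> (S *v u)\<close>; variance \<open>0\<close> means the point mass at \<open>0\<close>.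
\<close>

definition centered_normal :: "'a measure \<Rightarrow> ('a \<Rightarrow> real ^ 'd) \<Rightarrow> real ^ 'd ^ 'd \<Rightarrow> bool" where
  "centered_normal N Z S \<longleftrightarrow>
     prob_space N \<and> Z \<in> borel_measurable N \<and> transpose S = S \<and>
     (\<forall>u. let v = u \<bullet> (S *v u) in
        0 \<le> v \<and>
        (if v = 0 then AE w in N. u \<bullet> Z w = 0
         else distributed N lborel (\<lambda>w. u \<bullet> Z w) (\<lambda>t. ennreal (normal_density 0 (sqrt v) t))))"

text \<open>
  For a logistic model whose covariate has a positive density, the set below contains \<open>0\<close> and is
  bounded, so real-valued suprema of linear functionals over it are genuine.
\<close>

definition dual_set ::
    "ennreal \<Rightarrow> ((real ^ 'd) \<times> real) measure \<Rightarrow> real ^ 'd \<Rightarrow> (real ^ 'd) set" where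
  "dual_set p D b = {\<xi>. esssup D (\<lambda>(x, y). ereal (lq_norm p (\<xi> v* Dx_h x y b))) \<le> 1}"

text \<open>
  Measurability is part of the notion: \<^const>\<open>distr\<close> along a non-measurable map is a degenerate
  measure.
\<close>

definition converges_in_distribution ::
    "'a measure \<Rightarrow> (nat \<Rightarrow> 'a \<Rightarrow> real) \<Rightarrow> 'b measure \<Rightarrow> ('b \<Rightarrow> real) \<Rightarrow> bool" where
  "converges_in_distribution M S N L \<longleftrightarrow>
     (\<forall>n. S n \<in> borel_measurable M) \<and> L \<in> borel_measurable N \<and>
     weak_conv_m (\<lambda>n. distr M borel (S n)) (distr N borel L)"

definition stochastically_le ::
    "'a measure \<Rightarrow> ('a \<Rightarrow> real) \<Rightarrow> 'b measure \<Rightarrow> ('b \<Rightarrow> real) \<Rightarrow> bool" where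
  "stochastically_le M A N B \<longleftrightarrow>
     (\<forall>t. measure M {w \<in> space M. t \<le> A w} \<le> measure N {w \<in> space N. t \<le> B w})"

end

(*
Moving mass only ever changes the moment of the score h through the functionals xi . h, and for xi in
the dual set A these are 1-Lipschitz for the transport norm. Hence sup over A of xi . H_n, with H_n the
empirical mean of h, is a lower bound of the profile function for every n.

It is also an asymptotic upper bound. If c exceeds sup over A of xi . v, then by duality every direction
xi admits a point (x, y) and a displacement w of norm at most 1 with c xi . D_x h(x, y) w > xi . v, and by
compactness finitely many triples (x, y, w) serve all unit xi and all bounded v. By full support, a
positive fraction of the data lies near each of these points, so moving those data by O(n^(-1/2)) at
total cost c / sqrt n meets every half-space; splitting mass convexifies the reachable moments, and a
separating hyperplane argument gives cost at most c / sqrt n. The limit law then follows from the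
multivariate central limit theorem, since the support function of A is Lipschitz.

For the domination: if beta is nonzero, D_x h is unbounded along directions orthogonal to beta, so A lies
on the line through beta and the claim compares two one-dimensional centred normal laws; if beta = 0,
2 Z and Z' have the same law and A is the ball of radius 2 of the dual norm.
*)

theory Submission
  imports Defs "HOL-Real_Asymp.Real_Asymp"
begin


section \<open>Dual norms\<close>

text \<open>Two kinds of slack shape the argument. The ascent inequality is made strict by replacing
  the support function at v by that value plus some \<epsilon> > 0. Strictness is an open condition
  in \<xi>, v and x together; this is what lets finitely many displacements serve all \<xi> and v,
  and lets the moved observations lie anywhere near the chosen points. The normalised score is
  random and merely tight, so v is confined to a ball that it leaves with small probability only.
  Off a rare event the two bounds then differ by at most \<epsilon>, so the scaled profile and the
  support function of the normalised score are close in probability. No duality theorem for optimal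
  transport enters: \<xi> occurs only as a linear functional on R^d, tested against a coupling for
  the lower bound and normal to a separating hyperplane for the upper one. Limits in law are handled
  through characteristic functions, where the central limit theorem, continuous mapping and
  closeness in probability combine directly.\<close>

text \<open>The assumption \<open>1 < q\<close> excludes the pair p = \<infinity>, q = 1. Hence p is
  always finite, and only q = \<infinity> has to be separated from a pair of real exponents.\<close>

lemma conj_exponents_cases [consumes 2, case_names infinite finite]:
  fixes p q :: ennreal
  assumes "1 < q" "1 / p + 1 / q = 1"
  obtains "p = 1" "q = \<infinity>"
    | r s where "1 < r" "1 < s" "1 / r + 1 / s = 1" "p = ennreal r" "q = ennreal s"
proof (cases q)
  case top
  then have "inverse p = 1" using assms by (simp add: divide_ennreal_def)
  then have "p = 1"
    by (cases p; cases "p = 0") (auto simp: inverse_ennreal ennreal_1[symmetric] simp del: ennreal_1)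
  then show ?thesis using that(1) top by simp
next
  case (real s)
  then have s: "1 < s" using assms(1) by (simp add: ennreal_1[symmetric] ennreal_less_iff del: ennreal_1)
  then have qs: "1 / q = ennreal (1 / s)"
    using real by (simp add: divide_ennreal_def inverse_ennreal inverse_eq_divide)
  show ?thesis
  proof (cases p)
    case top
    then have "1 / s = 1" using qs assms(2) s
      by (simp add: divide_ennreal_def ennreal_1[symmetric] del: ennreal_1)
    then show ?thesis using s by simp
  next
    case p: (real r)
    have "r \<noteq> 0" using p assms(2) by (auto simp: divide_ennreal_def)
    then have r: "0 < r" using p by simp
    then have "ennreal (1 / r + 1 / s) = 1"
      using qs assms(2) s p by (simp add: divide_ennreal_def inverse_ennreal inverse_eq_divide)
    then have e: "1 / r + 1 / s = 1"
      using r s by (simp add: ennreal_1[symmetric] ennreal_plus[symmetric] del: ennreal_1 ennreal_plus)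
    moreover have "0 < 1 / s" using s by simp
    ultimately have "1 / r < 1" by linarith
    then have "1 < r" using r by (simp add: field_simps)
    then show ?thesis using that(2) s e p real by blast
  qed
qed

lemma lq_norm_infinity: "lq_norm \<infinity> x = infnorm x" "lq_norm \<top> x = infnorm x"
  by (simp_all add: lq_norm_def)

lemma lq_norm_ennreal:
  "0 \<le> s \<Longrightarrow> lq_norm (ennreal s) x = (\<Sum>i\<in>UNIV. \<bar>x $ i\<bar> powr s) powr (1 / s)"
  by (simp add: lq_norm_def)

lemma lq_norm_one: "lq_norm 1 x = (\<Sum>i\<in>UNIV. \<bar>x $ i\<bar>)"
  using lq_norm_ennreal[of 1 x] by (simp add: sum_nonneg)

lemma one_le_ennreal_cases [consumes 1, case_names infinite finite]:
  fixes q :: ennreal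
  assumes "1 \<le> q"
  obtains "q = \<infinity>" | s where "1 \<le> s" "q = ennreal s"
  using assms by (cases q) (auto simp: ennreal_1[symmetric] simp del: ennreal_1)

lemma lq_norm_nonneg [simp]: "0 \<le> lq_norm q x"
  by (simp add: lq_norm_def infnorm_pos_le)

lemma lq_norm_scaleR:
  assumes "1 \<le> q" shows "lq_norm q (c *\<^sub>R x) = \<bar>c\<bar> * lq_norm q x"
  using assms
proof (cases rule: one_le_ennreal_cases)
  case (finite s)
  have "(\<Sum>i\<in>UNIV. \<bar>(c *\<^sub>R x) $ i\<bar> powr s) = \<bar>c\<bar> powr s * (\<Sum>i\<in>UNIV. \<bar>x $ i\<bar> powr s)"
    by (simp add: abs_mult powr_mult sum_distrib_left)
  then show ?thesis using finite
    by (cases "c = 0") (auto simp: lq_norm_ennreal powr_mult powr_powr sum_nonneg)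
qed (simp add: lq_norm_infinity infnorm_mul)

lemma lq_norm_minus [simp]: "1 \<le> q \<Longrightarrow> lq_norm q (- x) = lq_norm q x"
  using lq_norm_scaleR[of q "-1" x] by simp

lemma lq_norm_zero [simp]: "1 \<le> q \<Longrightarrow> lq_norm q 0 = 0"
  using lq_norm_scaleR[of q 0 0] by simp

lemma continuous_on_lq_norm:
  assumes "1 \<le> q" shows "continuous_on UNIV (lq_norm q)"
  using assms
proof (cases rule: one_le_ennreal_cases)
  case infinite
  then show ?thesis
    by (auto simp: lq_norm_infinity[abs_def] lq_norm_infinity(2)[abs_def] continuous_on_eq_continuous_at isCont_def tendsto_infnorm)
next
  case (finite s)
  have "continuous_on UNIV (\<lambda>x::real^'a. (\<Sum>i\<in>UNIV. \<bar>x $ i\<bar> powr s) powr (1 / s))"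
    using finite by (intro continuous_on_powr' continuous_intros ballI conjI impI) (auto intro!: sum_nonneg)
  moreover have "lq_norm q = (\<lambda>x::real^'a. (\<Sum>i\<in>UNIV. \<bar>x $ i\<bar> powr s) powr (1 / s))"
    using finite by (intro ext) (simp add: lq_norm_ennreal)
  ultimately show ?thesis by simp
qed

lemma borel_measurable_lq_norm [measurable]: "1 \<le> q \<Longrightarrow> lq_norm q \<in> borel_measurable borel"
  by (rule borel_measurable_continuous_onI[OF continuous_on_lq_norm])

lemma component_le_lq_norm:
  assumes "1 \<le> q" shows "\<bar>x $ i\<bar> \<le> lq_norm q x"
  using assms
proof (cases rule: one_le_ennreal_cases)
  case infinite
  then show ?thesis by (simp add: lq_norm_infinity component_le_infnorm_cart)
next
  case (finite s)
  have "(\<bar>x $ i\<bar> powr s) powr (1 / s) \<le> (\<Sum>i\<in>UNIV. \<bar>x $ i\<bar> powr s) powr (1 / s)"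
    using finite by (intro powr_mono2 member_le_sum) auto
  then show ?thesis using finite by (simp add: lq_norm_ennreal powr_powr)
qed

lemma norm_le_lq_norm:
  fixes x :: "real ^ 'd"
  assumes "1 \<le> q" shows "norm x \<le> real CARD('d) * lq_norm q x"
proof -
  have "norm x \<le> (\<Sum>i\<in>UNIV. \<bar>x $ i\<bar>)" by (rule norm_le_l1_cart)
  also have "\<dots> \<le> real CARD('d) * lq_norm q x"
    using component_le_lq_norm[OF assms, of x] by (intro sum_bounded_above) auto
  finally show ?thesis .
qed

lemma lq_norm_eq_0_iff: "1 \<le> q \<Longrightarrow> lq_norm q x = 0 \<longleftrightarrow> x = 0"
  using norm_le_lq_norm[of q x] by auto

text \<open>After dividing both vectors by their norms, Young's inequality in each coordinate sums
  to exactly 1 / r + 1 / s = 1.\<close>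

lemma Holder_finite:
  fixes a b :: "real ^ 'd"
  assumes rs: "1 < r" "1 < s" "1 / r + 1 / s = 1"
  shows "a \<bullet> b \<le> lq_norm (ennreal r) a * lq_norm (ennreal s) b"
proof (cases "a = 0 \<or> b = 0")
  case False
  define A where "A = lq_norm (ennreal r) a"
  define B where "B = lq_norm (ennreal s) b"
  have pos: "0 < A" "0 < B"
    using False rs lq_norm_eq_0_iff[of "ennreal r" a] lq_norm_eq_0_iff[of "ennreal s" b]
    by (auto simp: A_def B_def less_le)
  have Ar: "(\<Sum>i\<in>UNIV. \<bar>a $ i\<bar> powr r) = A powr r"
    using rs by (simp add: A_def lq_norm_ennreal powr_powr sum_nonneg)
  have Bs: "(\<Sum>i\<in>UNIV. \<bar>b $ i\<bar> powr s) = B powr s"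
    using rs by (simp add: B_def lq_norm_ennreal powr_powr sum_nonneg)
  have "a \<bullet> b / (A * B) = (\<Sum>i\<in>UNIV. a $ i * b $ i / (A * B))"
    by (simp add: inner_vec_def sum_divide_distrib)
  also have "\<dots> \<le> (\<Sum>i\<in>UNIV. (\<bar>a $ i\<bar> / A) powr r / r + (\<bar>b $ i\<bar> / B) powr s / s)"
  proof (rule sum_mono)
    fix i
    have "a $ i * b $ i \<le> \<bar>a $ i\<bar> * \<bar>b $ i\<bar>" by (metis abs_ge_self abs_mult)
    then have "a $ i * b $ i / (A * B) \<le> (\<bar>a $ i\<bar> / A) * (\<bar>b $ i\<bar> / B)"
      using pos by (simp add: divide_right_mono)
    also have "\<dots> \<le> (\<bar>a $ i\<bar> / A) powr r / r + (\<bar>b $ i\<bar> / B) powr s / s"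
      using pos rs by (intro Youngs_inequality) auto
    finally show "a $ i * b $ i / (A * B) \<le> \<dots>" .
  qed
  also have "\<dots> = (\<Sum>i\<in>UNIV. \<bar>a $ i\<bar> powr r) / A powr r / r + (\<Sum>i\<in>UNIV. \<bar>b $ i\<bar> powr s) / B powr s / s"
    using pos by (simp add: sum.distrib sum_divide_distrib powr_divide)
  also have "\<dots> = 1" unfolding Ar Bs using pos rs(3) by simp
  finally show ?thesis using pos by (simp add: A_def B_def field_simps)
qed auto

lemma Holder_one_infinity: "a \<bullet> b \<le> lq_norm 1 a * lq_norm \<infinity> b"
proof -
  have "a $ i * b $ i \<le> \<bar>a $ i\<bar> * infnorm b" for i
  proof -
    have "a $ i * b $ i \<le> \<bar>a $ i\<bar> * \<bar>b $ i\<bar>" by (metis abs_ge_self abs_mult)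
    also have "\<dots> \<le> \<bar>a $ i\<bar> * infnorm b" by (intro mult_left_mono component_le_infnorm_cart) auto
    finally show ?thesis .
  qed
  then show ?thesis
    by (simp add: lq_norm_one lq_norm_infinity inner_vec_def sum_distrib_right sum_mono)
qed

lemma lq_norm_Holder:
  fixes a b :: "real ^ 'd"
  assumes "1 < q" "1 / p + 1 / q = 1"
  shows "a \<bullet> b \<le> lq_norm p a * lq_norm q b"
  using assms Holder_one_infinity Holder_finite
  by (cases rule: conj_exponents_cases) auto

text \<open>Together with Hoelder's inequality this identifies the r-norm as the dual of the s-norm;
  attainment turns a bound on all pairings into a bound on the norm.\<close>

lemma Holder_finite_attained:
  fixes a :: "real ^ 'd"
  assumes rs: "1 < r" "1 < s" "1 / r + 1 / s = 1"
  shows "\<exists>w. lq_norm (ennreal s) w \<le> 1 \<and> a \<bullet> w = lq_norm (ennreal r) a"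
proof (cases "a = 0")
  case True
  then show ?thesis using rs by (intro exI[of _ 0]) auto
next
  case False
  define A where "A = (\<Sum>i\<in>UNIV. \<bar>a $ i\<bar> powr r)"
  \<comment> \<open>Equality in Young's inequality forces |w_i|^s to be proportional to |a_i|^r.
    Since (r - 1) s = r, the power r - 1 achieves this, and the denominator makes the s-norm equal
    to 1.\<close>
  define w :: "real ^ 'd" where "w = (\<chi> i. sgn (a $ i) * \<bar>a $ i\<bar> powr (r - 1) / A powr (1 / s))"
  have "A \<noteq> 0"
    using False rs lq_norm_eq_0_iff[of "ennreal r" a] by (auto simp: A_def lq_norm_ennreal)
  then have A: "0 < A" by (simp add: A_def less_le sum_nonneg)
  have e: "(r - 1) * s = r" using rs by (simp add: field_simps)
  have "\<bar>w $ i\<bar> powr s = \<bar>a $ i\<bar> powr r / A" for i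
    using A e rs by (simp add: w_def abs_mult powr_mult powr_divide powr_powr abs_sgn_eq)
  then have "(\<Sum>i\<in>UNIV. \<bar>w $ i\<bar> powr s) = 1"
    using A by (simp add: sum_divide_distrib[symmetric] A_def)
  then have 1: "lq_norm (ennreal s) w = 1" using rs by (simp add: lq_norm_ennreal)
  have "a $ i * w $ i = \<bar>a $ i\<bar> powr r / A powr (1 / s)" for i
  proof (cases "a $ i = 0")
    case False
    have "a $ i * sgn (a $ i) * \<bar>a $ i\<bar> powr (r - 1) = \<bar>a $ i\<bar> powr r"
      using False by (simp add: abs_sgn[symmetric] powr_diff)
    then show ?thesis by (simp add: w_def)
  qed simp
  then have "a \<bullet> w = A / A powr (1 / s)"
    by (simp add: inner_vec_def A_def sum_divide_distrib)
  also have "\<dots> = A powr (1 - 1 / s)" using A by (simp add: powr_diff)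
  also have "1 - 1 / s = 1 / r" using rs(3) by simp
  also have "A powr (1 / r) = lq_norm (ennreal r) a" using rs by (simp add: A_def lq_norm_ennreal)
  finally show ?thesis using 1 by (intro exI[of _ w]) auto
qed

lemma lq_norm_attained:
  fixes a :: "real ^ 'd"
  assumes "1 < q" "1 / p + 1 / q = 1"
  shows "\<exists>w. lq_norm q w \<le> 1 \<and> a \<bullet> w = lq_norm p a"
  using assms
proof (cases rule: conj_exponents_cases)
  case infinite
  define w :: "real ^ 'd" where "w = (\<chi> i. sgn (a $ i))"
  have "infnorm w \<le> 1"
    unfolding infnorm_cart by (rule cSup_least) (auto simp: w_def abs_sgn_eq)
  moreover have "a \<bullet> w = lq_norm 1 a"
    by (simp add: inner_vec_def w_def lq_norm_one abs_sgn)
  ultimately show ?thesis using infinite by (auto simp: lq_norm_infinity)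
next
  case (finite r s)
  then show ?thesis using Holder_finite_attained by auto
qed

text \<open>A norm given as a maximum of linear functionals is subadditive: pair x + y with its
  maximiser and bound the two summands by Hoelder. The exponents exchange roles here, the s-norm
  being the one that is dualised.\<close>

lemma lq_norm_triangle:
  fixes x y :: "real ^ 'd"
  assumes "1 < q" "1 / p + 1 / q = 1"
  shows "lq_norm q (x + y) \<le> lq_norm q x + lq_norm q y"
  using assms
proof (cases rule: conj_exponents_cases)
  case infinite
  then show ?thesis by (simp add: lq_norm_infinity infnorm_triangle)
next
  case (finite r s)
  then have sr: "1 / s + 1 / r = 1" by simp
  obtain w where w: "lq_norm p w \<le> 1" "(x + y) \<bullet> w = lq_norm q (x + y)"
    using Holder_finite_attained[OF finite(2,1) sr] finite by metis
  have H: "z \<bullet> w \<le> lq_norm q z" for z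
    using Holder_finite[OF finite(2,1) sr, of z w] w(1)
      mult_left_mono[OF w(1), of "lq_norm q z"] finite by auto
  show ?thesis using w(2) H[of x] H[of y] by (simp add: inner_add_left)
qed

lemma conj_exponent_ge_1:
  fixes p q :: ennreal
  assumes "1 < q" "1 / p + 1 / q = 1" shows "1 \<le> p"
  using assms by (cases rule: conj_exponents_cases) (auto simp: ennreal_1[symmetric] simp del: ennreal_1)


section \<open>The gradient of the score\<close>

text \<open>\<open>hgrad b y \<xi> x\<close> is the row vector \<open>\<xi>\<^sup>T D\<^sub>x h(x, y; b)\<close>, written out.\<close>

definition hgrad :: "real ^ 'd \<Rightarrow> real \<Rightarrow> real ^ 'd \<Rightarrow> real ^ 'd \<Rightarrow> real ^ 'd" where
  "hgrad b y \<xi> x = (- y / (1 + exp (y * (b \<bullet> x)))) *\<^sub>R \<xi>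
     + (y\<^sup>2 * exp (y * (b \<bullet> x)) / (1 + exp (y * (b \<bullet> x)))\<^sup>2 * (\<xi> \<bullet> x)) *\<^sub>R b"

lemma one_plus_exp_neq_0 [simp]: "1 + exp (t::real) \<noteq> 0"
  by (metis add_pos_pos exp_gt_zero less_irrefl zero_less_one)

lemma logistic_h_has_derivative:
  "((\<lambda>x. logistic_h x y b) has_derivative
     (\<lambda>w. (- y / (1 + exp (y * (b \<bullet> x)))) *\<^sub>R w
        + (y\<^sup>2 * exp (y * (b \<bullet> x)) / (1 + exp (y * (b \<bullet> x)))\<^sup>2 * (b \<bullet> w)) *\<^sub>R x)) (at x)"
  unfolding logistic_h_def
  by (rule derivative_eq_intros refl | simp)+
     (auto simp: fun_eq_iff power2_eq_square field_simps)

text \<open>\<open>hgrad\<close> is the transpose of the derivative applied to \<open>\<xi>\<close>.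
  Moving the derivative onto \<open>\<xi>\<close> lets the p-norm of a single vector control
  displacements in every direction.\<close>

lemma inner_hgrad:
  "hgrad b y \<xi> x \<bullet> w = \<xi> \<bullet> ((- y / (1 + exp (y * (b \<bullet> x)))) *\<^sub>R w
        + (y\<^sup>2 * exp (y * (b \<bullet> x)) / (1 + exp (y * (b \<bullet> x)))\<^sup>2 * (b \<bullet> w)) *\<^sub>R x)"
  by (simp add: hgrad_def inner_add_left inner_add_right inner_diff_left inner_diff_right inner_commute)

lemma vector_matrix_Dx_h: "\<xi> v* Dx_h x y b = hgrad b y \<xi> x"
proof -
  let ?L = "frechet_derivative (\<lambda>x'. logistic_h x' y b) (at x)"
  have L: "?L = (\<lambda>w. (- y / (1 + exp (y * (b \<bullet> x)))) *\<^sub>R w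
        + (y\<^sup>2 * exp (y * (b \<bullet> x)) / (1 + exp (y * (b \<bullet> x)))\<^sup>2 * (b \<bullet> w)) *\<^sub>R x)"
    by (rule frechet_derivative_at[OF logistic_h_has_derivative, symmetric])
  have lin: "linear ?L"
    using logistic_h_has_derivative[of y b x] unfolding L by (rule has_derivative_linear)
  have "(\<xi> v* matrix ?L) \<bullet> w = hgrad b y \<xi> x \<bullet> w" for w
    by (simp only: dot_lmul_matrix matrix_vector_mul(2)[OF lin] inner_hgrad) (simp only: L)
  then show ?thesis unfolding Dx_h_def by (metis vector_eq_rdot)
qed

text \<open>A vector-valued map has no mean value point in general, but each scalar functional of it
  does along the segment; the point depends on \<open>\<xi>\<close>.\<close>

lemma logistic_h_mean_value:
  "\<exists>z\<in>closed_segment v u. \<xi> \<bullet> logistic_h u y b - \<xi> \<bullet> logistic_h v y b = hgrad b y \<xi> z \<bullet> (u - v)"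
proof -
  define \<phi> where "\<phi> t = \<xi> \<bullet> logistic_h (v + t *\<^sub>R (u - v)) y b" for t
  have D: "(\<phi> has_real_derivative hgrad b y \<xi> (v + t *\<^sub>R (u - v)) \<bullet> (u - v)) (at t)" for t
  proof -
    let ?L = "\<lambda>x w. (- y / (1 + exp (y * (b \<bullet> x)))) *\<^sub>R w
        + (y\<^sup>2 * exp (y * (b \<bullet> x)) / (1 + exp (y * (b \<bullet> x)))\<^sup>2 * (b \<bullet> w)) *\<^sub>R x"
    have "((\<lambda>t. logistic_h (v + t *\<^sub>R (u - v)) y b) has_derivative
      (\<lambda>s. ?L (v + t *\<^sub>R (u - v)) (s *\<^sub>R (u - v)))) (at t)"
      by (rule has_derivative_compose[OF _ logistic_h_has_derivative, simplified o_def])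
         (auto intro!: derivative_eq_intros)
    then have "(\<phi> has_derivative (\<lambda>s. \<xi> \<bullet> ?L (v + t *\<^sub>R (u - v)) (s *\<^sub>R (u - v)))) (at t)"
      unfolding \<phi>_def by (rule has_derivative_inner_right)
    moreover have "\<xi> \<bullet> ?L x (s *\<^sub>R (u - v)) = (hgrad b y \<xi> x \<bullet> (u - v)) * s" for x s
      by (simp only: inner_hgrad[symmetric]) simp
    ultimately show ?thesis
      unfolding has_field_derivative_def by (simp only:)
  qed
  obtain t where t: "0 < t" "t < 1" "\<phi> 1 - \<phi> 0 = (1 - 0) * (hgrad b y \<xi> (v + t *\<^sub>R (u - v)) \<bullet> (u - v))"
    using MVT2[of 0 1 \<phi> "\<lambda>t. hgrad b y \<xi> (v + t *\<^sub>R (u - v)) \<bullet> (u - v)"] D by auto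
  then have "v + t *\<^sub>R (u - v) \<in> closed_segment v u"
    by (auto simp: in_segment algebra_simps intro!: exI[of _ t])
  then show ?thesis using t(3) by (intro bexI) (auto simp: \<phi>_def)
qed

lemma continuous_on_hgrad [continuous_intros]:
  assumes "continuous_on S f" "continuous_on S g" "continuous_on S k"
  shows "continuous_on S (\<lambda>s. hgrad b (k s) (f s) (g s))"
  unfolding hgrad_def by (intro continuous_intros assms ballI) auto

lemma continuous_on_logistic_h [continuous_intros]:
  assumes "continuous_on S f" "continuous_on S g"
  shows "continuous_on S (\<lambda>s. logistic_h (f s) (g s) b)"
  unfolding logistic_h_def by (intro continuous_intros assms ballI) auto

lemma hgrad_scaleR: "hgrad b y (c *\<^sub>R \<xi>) x = c *\<^sub>R hgrad b y \<xi> x"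
  by (simp add: hgrad_def scaleR_right_distrib scaleR_right_diff_distrib mult_ac)

lemma hgrad_0 [simp]: "hgrad b y \<xi> 0 = (- y / 2) *\<^sub>R \<xi>"
  by (simp add: hgrad_def)

section \<open>The dual set and its support function\<close>

text \<open>The dual set with the essential supremum replaced by a bound at every point, which frees
  it from the law \<open>D\<close>.\<close>

definition slope_set :: "ennreal \<Rightarrow> real ^ 'd \<Rightarrow> (real ^ 'd) set" where
  "slope_set p b = {\<xi>. \<forall>x. \<forall>y\<in>{-1, 1}. lq_norm p (hgrad b y \<xi> x) \<le> 1}"

definition support_fun :: "(real ^ 'd) set \<Rightarrow> real ^ 'd \<Rightarrow> real" where
  "support_fun A v = (SUP \<xi>\<in>A. \<xi> \<bullet> v)"

text \<open>The norm of the slope is continuous in x, so a single violation spreads to an open set,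
  and full support gives that set positive mass for the label in question. The other inclusion uses
  only that the labels are almost surely -1 or 1.\<close>

lemma dual_set_eq_slope_set:
  fixes D :: "((real ^ 'd) \<times> real) measure"
  assumes p: "1 \<le> p" and sets: "sets D = sets borel"
    and labels: "AE z in D. snd z \<in> {-1, 1}"
    and support: "\<And>U y. open U \<Longrightarrow> U \<noteq> {} \<Longrightarrow> y \<in> {-1, 1} \<Longrightarrow> emeasure D (U \<times> {y}) \<noteq> 0"
  shows "dual_set p D b = slope_set p b"
proof (intro set_eqI)
  fix \<xi> :: "real ^ 'd"
  have "(\<lambda>z. lq_norm p (hgrad b (snd z) \<xi> (fst z))) \<in> borel_measurable borel"
    by (intro borel_measurable_continuous_onI continuous_on_compose2[OF continuous_on_lq_norm[OF p]]
        continuous_intros) auto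
  then have m: "(\<lambda>(x, y). ereal (lq_norm p (\<xi> v* Dx_h x y b))) \<in> borel_measurable D"
    unfolding measurable_cong_sets[OF sets refl] by (simp add: vector_matrix_Dx_h case_prod_beta)
  show "\<xi> \<in> dual_set p D b \<longleftrightarrow> \<xi> \<in> slope_set p b"
  proof
    assume "\<xi> \<in> slope_set p b"
    then have "AE z in D. (case z of (x, y) \<Rightarrow> ereal (lq_norm p (\<xi> v* Dx_h x y b))) \<le> 1"
      using labels by (auto simp: slope_set_def vector_matrix_Dx_h case_prod_beta elim!: eventually_mono)
    then show "\<xi> \<in> dual_set p D b"
      unfolding dual_set_def using esssup_I[OF m] by blast
  next
    assume "\<xi> \<in> dual_set p D b"
    then have "AE z in D. (case z of (x, y) \<Rightarrow> ereal (lq_norm p (\<xi> v* Dx_h x y b))) \<le> 1"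
      using esssup_AE[where M = D and f = "\<lambda>(x, y). ereal (lq_norm p (\<xi> v* Dx_h x y b))"]
      by (auto simp: dual_set_def elim!: eventually_mono intro: order_trans)
    then have ae: "AE z in D. lq_norm p (hgrad b (snd z) \<xi> (fst z)) \<le> 1"
      by (simp add: vector_matrix_Dx_h case_prod_beta)
    show "\<xi> \<in> slope_set p b"
    proof (rule ccontr)
      assume "\<xi> \<notin> slope_set p b"
      then obtain x y where y: "y \<in> {-1, 1}" and x: "1 < lq_norm p (hgrad b y \<xi> x)"
        by (auto simp: slope_set_def not_le)
      define U where "U = {x. 1 < lq_norm p (hgrad b y \<xi> x)}"
      have "open U" unfolding U_def
        by (intro open_Collect_less continuous_on_compose2[OF continuous_on_lq_norm[OF p]]
            continuous_intros) auto
      moreover have "U \<noteq> {}" using x by (auto simp: U_def)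
      moreover have "emeasure D (U \<times> {y}) = 0"
      proof (rule AE_E[OF ae])
        fix N assume N: "{z \<in> space D. \<not> lq_norm p (hgrad b (snd z) \<xi> (fst z)) \<le> 1} \<subseteq> N"
          "emeasure D N = 0" "N \<in> sets D"
        have "space D = UNIV" using sets_eq_imp_space_eq[OF sets] by simp
        then have "U \<times> {y} \<subseteq> N" using N(1) by (auto simp: U_def not_le)
        then show ?thesis using N(2,3) emeasure_mono[of _ N D] by (metis le_zero_eq)
      qed
      ultimately show False using support y by blast
    qed
  qed
qed

text \<open>At x = 0 the slope is \<open>\<xi>\<close> times -y / 2, whence the constant 2. It is
  sharp for b = 0, where the slope has this value at every x.\<close>

lemma lq_norm_slope_set:
  assumes "1 \<le> p" "\<xi> \<in> slope_set p b" shows "lq_norm p \<xi> \<le> 2"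
proof -
  have "lq_norm p (hgrad b 1 \<xi> 0) \<le> 1"
    using assms(2) by (auto simp: slope_set_def simp del: hgrad_0)
  then show ?thesis using assms(1) by (simp add: lq_norm_scaleR)
qed

lemma slope_set_subset_cball:
  fixes b :: "real ^ 'd"
  assumes "1 \<le> p" shows "slope_set p b \<subseteq> cball 0 (2 * real CARD('d))"
proof
  fix \<xi> assume "\<xi> \<in> slope_set p b"
  then show "\<xi> \<in> cball 0 (2 * real CARD('d))"
    using norm_le_lq_norm[OF assms, of \<xi>]
      mult_left_mono[OF lq_norm_slope_set[OF assms, of \<xi> b], of "real CARD('d)"]
    unfolding mem_cball_0 by linarith
qed

lemma zero_in_slope_set: "1 \<le> p \<Longrightarrow> 0 \<in> slope_set p b"
  using hgrad_scaleR[of b _ 0 0] by (simp add: slope_set_def)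

lemma inner_le_support_fun:
  fixes A :: "(real ^ 'd) set"
  assumes "A \<subseteq> cball 0 C" "\<xi> \<in> A"
  shows "\<xi> \<bullet> v \<le> support_fun A v"
  unfolding support_fun_def
proof (rule cSUP_upper[OF assms(2)])
  have "\<xi> \<bullet> v \<le> C * norm v" if "\<xi> \<in> A" for \<xi>
    using norm_cauchy_schwarz[of \<xi> v] mult_right_mono[of "norm \<xi>" C "norm v"] assms(1) that
    by (auto simp: mem_cball_0 subset_iff)
  then show "bdd_above ((\<lambda>\<xi>. \<xi> \<bullet> v) ` A)" by (intro bdd_aboveI2[of _ _ "C * norm v"])
qed

lemma support_fun_lipschitz:
  fixes A :: "(real ^ 'd) set"
  assumes A: "A \<subseteq> cball 0 C" and "A \<noteq> {}"
  shows "C-lipschitz_on UNIV (support_fun A)"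
proof (rule lipschitz_onI)
  have *: "support_fun A v \<le> support_fun A w + C * norm (v - w)" for v w
    unfolding support_fun_def[of A v]
  proof (rule cSUP_least[OF assms(2)])
    fix \<xi> assume \<xi>: "\<xi> \<in> A"
    have "\<xi> \<bullet> (v - w) \<le> C * norm (v - w)"
      using norm_cauchy_schwarz[of \<xi> "v - w"] mult_right_mono[of "norm \<xi>" C "norm (v - w)"] A \<xi>
      by (auto simp: mem_cball_0 subset_iff)
    moreover have "\<xi> \<bullet> w \<le> support_fun A w" by (rule inner_le_support_fun[OF A \<xi>])
    ultimately show "\<xi> \<bullet> v \<le> support_fun A w + C * norm (v - w)" by (simp add: inner_diff_right)
  qed
  show "dist (support_fun A v) (support_fun A w) \<le> C * dist v w" for v w
    using *[of v w] *[of w v] by (simp add: dist_real_def dist_norm norm_minus_commute)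
  show "0 \<le> C" using assms by (meson all_not_in_conv mem_cball_0 norm_ge_zero order_trans subsetD)
qed

lemma support_fun_nonneg:
  fixes A :: "(real ^ 'd) set"
  assumes "A \<subseteq> cball 0 C" "0 \<in> A" shows "0 \<le> support_fun A v"
  using inner_le_support_fun[OF assms, of v] by simp

text \<open>The slope at the mean value point has p-norm at most 1, so Hoelder's inequality turns
  the increment into the transport cost of a move that keeps the label.\<close>

lemma slope_set_lipschitz:
  assumes "1 < q" "1 / p + 1 / q = 1" "\<xi> \<in> slope_set p b" "y \<in> {-1, 1}"
  shows "\<xi> \<bullet> logistic_h u y b - \<xi> \<bullet> logistic_h v y b \<le> lq_norm q (u - v)"
proof -
  obtain z where z: "\<xi> \<bullet> logistic_h u y b - \<xi> \<bullet> logistic_h v y b = hgrad b y \<xi> z \<bullet> (u - v)"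
    using logistic_h_mean_value by blast
  have "hgrad b y \<xi> z \<bullet> (u - v) \<le> lq_norm p (hgrad b y \<xi> z) * lq_norm q (u - v)"
    by (rule lq_norm_Holder[OF assms(1,2)])
  also have "\<dots> \<le> 1 * lq_norm q (u - v)"
    using assms(3,4) by (intro mult_right_mono) (auto simp: slope_set_def)
  finally show ?thesis using z by simp
qed

text \<open>
  If no displacement direction beat \<open>\<xi> \<bullet> v\<close>, then \<open>\<xi>\<close>, rescaled so that \<open>\<xi> \<bullet> v = c\<close>, would lie in
  the slope set, forcing \<open>c \<le> support_fun A v\<close>.
\<close>

lemma exists_ascent_direction:
  fixes \<xi> v :: "real ^ 'd"
  assumes q: "1 < q" and conj: "1 / p + 1 / q = 1"
    and c: "support_fun (slope_set p b) v < c" and "\<xi> \<noteq> 0"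
  shows "\<exists>x w. \<exists>y\<in>{-1, 1}. lq_norm q w \<le> 1 \<and> \<xi> \<bullet> v < c * (hgrad b y \<xi> x \<bullet> w)"
proof (rule ccontr)
  assume contr: "\<not> ?thesis"
  have p: "1 \<le> p" by (rule conj_exponent_ge_1[OF q conj])
  have "0 \<le> support_fun (slope_set p b) v"
    by (rule support_fun_nonneg[OF slope_set_subset_cball[OF p] zero_in_slope_set[OF p]])
  then have c0: "0 < c" using c by simp
  \<comment> \<open>The negated claim is tested at the displacement that attains the dual norm of
    the slope.\<close>
  have le: "c * lq_norm p (hgrad b y \<xi> x) \<le> \<xi> \<bullet> v" if "y \<in> {-1, 1}" for x y
    using contr that lq_norm_attained[OF q conj, of "hgrad b y \<xi> x"] by (metis not_le)
  have "0 < lq_norm p \<xi>"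
    using \<open>\<xi> \<noteq> 0\<close> lq_norm_eq_0_iff[OF p, of \<xi>] lq_norm_nonneg[of p \<xi>] by linarith
  then have "0 < c * lq_norm p (hgrad b 1 \<xi> 0)" using c0 p by (simp add: lq_norm_scaleR)
  \<comment> \<open>At x = 0 the slope is a nonzero multiple of \<open>\<xi>\<close>, so the pairing
    with v is strictly positive and the rescaling makes sense.\<close>
  then have pos: "0 < \<xi> \<bullet> v" using le[of 1 0] by simp
  have "(c / (\<xi> \<bullet> v)) *\<^sub>R \<xi> \<in> slope_set p b"
    using le pos c0 p by (auto simp: slope_set_def hgrad_scaleR lq_norm_scaleR)
  then have "((c / (\<xi> \<bullet> v)) *\<^sub>R \<xi>) \<bullet> v \<le> support_fun (slope_set p b) v"
    by (rule inner_le_support_fun[OF slope_set_subset_cball[OF p]])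
  then show False using pos c by simp
qed

text \<open>
  For \<open>b \<noteq> 0\<close> the derivative of the score is unbounded along directions orthogonal to \<open>b\<close>, so
  the slope set collapses onto the line through \<open>b\<close>.
\<close>

lemma slope_set_subset_line:
  fixes \<xi> b :: "real ^ 'd"
  assumes p: "1 \<le> p" and "b \<noteq> 0" and \<xi>: "\<xi> \<in> slope_set p b"
  obtains t where "\<xi> = t *\<^sub>R b"
proof -
  define t where "t = (\<xi> \<bullet> b) / (b \<bullet> b)"
  define \<eta> where "\<eta> = \<xi> - t *\<^sub>R b"
  have orth: "b \<bullet> \<eta> = 0" using \<open>b \<noteq> 0\<close> by (simp add: \<eta>_def t_def inner_diff_right inner_commute)
  have \<xi>\<eta>: "\<xi> \<bullet> \<eta> = \<eta> \<bullet> \<eta>"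
  proof -
    have "\<xi> = \<eta> + t *\<^sub>R b" by (simp add: \<eta>_def)
    then show ?thesis using orth by (simp add: inner_add_left)
  qed
  have "\<eta> = 0"
  proof (rule ccontr)
    assume "\<eta> \<noteq> 0"
    \<comment> \<open>Along multiples of \<open>\<eta>\<close> the exponent stays 0, so the logistic
      weights keep the values 1/2 and 1/4, while the pairing of \<open>\<xi>\<close> with the point
      grows linearly; \<open>k\<close> is the resulting growth rate.\<close>
    define k where "k = \<eta> \<bullet> \<eta> * norm b / 4"
    have k: "0 < k" using \<open>\<eta> \<noteq> 0\<close> \<open>b \<noteq> 0\<close> by (simp add: k_def)
    have bound: "s * k \<le> real CARD('d) + norm \<xi> / 2" if "0 \<le> s" for s
    proof -
      have eq: "hgrad b 1 \<xi> (s *\<^sub>R \<eta>) = (- 1 / 2) *\<^sub>R \<xi> + (s * (\<eta> \<bullet> \<eta>) / 4) *\<^sub>R b"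
        by (simp add: hgrad_def orth \<xi>\<eta>)
      have "s * k = norm ((s * (\<eta> \<bullet> \<eta>) / 4) *\<^sub>R b)" using that by (simp add: k_def)
      also have "(s * (\<eta> \<bullet> \<eta>) / 4) *\<^sub>R b = hgrad b 1 \<xi> (s *\<^sub>R \<eta>) + (1 / 2) *\<^sub>R \<xi>" by (simp add: eq)
      also have "norm \<dots> \<le> norm (hgrad b 1 \<xi> (s *\<^sub>R \<eta>)) + norm \<xi> / 2"
        using norm_triangle_ineq[of "hgrad b 1 \<xi> (s *\<^sub>R \<eta>)" "(1 / 2) *\<^sub>R \<xi>"] by simp
      also have "norm (hgrad b 1 \<xi> (s *\<^sub>R \<eta>)) \<le> real CARD('d) * lq_norm p (hgrad b 1 \<xi> (s *\<^sub>R \<eta>))"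
        by (rule norm_le_lq_norm[OF p])
      also have "\<dots> \<le> real CARD('d) * 1"
        using \<xi> by (intro mult_left_mono) (auto simp: slope_set_def)
      finally show ?thesis by simp
    qed
    have "(real CARD('d) + norm \<xi> / 2 + 1) / k * k \<le> real CARD('d) + norm \<xi> / 2"
      using k by (intro bound) auto
    then show False using k by simp
  qed
  then show ?thesis using that[of t] by (simp add: \<eta>_def)
qed

text \<open>For label 1 and x = -s b with s large, the logistic weight tends to 1 while the rank-one
  term vanishes, its exponential decay beating the linear factor. The slope therefore tends to
  \<open>- \<xi>\<close>, which improves the bound 2 to 1. With 2 the comparison with the q-norm of
  the second normal vector would lose a factor.\<close>

lemma lq_norm_slope_set_le_1:
  fixes \<xi> b :: "real ^ 'd"
  assumes p: "1 \<le> p" and "b \<noteq> 0" and \<xi>: "\<xi> \<in> slope_set p b"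
  shows "lq_norm p \<xi> \<le> 1"
proof -
  define k where "k = b \<bullet> b"
  have k: "0 < k" using \<open>b \<noteq> 0\<close> by (simp add: k_def)
  have 1: "((\<lambda>s. - 1 / (1 + exp (- (s * k)))) \<longlongrightarrow> - 1) at_top"
    using k by real_asymp
  have 2: "((\<lambda>s. exp (- (s * k)) / (1 + exp (- (s * k)))\<^sup>2 * (- s * (\<xi> \<bullet> b))) \<longlongrightarrow> 0) at_top"
    using k by real_asymp
  have "((\<lambda>s. hgrad b 1 \<xi> ((- s) *\<^sub>R b)) \<longlongrightarrow> (- 1) *\<^sub>R \<xi> + 0 *\<^sub>R b) at_top"
    unfolding hgrad_def using tendsto_add[OF tendsto_scaleR[OF 1 tendsto_const] tendsto_scaleR[OF 2 tendsto_const]]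
    by (simp add: k_def)
  then have "((\<lambda>s. lq_norm p (hgrad b 1 \<xi> ((- s) *\<^sub>R b))) \<longlongrightarrow> lq_norm p ((- 1) *\<^sub>R \<xi> + 0 *\<^sub>R b)) at_top"
    using continuous_on_tendsto_compose[OF continuous_on_lq_norm[OF p]] by auto
  then have "lq_norm p ((- 1) *\<^sub>R \<xi> + 0 *\<^sub>R b) \<le> 1"
    by (rule tendsto_upperbound) (use \<xi> in \<open>auto simp: slope_set_def intro!: always_eventually\<close>)
  then show ?thesis using p by simp
qed


section \<open>Transport to an empirical measure\<close>

lemma measurable_uniform_count_measure [measurable]:
  "z \<in> uniform_count_measure A \<rightarrow>\<^sub>M borel"
  unfolding measurable_cong_sets[OF sets_uniform_count_measure_count_space refl] by simp

lemma emeasure_empirical: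
  assumes "0 < n" "E \<in> sets borel"
  shows "emeasure (empirical n z) E = ennreal (real (card {i\<in>{..<n}. z i \<in> E}) / real n)"
proof -
  have "z -` E \<inter> space (uniform_count_measure {..<n}) = {i\<in>{..<n}. z i \<in> E}"
    by (auto simp: space_uniform_count_measure)
  then show ?thesis using assms
    by (simp add: empirical_def emeasure_distr) (subst emeasure_uniform_count_measure, auto)
qed

lemma sets_empirical [simp]: "sets (empirical n z) = sets borel"
  by (simp add: empirical_def)

lemma AE_empirical:
  assumes "{x. P x} \<in> sets borel" "\<And>i. i < n \<Longrightarrow> P (z i)"
  shows "AE x in empirical n z. P x"
  unfolding empirical_def using assms
  by (subst AE_distr_iff) (auto simp: space_uniform_count_measure intro!: AE_I2)

lemma integrable_empirical:
  fixes g :: "_ \<Rightarrow> 'b::{banach, second_countable_topology}"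
  assumes "g \<in> borel_measurable borel" shows "integrable (empirical n z) g"
  unfolding empirical_def using assms
  by (subst integrable_distr_eq) (auto simp: uniform_count_measure_def integrable_point_measure_finite)

lemma integral_empirical:
  fixes g :: "_ \<Rightarrow> 'b::{banach, second_countable_topology}"
  assumes "g \<in> borel_measurable borel"
  shows "integral\<^sup>L (empirical n z) g = (1 / real n) *\<^sub>R (\<Sum>i<n. g (z i))"
  unfolding empirical_def using assms
  by (subst integral_distr)
     (auto simp: uniform_count_measure_def lebesgue_integral_point_measure_finite scaleR_sum_right)

text \<open>The constant is moved to the other side by subtraction, which is reversible only when it
  is finite.\<close>

lemma ennreal_le_INF_add:
  fixes c x :: ennreal
  assumes "\<And>i. i \<in> I \<Longrightarrow> x \<le> f i + c"
  shows "x \<le> (INF i\<in>I. f i) + c"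
proof (cases "c = \<top>")
  case False
  then have "x - c \<le> (INF i\<in>I. f i)"
    using assms by (intro INF_greatest) (simp add: ennreal_minus_le_iff add.commute)
  then show ?thesis using False by (simp add: ennreal_minus_le_iff add.commute)
qed simp

lemma prob_space_coupling: "\<pi> \<in> couplings P Q \<Longrightarrow> prob_space \<pi>"
  by (simp add: couplings_def)

text \<open>
  Replacing the atoms \<open>z i\<close> by \<open>z' i\<close>. Since atoms may coincide, a pair \<open>(u, v)\<close> of the given
  coupling is sent to \<open>(u, z' j)\<close> with \<open>j\<close> uniformly distributed over all indices with \<open>z j = v\<close>.
\<close>

lemma transport_cost_empirical_le:
  fixes c :: "'a::t1_space \<Rightarrow> 'a \<Rightarrow> ennreal"
  assumes n: "0 < n"
    and c[measurable]: "(\<lambda>w. c (fst w) (snd w)) \<in> borel_measurable (borel \<Otimes>\<^sub>M borel)"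
    and tri: "\<And>u v w. c u w \<le> c u v + c v w"
  shows "transport_cost c P (empirical n z')
    \<le> transport_cost c P (empirical n z) + (\<Sum>i<n. c (z i) (z' i)) * ennreal (1 / real n)"
proof -
  define N where "N v = real (card {j\<in>{..<n}. z j = v})" for v
  have Npos: "0 < N (z j)" if "j < n" for j
    unfolding N_def using that by (auto simp: card_gt_0_iff)
  have "\<exists>\<pi>'\<in>couplings P (empirical n z'). (\<integral>\<^sup>+ w. c (fst w) (snd w) \<partial>\<pi>')
     \<le> (\<integral>\<^sup>+ w. c (fst w) (snd w) \<partial>\<pi>) + (\<Sum>i<n. c (z i) (z' i)) * ennreal (1 / real n)"
    if \<pi>: "\<pi> \<in> couplings P (empirical n z)" for \<pi>
  proof -
    interpret \<pi>: prob_space \<pi> by (rule prob_space_coupling[OF \<pi>])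
    have sets\<pi>[measurable_cong]: "sets \<pi> = sets (borel \<Otimes>\<^sub>M borel)"
      and fst\<pi>: "distr \<pi> borel fst = P" and snd\<pi>: "distr \<pi> borel snd = empirical n z"
      using \<pi> by (auto simp: couplings_def)
    have [simp]: "space \<pi> = UNIV"
      using sets_eq_imp_space_eq[OF sets\<pi>] by (simp add: space_pair_measure)
    interpret C: sigma_finite_measure "count_space {..<n}"
      by (rule sigma_finite_measure_count_space_finite) simp
    interpret K: pair_sigma_finite \<pi> "count_space {..<n}" ..
    define \<rho> where "\<rho> w j = (if snd w = z j then ennreal (1 / N (z j)) else 0)" for w :: "'a \<times> 'a" and j
    have \<rho>m[measurable]: "(\<lambda>w. \<rho> w j) \<in> borel_measurable \<pi>" for j
    proof -
      have [measurable]: "{z j} \<in> sets borel" by simp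
      have "(\<lambda>w. \<rho> w j) = (\<lambda>w. if snd w \<in> {z j} then ennreal (1 / N (z j)) else 0)"
        by (auto simp: \<rho>_def)
      then show ?thesis by simp
    qed
    have \<rho>m'[measurable]: "case_prod \<rho> \<in> borel_measurable (\<pi> \<Otimes>\<^sub>M count_space {..<n})"
    proof -
      have "(\<lambda>wj. \<rho> (fst wj) (snd wj)) \<in> borel_measurable (\<pi> \<Otimes>\<^sub>M count_space {..<n})"
        by (rule measurable_compose_countable'[where I = "{..<n}" and f = "\<lambda>j wj. \<rho> (fst wj) j"]) auto
      then show ?thesis by (simp add: case_prod_beta')
    qed
    \<comment> \<open>\<open>K\<close> is the joint law of a pair drawn from \<open>\<pi>\<close>
      and the index chosen for it; \<open>\<rho>\<close> is the conditional weight of the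
      index.\<close>
    define K where "K = density (\<pi> \<Otimes>\<^sub>M count_space {..<n}) (case_prod \<rho>)"
    have [measurable]: "(\<lambda>(w, j). (fst w, z' j)) \<in> K \<rightarrow>\<^sub>M borel \<Otimes>\<^sub>M borel"
      unfolding K_def by measurable
    define \<pi>' where "\<pi>' = distr K (borel \<Otimes>\<^sub>M borel) (\<lambda>(w, j). (fst w, z' j))"
    have int: "(\<integral>\<^sup>+ w. g w \<partial>\<pi>') = (\<integral>\<^sup>+ w. (\<Sum>j<n. \<rho> w j * g (fst w, z' j)) \<partial>\<pi>)"
      if g[measurable]: "g \<in> borel_measurable (borel \<Otimes>\<^sub>M borel)" for g
    proof -
      have "(\<integral>\<^sup>+ w. g w \<partial>\<pi>') = (\<integral>\<^sup>+ wj. \<rho> (fst wj) (snd wj) * g (fst (fst wj), z' (snd wj)) \<partial>(\<pi> \<Otimes>\<^sub>M count_space {..<n}))"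
        unfolding \<pi>'_def by (subst nn_integral_distr) (auto simp: K_def nn_integral_density case_prod_beta)
      also have "\<dots> = (\<integral>\<^sup>+ w. \<integral>\<^sup>+ j. \<rho> w j * g (fst w, z' j) \<partial>count_space {..<n} \<partial>\<pi>)"
        by (subst C.nn_integral_fst[symmetric]) (auto simp: case_prod_beta)
      finally show ?thesis by (simp add: nn_integral_count_space_finite)
    qed
    have AEz: "AE w in \<pi>. snd w \<in> z ` {..<n}"
    proof -
      have "z ` {..<n} \<in> sets borel" by (intro borel_closed finite_imp_closed) auto
      then have "AE v in distr \<pi> borel snd. v \<in> z ` {..<n}"
        unfolding snd\<pi> by (intro AE_empirical) auto
      then show ?thesis by (subst (asm) AE_distr_iff) (use \<open>z ` {..<n} \<in> sets borel\<close> in auto)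
    qed
    have sum\<rho>: "(\<Sum>j<n. \<rho> w j) = 1" if "snd w \<in> z ` {..<n}" for w
    proof -
      have "(\<Sum>j<n. \<rho> w j) = (\<Sum>j\<in>{j\<in>{..<n}. z j = snd w}. ennreal (1 / N (snd w)))"
        by (subst sum.inter_filter) (auto simp: \<rho>_def intro!: sum.cong)
      also have "\<dots> = ennreal (N (snd w) * (1 / N (snd w)))"
        by (simp only: sum_constant N_def ennreal_mult'' ennreal_of_nat_eq_real_of_nat of_nat_0_le_iff
            ennreal_mult divide_nonneg_nonneg zero_le_one)
      also have "\<dots> = 1" using that Npos by force
      finally show ?thesis .
    qed
    \<comment> \<open>An atom of multiplicity N has mass N / n and selects each of its indices with
      weight 1 / N, so every index is chosen with probability 1 / n.\<close>
    have int\<rho>: "(\<integral>\<^sup>+ w. \<rho> w j \<partial>\<pi>) = ennreal (1 / real n)" if "j < n" for j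
    proof -
      have "(\<integral>\<^sup>+ w. \<rho> w j \<partial>\<pi>) = (\<integral>\<^sup>+ w. ennreal (1 / N (z j)) * indicator {z j} (snd w) \<partial>\<pi>)"
        by (intro nn_integral_cong) (auto simp: \<rho>_def)
      also have "\<dots> = ennreal (1 / N (z j)) * (\<integral>\<^sup>+ v. indicator {z j} v \<partial>distr \<pi> borel snd)"
        by (subst nn_integral_distr) (auto simp: nn_integral_cmult)
      also have "\<dots> = ennreal (1 / N (z j)) * ennreal (N (z j) / real n)"
        unfolding snd\<pi> using n by (simp add: emeasure_empirical N_def)
      also have "\<dots> = ennreal (1 / real n)"
        using Npos[OF that] by (simp add: ennreal_mult'[symmetric])
      finally show ?thesis .
    qed
    have set\<pi>': "sets \<pi>' = sets (borel \<Otimes>\<^sub>M borel)" by (simp add: \<pi>'_def)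
    have fst': "distr \<pi>' borel fst = P"
    proof (rule measure_eqI)
      show "sets (distr \<pi>' borel fst) = sets P" using fst\<pi> by auto
      fix E :: "'a set" assume "E \<in> sets (distr \<pi>' borel fst)"
      then have E[measurable]: "E \<in> sets borel" by simp
      have [measurable]: "fst \<in> \<pi>' \<rightarrow>\<^sub>M borel" "fst \<in> \<pi> \<rightarrow>\<^sub>M borel"
        by (simp_all add: measurable_cong_sets[OF set\<pi>' refl] measurable_cong_sets[OF sets\<pi> refl])
      have "emeasure (distr \<pi>' borel fst) E = (\<integral>\<^sup>+ x. indicator E x \<partial>distr \<pi>' borel fst)"
        by simp
      also have "\<dots> = (\<integral>\<^sup>+ w. indicator E (fst w) \<partial>\<pi>')" by (subst nn_integral_distr) auto
      also have "\<dots> = (\<integral>\<^sup>+ w. (\<Sum>j<n. \<rho> w j) * indicator E (fst w) \<partial>\<pi>)"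
        by (subst int) (auto simp: sum_distrib_right)
      also have "\<dots> = (\<integral>\<^sup>+ w. indicator E (fst w) \<partial>\<pi>)"
        using AEz by (intro nn_integral_cong_AE) (auto simp: sum\<rho> elim!: eventually_mono)
      also have "\<dots> = (\<integral>\<^sup>+ x. indicator E x \<partial>P)"
        unfolding fst\<pi>[symmetric] by (subst nn_integral_distr) auto
      also have "\<dots> = emeasure P E" using fst\<pi> by (subst nn_integral_indicator) auto
      finally show "emeasure (distr \<pi>' borel fst) E = emeasure P E" .
    qed
    have snd': "distr \<pi>' borel snd = empirical n z'"
    proof (rule measure_eqI)
      fix E :: "'a set" assume "E \<in> sets (distr \<pi>' borel snd)"
      then have E[measurable]: "E \<in> sets borel" by simp
      have [measurable]: "snd \<in> \<pi>' \<rightarrow>\<^sub>M borel"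
        by (simp add: measurable_cong_sets[OF set\<pi>' refl])
      have "emeasure (distr \<pi>' borel snd) E = (\<integral>\<^sup>+ x. indicator E x \<partial>distr \<pi>' borel snd)"
        by simp
      also have "\<dots> = (\<integral>\<^sup>+ w. indicator E (snd w) \<partial>\<pi>')" by (subst nn_integral_distr) auto
      also have "\<dots> = (\<integral>\<^sup>+ w. (\<Sum>j<n. \<rho> w j * indicator E (z' j)) \<partial>\<pi>)"
        by (subst int) auto
      also have "\<dots> = (\<Sum>j<n. ennreal (1 / real n) * indicator E (z' j))"
        by (simp add: nn_integral_sum nn_integral_multc int\<rho>)
      also have "\<dots> = (\<Sum>j\<in>{j\<in>{..<n}. z' j \<in> E}. ennreal (1 / real n))"
        unfolding sum.inter_filter[OF finite_lessThan]
        by (intro sum.cong) (auto simp: indicator_def)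
      also have "\<dots> = ennreal (real (card {j\<in>{..<n}. z' j \<in> E}) * (1 / real n))"
        by (simp only: sum_constant ennreal_of_nat_eq_real_of_nat of_nat_0_le_iff
            ennreal_mult divide_nonneg_nonneg zero_le_one)
      also have "real (card {j\<in>{..<n}. z' j \<in> E}) * (1 / real n) = real (card {j\<in>{..<n}. z' j \<in> E}) / real n"
        by simp
      also have "\<dots> = emeasure (empirical n z') E" using n by (simp add: emeasure_empirical)
      finally show "emeasure (distr \<pi>' borel snd) E = emeasure (empirical n z') E" .
    qed simp
    have "prob_space P" unfolding fst\<pi>[symmetric]
      by (rule \<pi>.prob_space_distr) (simp add: measurable_cong_sets[OF sets\<pi> refl])
    then have "prob_space \<pi>'"
      unfolding fst'[symmetric]
      by (rule prob_space_distrD[rotated]) (simp add: measurable_cong_sets[OF set\<pi>' refl])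
    then have cpl: "\<pi>' \<in> couplings P (empirical n z')"
      using set\<pi>' fst' snd' by (simp add: couplings_def)
    have "(\<integral>\<^sup>+ w. c (fst w) (snd w) \<partial>\<pi>') = (\<integral>\<^sup>+ w. (\<Sum>j<n. \<rho> w j * c (fst w) (z' j)) \<partial>\<pi>)"
      by (subst int) auto
    also have "\<dots> \<le> (\<integral>\<^sup>+ w. (\<Sum>j<n. \<rho> w j) * c (fst w) (snd w) + (\<Sum>j<n. \<rho> w j * c (z j) (z' j)) \<partial>\<pi>)"
    proof (intro nn_integral_mono)
      fix w
      \<comment> \<open>The weight vanishes unless the second coordinate of \<open>w\<close> is
        \<open>z j\<close>, so the triangle inequality may be routed through
        \<open>z j\<close>.\<close>
      have "\<rho> w j * c (fst w) (z' j) \<le> \<rho> w j * (c (fst w) (snd w) + c (z j) (z' j))" for j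
        using tri[of "fst w" "z' j" "snd w"] by (auto simp: \<rho>_def intro!: mult_left_mono)
      then show "(\<Sum>j<n. \<rho> w j * c (fst w) (z' j))
          \<le> (\<Sum>j<n. \<rho> w j) * c (fst w) (snd w) + (\<Sum>j<n. \<rho> w j * c (z j) (z' j))"
        by (simp add: sum_distrib_right sum.distrib[symmetric] distrib_left[symmetric] sum_mono)
    qed
    also have "\<dots> = (\<integral>\<^sup>+ w. (\<Sum>j<n. \<rho> w j) * c (fst w) (snd w) \<partial>\<pi>) + (\<Sum>j<n. (\<integral>\<^sup>+ w. \<rho> w j \<partial>\<pi>) * c (z j) (z' j))"
      by (simp add: nn_integral_add nn_integral_sum nn_integral_multc)
    also have "(\<integral>\<^sup>+ w. (\<Sum>j<n. \<rho> w j) * c (fst w) (snd w) \<partial>\<pi>) = (\<integral>\<^sup>+ w. c (fst w) (snd w) \<partial>\<pi>)"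
      using AEz by (intro nn_integral_cong_AE) (auto simp: sum\<rho> elim!: eventually_mono)
    also have "(\<Sum>j<n. (\<integral>\<^sup>+ w. \<rho> w j \<partial>\<pi>) * c (z j) (z' j)) = (\<Sum>i<n. c (z i) (z' i)) * ennreal (1 / real n)"
      by (simp add: int\<rho> sum_distrib_left mult.commute)
    finally show ?thesis using cpl by blast
  qed
  note ex = this
  show ?thesis
      unfolding transport_cost_def[of c P "empirical n z"] transport_cost_def[of c P "empirical n z'"]
      using ex by (intro ennreal_le_INF_add) (auto intro: INF_lower2)
qed


section \<open>Bounds for the profile function at an empirical measure\<close>

abbreviation score :: "real ^ 'd \<Rightarrow> (real ^ 'd) \<times> real \<Rightarrow> real ^ 'd" where
  "score b z \<equiv> logistic_h (fst z) (snd z) b"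

lemma measurable_score [measurable]: "score b \<in> borel_measurable borel"
  by (intro borel_measurable_continuous_onI continuous_intros)

lemma measurable_N_cost [measurable]:
  assumes [measurable]: "1 \<le> q"
  shows "(\<lambda>w. N_cost q (fst w) (snd w)) \<in> borel_measurable (borel \<Otimes>\<^sub>M borel)"
  unfolding N_cost_def borel_prod[symmetric] by measurable

lemma N_cost_triangle:
  fixes z1 z2 z3 :: "(real ^ 'd) \<times> real"
  assumes "1 < q" "1 / p + 1 / q = 1"
  shows "N_cost q z1 z3 \<le> N_cost q z1 z2 + N_cost q z2 z3"
proof -
  have "lq_norm q (fst z1 - fst z3) \<le> lq_norm q (fst z1 - fst z2) + lq_norm q (fst z2 - fst z3)"
    using lq_norm_triangle[OF assms, of "fst z1 - fst z2" "fst z2 - fst z3"] by simp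
  then show ?thesis
    by (auto simp: N_cost_def ennreal_plus[symmetric] ennreal_leI simp del: ennreal_plus)
qed

text \<open>The feasible measures do not depend on the empirical measure, so the stability of the
  transport cost passes to the infimum. This bound yields the semicontinuity behind the
  measurability of the profile function.\<close>

lemma profile_empirical_le:
  fixes b :: "real ^ 'd"
  assumes q: "1 < q" "1 / p + 1 / q = 1" and n: "0 < n"
  shows "profile q b (empirical n z') \<le> profile q b (empirical n z)
    + (\<Sum>i<n. N_cost q (z i) (z' i)) * ennreal (1 / real n)"
  unfolding profile_def[of q b "empirical n z"] profile_def[of q b "empirical n z'"]
proof (rule ennreal_le_INF_add)
  have "1 \<le> q" using q(1) by simp
  fix P :: "((real ^ 'd) \<times> real) measure"
  assume "P \<in> {P. prob_space P \<and> sets P = sets borel \<and> integrable P (\<lambda>(x, y). logistic_h x y b)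
      \<and> (\<integral>(x, y). logistic_h x y b \<partial>P) = 0}"
  then show "(INF P\<in>{P. prob_space P \<and> sets P = sets borel \<and> integrable P (\<lambda>(x, y). logistic_h x y b)
      \<and> (\<integral>(x, y). logistic_h x y b \<partial>P) = 0}. transport_cost (N_cost q) P (empirical n z'))
    \<le> transport_cost (N_cost q) P (empirical n z) + (\<Sum>i<n. N_cost q (z i) (z' i)) * ennreal (1 / real n)"
    by (rule INF_lower2)
       (intro transport_cost_empirical_le n measurable_N_cost \<open>1 \<le> q\<close> N_cost_triangle[OF q])
qed

text \<open>
  Linear functionals in the slope set are 1-Lipschitz along the score, so integrating them along
  any coupling bounds its cost from below.
\<close>

lemma profile_ge:
  fixes z :: "nat \<Rightarrow> (real ^ 'd) \<times> real"
  assumes q: "1 < q" "1 / p + 1 / q = 1" and \<xi>: "\<xi> \<in> slope_set p b"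
    and labels: "\<And>i. i < n \<Longrightarrow> snd (z i) \<in> {-1, 1}"
  shows "ennreal (\<xi> \<bullet> ((1 / real n) *\<^sub>R (\<Sum>i<n. score b (z i)))) \<le> profile q b (empirical n z)"
  unfolding profile_def transport_cost_def
proof (intro INF_greatest)
  have q1: "1 \<le> q" using q(1) by simp
  fix P :: "((real ^ 'd) \<times> real) measure" and \<pi>
  assume "P \<in> {P. prob_space P \<and> sets P = sets borel \<and> integrable P (\<lambda>(x, y). logistic_h x y b)
      \<and> (\<integral>(x, y). logistic_h x y b \<partial>P) = 0}"
  then have P: "sets P = sets borel" "integrable P (score b)" "(\<integral>z. score b z \<partial>P) = 0"
    by (auto simp: case_prod_beta')
  assume \<pi>: "\<pi> \<in> couplings P (empirical n z)"
  interpret \<pi>: prob_space \<pi> by (rule prob_space_coupling[OF \<pi>])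
  have sets\<pi>[measurable_cong]: "sets \<pi> = sets (borel \<Otimes>\<^sub>M borel)"
    and fst\<pi>: "distr \<pi> borel fst = P" and snd\<pi>: "distr \<pi> borel snd = empirical n z"
    using \<pi> by (auto simp: couplings_def)
  have [measurable]: "fst \<in> \<pi> \<rightarrow>\<^sub>M borel" "snd \<in> \<pi> \<rightarrow>\<^sub>M borel"
    by (simp_all add: measurable_cong_sets[OF sets\<pi> refl])
  let ?C = "\<integral>\<^sup>+ w. N_cost q (fst w) (snd w) \<partial>\<pi>"
  show "ennreal (\<xi> \<bullet> ((1 / real n) *\<^sub>R (\<Sum>i<n. score b (z i)))) \<le> ?C"
  proof (cases "?C = \<infinity>")
    case False
    have 1: "integrable \<pi> (\<lambda>w. score b (fst w))" "(\<integral>w. score b (fst w) \<partial>\<pi>) = 0"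
      using P(2,3) unfolding fst\<pi>[symmetric] by (simp_all add: integrable_distr_eq integral_distr)
    have 2: "integrable \<pi> (\<lambda>w. score b (snd w))"
      "(\<integral>w. score b (snd w) \<partial>\<pi>) = (1 / real n) *\<^sub>R (\<Sum>i<n. score b (z i))"
      using integrable_empirical[OF measurable_score, of n z b] integral_empirical[OF measurable_score, of n z b]
      unfolding snd\<pi>[symmetric] by (simp_all add: integrable_distr_eq integral_distr)
    \<comment> \<open>A finite cost forces the two labels to agree almost surely, so the labels
      under \<open>P\<close>, a priori arbitrary reals, lie in {-1, 1} as well.\<close>
    have "AE w in \<pi>. N_cost q (fst w) (snd w) \<noteq> \<infinity>"
      using False by (intro nn_integral_PInf_AE)
        (simp_all add: measurable_cong_sets[OF sets\<pi> refl] measurable_N_cost[OF q1])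
    then have ae1: "AE w in \<pi>. snd (fst w) = snd (snd w)"
      by (auto simp: N_cost_def elim!: eventually_mono split: if_splits)
    have lab: "{v :: (real ^ 'd) \<times> real. snd v \<in> {-1, 1}} \<in> sets borel"
    proof -
      have "{v :: (real ^ 'd) \<times> real. snd v \<in> {-1, 1}} = UNIV \<times> {-1, 1}" by auto
      moreover have "closed ((UNIV :: (real ^ 'd) set) \<times> {-1, 1 :: real})" by (intro closed_Times) auto
      ultimately show ?thesis by (simp only: borel_closed)
    qed
    then have "AE v in distr \<pi> borel snd. snd v \<in> {-1, 1}"
      unfolding snd\<pi> by (intro AE_empirical labels)
    then have ae2: "AE w in \<pi>. snd (snd w) \<in> {-1, 1}"
      by (rule AE_distrD[rotated]) simp
    \<comment> \<open>The moment of \<open>P\<close> vanishes, so the integral of this difference is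
      the pairing of \<open>\<xi>\<close> with the empirical mean.\<close>
    define g where "g w = \<xi> \<bullet> score b (snd w) - \<xi> \<bullet> score b (fst w)" for w :: "((real ^ 'd) \<times> real) \<times> ((real ^ 'd) \<times> real)"
    have g: "integrable \<pi> g" "(\<integral>w. g w \<partial>\<pi>) = \<xi> \<bullet> ((1 / real n) *\<^sub>R (\<Sum>i<n. score b (z i)))"
      unfolding g_def using 1 2 by simp_all
    have "AE w in \<pi>. ennreal (g w) \<le> N_cost q (fst w) (snd w)"
      using ae1 ae2
    proof eventually_elim
      case (elim w)
      have "g w \<le> lq_norm q (fst (snd w) - fst (fst w))"
        unfolding g_def elim(1) by (rule slope_set_lipschitz[OF q \<xi> elim(2)])
      also have "\<dots> = lq_norm q (fst (fst w) - fst (snd w))"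
        using lq_norm_minus[OF q1, of "fst (fst w) - fst (snd w)"] by simp
      finally show ?case using elim(1) by (simp add: N_cost_def ennreal_leI)
    qed
    then have le: "(\<integral>\<^sup>+ w. ennreal (g w) \<partial>\<pi>) \<le> ?C" by (rule nn_integral_mono_AE)
    \<comment> \<open>\<open>g\<close> may take negative values; the nonnegative integral sees only
      its positive part, which can but enlarge the value.\<close>
    have "ennreal (\<integral>w. g w \<partial>\<pi>) \<le> ennreal (\<integral>w. max 0 (g w) \<partial>\<pi>)"
      using g(1) by (intro ennreal_leI integral_mono) auto
    also have "\<dots> = (\<integral>\<^sup>+ w. ennreal (max 0 (g w)) \<partial>\<pi>)"
      using g(1) by (intro nn_integral_eq_integral[symmetric]) auto
    also have "\<dots> = (\<integral>\<^sup>+ w. ennreal (g w) \<partial>\<pi>)"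
      by (intro nn_integral_cong) (auto simp: max_def ennreal_neg)
    finally show ?thesis using le g(2) by simp
  qed simp
qed

text \<open>A feasible measure is built by drawing k with probability \<open>u k\<close> and i
  uniformly, then placing observation i at \<open>T k i\<close> with its label unchanged. Mixing
  several rearrangements adds convex combinations to the moments that single rearrangements reach,
  and the cost bound survives averaging.\<close>

lemma profile_le_mixture:
  fixes z :: "nat \<Rightarrow> (real ^ 'd) \<times> real" and T :: "'k \<Rightarrow> nat \<Rightarrow> real ^ 'd"
  assumes q: "1 \<le> q" and n: "0 < n" and K: "finite K" "\<And>k. k \<in> K \<Longrightarrow> 0 \<le> u k" "sum u K = 1"
    and moment: "(\<Sum>k\<in>K. u k *\<^sub>R (\<Sum>i<n. score b (T k i, snd (z i)))) = 0"
    and cost: "\<And>k. k \<in> K \<Longrightarrow> (\<Sum>i<n. lq_norm q (T k i - fst (z i))) \<le> real n * c"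
  shows "profile q b (empirical n z) \<le> ennreal c"
proof -
  define W where "W = point_measure (K \<times> {..<n}) (\<lambda>a. u (fst a) / real n)"
  define F where "F a = ((T (fst a) (snd a), snd (z (snd a))), z (snd a))" for a
  define \<pi> where "\<pi> = distr W (borel \<Otimes>\<^sub>M borel) F"
  have fin: "finite (K \<times> {..<n})" using K by simp
  have nonneg: "0 \<le> u (fst a) / real n" if "a \<in> K \<times> {..<n}" for a
    using that K by auto
  have [measurable]: "g \<in> measurable W N" if "g \<in> space W \<rightarrow> space N" for g and N :: "'x measure"
    using that unfolding W_def by (simp add: measurable_point_measure_eq1 space_point_measure)
  have FW: "F \<in> measurable W (borel \<Otimes>\<^sub>M borel)"
    by (simp add: W_def measurable_point_measure_eq1 space_pair_measure)
  have gW: "g \<in> measurable W borel" for g :: "_ \<Rightarrow> 'x::topological_space"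
    by (simp add: W_def measurable_point_measure_eq1)
  have intW: "(\<integral>\<^sup>+ a. ennreal (g (snd a)) \<partial>W) = ennreal ((\<Sum>i<n. g i) / real n)" if "\<And>i. 0 \<le> g i" for g
  proof -
    have "(\<integral>\<^sup>+ a. ennreal (g (snd a)) \<partial>W) = (\<Sum>a\<in>K \<times> {..<n}. ennreal (u (fst a) / real n) * ennreal (g (snd a)))"
      unfolding W_def by (rule nn_integral_point_measure_finite[OF fin])
    also have "\<dots> = ennreal (\<Sum>a\<in>K \<times> {..<n}. u (fst a) / real n * g (snd a))"
      using nonneg that by (simp only: ennreal_mult''[symmetric] sum_ennreal mult_nonneg_nonneg)
    also have "(\<Sum>a\<in>K \<times> {..<n}. u (fst a) / real n * g (snd a)) = (\<Sum>k\<in>K. \<Sum>i<n. u k / real n * g i)"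
      by (subst sum.cartesian_product) (simp add: case_prod_beta)
    also have "\<dots> = (\<Sum>k\<in>K. u k) * (\<Sum>i<n. g i) / real n"
      by (simp add: sum_distrib_left[symmetric] sum_distrib_right[symmetric] sum_divide_distrib[symmetric])
    finally show ?thesis using K(3) by simp
  qed
  have "prob_space W"
    using intW[of "\<lambda>_. 1"] n by (intro prob_spaceI) simp
  then interpret W: prob_space W .
  interpret \<pi>: prob_space \<pi> unfolding \<pi>_def by (rule W.prob_space_distr[OF FW])
  have fst\<pi>: "distr \<pi> borel fst = distr W borel (fst \<circ> F)"
    unfolding \<pi>_def by (rule distr_distr) (use FW in auto)
  have snd\<pi>: "distr \<pi> borel snd = distr W borel (snd \<circ> F)"
    unfolding \<pi>_def by (rule distr_distr) (use FW in auto)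
  have "distr \<pi> borel snd = empirical n z"
  proof (rule measure_eqI)
    fix E assume "E \<in> sets (distr \<pi> borel snd)"
    then have E: "E \<in> sets borel" by simp
    have "emeasure (distr \<pi> borel snd) E = (\<integral>\<^sup>+ v. indicator E v \<partial>distr W borel (snd \<circ> F))"
      using E by (simp add: snd\<pi>)
    also have "\<dots> = (\<integral>\<^sup>+ a. indicator E (z (snd a)) \<partial>W)"
      using E by (subst nn_integral_distr) (auto simp: F_def gW)
    also have "\<dots> = (\<integral>\<^sup>+ a. ennreal (indicator E (z (snd a))) \<partial>W)"
      by (simp add: ennreal_indicator)
    also have "\<dots> = ennreal ((\<Sum>i<n. indicator E (z i)) / real n)"
      by (rule intW) simp
    also have "(\<Sum>i<n. indicator E (z i) :: real) = real (card {i\<in>{..<n}. z i \<in> E})"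
      by (auto simp: indicator_def intro!: arg_cong[where f = card])
    finally show "emeasure (distr \<pi> borel snd) E = emeasure (empirical n z) E"
      using emeasure_empirical[OF n E] by simp
  qed simp
  then have cpl: "\<pi> \<in> couplings (distr \<pi> borel fst) (empirical n z)"
    by (simp add: couplings_def \<pi>.prob_space_axioms) (simp add: \<pi>_def)
  let ?P = "distr \<pi> borel fst"
  have "prob_space ?P" unfolding fst\<pi> by (rule W.prob_space_distr[OF gW])
  moreover have "integrable ?P (score b)"
    unfolding fst\<pi> by (subst integrable_distr_eq[OF gW measurable_score])
      (simp add: W_def integrable_point_measure_finite[OF fin])
  moreover have "(\<integral>z. score b z \<partial>?P) = 0"
  proof -
    have "(\<integral>z. score b z \<partial>?P) = (\<integral>a. score b (T (fst a) (snd a), snd (z (snd a))) \<partial>W)"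
      unfolding fst\<pi> by (subst integral_distr[OF gW measurable_score]) (simp add: F_def)
    also have "\<dots> = (\<Sum>a\<in>K \<times> {..<n}. (u (fst a) / real n) *\<^sub>R score b (T (fst a) (snd a), snd (z (snd a))))"
      unfolding W_def by (rule lebesgue_integral_point_measure_finite[OF fin nonneg])
    also have "\<dots> = (\<Sum>k\<in>K. \<Sum>i<n. (u k / real n) *\<^sub>R score b (T k i, snd (z i)))"
      by (subst sum.cartesian_product) (simp add: case_prod_beta)
    also have "\<dots> = (1 / real n) *\<^sub>R (\<Sum>k\<in>K. u k *\<^sub>R (\<Sum>i<n. score b (T k i, snd (z i))))"
      by (simp add: scaleR_sum_right)
    finally show ?thesis using moment by simp
  qed
  ultimately have "profile q b (empirical n z) \<le> transport_cost (N_cost q) ?P (empirical n z)"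
    unfolding profile_def by (intro INF_lower) (auto simp: case_prod_beta')
  also have "\<dots> \<le> (\<integral>\<^sup>+ w. N_cost q (fst w) (snd w) \<partial>\<pi>)"
    unfolding transport_cost_def by (rule INF_lower[OF cpl])
  also have "\<dots> = (\<integral>\<^sup>+ a. N_cost q (fst (F a)) (snd (F a)) \<partial>W)"
    unfolding \<pi>_def using FW q by (subst nn_integral_distr) auto
  also have "\<dots> = (\<Sum>a\<in>K \<times> {..<n}. ennreal (u (fst a) / real n) * ennreal (lq_norm q (T (fst a) (snd a) - fst (z (snd a)))))"
    unfolding W_def by (subst nn_integral_point_measure_finite[OF fin]) (simp add: F_def N_cost_def)
  also have "\<dots> = ennreal (\<Sum>a\<in>K \<times> {..<n}. u (fst a) / real n * lq_norm q (T (fst a) (snd a) - fst (z (snd a))))"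
    using nonneg by (simp only: ennreal_mult''[symmetric] lq_norm_nonneg sum_ennreal mult_nonneg_nonneg)
  also have "\<dots> \<le> ennreal c"
  proof (rule ennreal_leI)
    have "(\<Sum>a\<in>K \<times> {..<n}. u (fst a) / real n * lq_norm q (T (fst a) (snd a) - fst (z (snd a))))
        = (\<Sum>k\<in>K. \<Sum>i<n. u k / real n * lq_norm q (T k i - fst (z i)))"
      by (subst sum.cartesian_product) (simp add: case_prod_beta)
    also have "\<dots> = (\<Sum>k\<in>K. u k / real n * (\<Sum>i<n. lq_norm q (T k i - fst (z i))))"
      by (simp add: sum_distrib_left)
    also have "\<dots> \<le> (\<Sum>k\<in>K. u k / real n * (real n * c))"
      using K cost by (intro sum_mono mult_left_mono) auto
    also have "\<dots> = (\<Sum>k\<in>K. u k) * c" using n by (simp add: sum_distrib_right)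
    finally show "(\<Sum>a\<in>K \<times> {..<n}. u (fst a) / real n * lq_norm q (T (fst a) (snd a) - fst (z (snd a)))) \<le> c"
      using K(3) by simp
  qed
  finally show ?thesis .
qed

lemma profile_empirical_finite:
  assumes "1 \<le> q" "0 < n" shows "profile q b (empirical n z) < \<infinity>"
proof -
  have "profile q b (empirical n z) \<le> ennreal ((\<Sum>i<n. lq_norm q (0 - fst (z i))) / real n)"
    using assms
    by (intro profile_le_mixture[where K = "{()}" and u = "\<lambda>_. 1" and T = "\<lambda>_ _. 0"])
       (auto simp: logistic_h_def)
  then show ?thesis using le_less_trans[OF _ ennreal_less_top] by simp
qed


section \<open>The Cramer-Wold device\<close>

text \<open>
  A bounded continuous \<open>f\<close> is compared with \<open>x \<mapsto> f (sine_map L x)\<close>, which is close to \<open>f\<close> on large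
  balls, bounded everywhere, and by Weierstrass uniformly close to a trigonometric polynomial.
\<close>

inductive trig_poly :: "(real ^ 'd \<Rightarrow> real) \<Rightarrow> bool" where
  cos: "trig_poly (\<lambda>x. c * cos (u \<bullet> x + a))"
| add: "trig_poly f \<Longrightarrow> trig_poly g \<Longrightarrow> trig_poly (\<lambda>x. f x + g x)"

lemma trig_poly_const: "trig_poly (\<lambda>x. c)"
  using trig_poly.cos[of c 0 0] by simp

lemma trig_poly_sum: "(\<And>i. i \<in> I \<Longrightarrow> trig_poly (f i)) \<Longrightarrow> trig_poly (\<lambda>x. \<Sum>i\<in>I. f i x)"
  by (induction I rule: infinite_finite_induct) (auto intro: trig_poly_const trig_poly.add)

text \<open>Closure under products, from the product-to-sum formula, is what allows polynomials in
  sines to be expanded into single cosines.\<close>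

lemma trig_poly_mult: "trig_poly f \<Longrightarrow> trig_poly g \<Longrightarrow> trig_poly (\<lambda>x. f x * g x)"
proof (induction f rule: trig_poly.induct)
  case (cos c u a)
  from cos show ?case
  proof (induction g rule: trig_poly.induct)
    case (cos c' u' a')
    have "c * cos (u \<bullet> x + a) * (c' * cos (u' \<bullet> x + a'))
       = (c * c' / 2) * cos ((u - u') \<bullet> x + (a - a')) + (c * c' / 2) * cos ((u + u') \<bullet> x + (a + a'))" for x
    proof -
      have "c * cos (u \<bullet> x + a) * (c' * cos (u' \<bullet> x + a')) = c * c' * (cos (u \<bullet> x + a) * cos (u' \<bullet> x + a'))"
        by simp
      also have "\<dots> = c * c' * ((cos ((u \<bullet> x + a) - (u' \<bullet> x + a')) + cos ((u \<bullet> x + a) + (u' \<bullet> x + a'))) / 2)"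
        by (simp only: cos_times_cos)
      finally show ?thesis by (simp add: inner_add_left inner_diff_left field_simps)
    qed
    then show ?case by (simp only:) (intro trig_poly.intros)
  next
    case (add f g)
    then show ?case by (simp add: distrib_left) (intro trig_poly.intros; assumption)
  qed
next
  case (add f g)
  then show ?case by (simp add: distrib_right) (intro trig_poly.intros; assumption)
qed

text \<open>Amplitude and inverse frequency share \<open>L\<close>, so the derivative at 0 is the
  identity while the range stays in the box of half-width \<open>L\<close>. A polynomial
  approximation on that box is thus valid for all arguments.\<close>

definition sine_map :: "real \<Rightarrow> real ^ 'd \<Rightarrow> real ^ 'd" where
  "sine_map L x = (\<chi> i. L * sin (x $ i / L))"

lemma trig_poly_sine_map:
  assumes "real_polynomial_function p" shows "trig_poly (\<lambda>x. p (sine_map L x))"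
  using assms
proof induction
  case (linear f)
  have lin: "linear f" using linear by (rule bounded_linear.linear)
  have "f (sine_map L x) = (\<Sum>i\<in>UNIV. (L * f (axis i 1)) * cos (axis i (1 / L) \<bullet> x + - (pi / 2)))" for x
  proof -
    have "cos (axis i (1 / L) \<bullet> x + - (pi / 2)) = sin (x $ i / L)" for i
      by (simp only: cos_add) (simp add: inner_axis')
    moreover have "sine_map L x = (\<Sum>i\<in>UNIV. (L * sin (x $ i / L)) *\<^sub>R axis i 1)"
      by (simp add: vec_eq_iff sine_map_def axis_def if_distrib[of "(*) _"] cong: if_cong)
    then have "f (sine_map L x) = (\<Sum>i\<in>UNIV. (L * sin (x $ i / L)) *\<^sub>R f (axis i 1))"
      by (simp add: linear_sum[OF lin] linear_scale[OF lin])
    ultimately show ?thesis by (simp only: real_scaleR_def mult_ac)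
  qed
  then show ?case by (simp only:) (intro trig_poly_sum trig_poly.cos)
next
  case (mult f g)
  then show ?case by (intro trig_poly_mult)
qed (auto intro: trig_poly_const trig_poly.add)

lemma norm_sine_map_le: "0 < L \<Longrightarrow> norm (sine_map L x) \<le> norm x"
proof (rule norm_le_componentwise_cart)
  fix i assume "0 < L"
  then show "norm (sine_map L x $ i) \<le> norm (x $ i)"
    using abs_sin_x_le_abs_x[of "x $ i / L"] by (simp add: sine_map_def abs_mult field_simps)
qed

text \<open>As sin t - t = o(t), the error in coordinate i is at most \<kappa> |x_i| once |x_i| / L
  is small: the factor L from the amplitude cancels against the scaled argument.\<close>

lemma sine_map_close:
  assumes "0 < \<delta>" "0 \<le> R"
  shows "\<exists>L>0. \<forall>x :: real ^ 'd. norm x \<le> R \<longrightarrow> norm (sine_map L x - x) < \<delta>"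
proof -
  define \<kappa> where "\<kappa> = \<delta> / (R + 1)"
  have \<kappa>: "0 < \<kappa>" "\<kappa> * R < \<delta>" using assms by (auto simp: \<kappa>_def field_simps)
  have "(sin has_derivative (\<lambda>t. t)) (at (0::real))"
    by (auto intro!: derivative_eq_intros)
  then obtain \<eta> where \<eta>: "0 < \<eta>" "\<And>t::real. \<bar>t\<bar> < \<eta> \<Longrightarrow> \<bar>sin t - t\<bar> \<le> \<kappa> * \<bar>t\<bar>"
    using \<kappa>(1) unfolding has_derivative_at_alt by fastforce
  define L where "L = (R + 1) / \<eta>"
  have L: "0 < L" using assms \<eta> by (simp add: L_def)
  have "norm (sine_map L x - x) < \<delta>" if "norm x \<le> R" for x :: "real ^ 'd"
  proof -
    have "norm (sine_map L x - x) \<le> norm (\<kappa> *\<^sub>R x)"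
    proof (rule norm_le_componentwise_cart)
      fix i
      have "\<bar>x $ i\<bar> \<le> R" using component_le_norm_cart[of x i] that by simp
      then have "\<bar>x $ i\<bar> * \<eta> < (R + 1) * \<eta>" using \<eta>(1) by (intro mult_strict_right_mono) auto
      then have "\<bar>x $ i\<bar> / L < \<eta>" using assms \<eta>(1) by (simp add: L_def field_simps)
      then have "\<bar>sin (x $ i / L) - x $ i / L\<bar> \<le> \<kappa> * \<bar>x $ i / L\<bar>" using L by (intro \<eta>(2)) simp
      then have "L * \<bar>sin (x $ i / L) - x $ i / L\<bar> \<le> \<kappa> * \<bar>x $ i\<bar>" using L by (simp add: field_simps)
      also have "L * \<bar>sin (x $ i / L) - x $ i / L\<bar> = \<bar>L * (sin (x $ i / L) - x $ i / L)\<bar>"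
        using L by (simp only: abs_mult abs_of_pos)
      also have "L * (sin (x $ i / L) - x $ i / L) = L * sin (x $ i / L) - x $ i"
        using L by (simp add: right_diff_distrib)
      finally show "norm ((sine_map L x - x) $ i) \<le> norm ((\<kappa> *\<^sub>R x) $ i)"
        using \<kappa> by (simp add: sine_map_def abs_mult)
    qed
    also have "\<dots> \<le> \<kappa> * R" using \<kappa> that by (simp add: mult_left_mono)
    finally show ?thesis using \<kappa> by simp
  qed
  then show ?thesis using L by blast
qed

lemma trig_poly_bounded_continuous:
  assumes "trig_poly g"
  shows "continuous_on UNIV g \<and> (\<exists>B. \<forall>x. \<bar>g x\<bar> \<le> B)"
  using assms
proof induction
  case (cos c u a)
  have "\<bar>c * cos (u \<bullet> x + a)\<bar> \<le> \<bar>c\<bar>" for x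
    using mult_left_mono[OF abs_cos_le_one, of "\<bar>c\<bar>" "u \<bullet> x + a"] by (simp add: abs_mult)
  then show ?case by (auto intro!: continuous_intros)
next
  case (add f g)
  then obtain A B where "\<And>x. \<bar>f x\<bar> \<le> A" "\<And>x. \<bar>g x\<bar> \<le> B" by auto
  then have "\<bar>f x + g x\<bar> \<le> A + B" for x by (meson abs_triangle_ineq add_mono order_trans)
  then show ?case using add by (auto intro!: continuous_intros)
qed

lemma (in prob_space) integrable_bounded_continuous:
  fixes g :: "'b::euclidean_space \<Rightarrow> real"
  assumes [measurable]: "V \<in> borel_measurable M" and "continuous_on UNIV g" "\<And>x. \<bar>g x\<bar> \<le> B"
  shows "integrable M (\<lambda>w. g (V w))"
proof (rule integrable_const_bound[where B = B])
  have [measurable]: "g \<in> borel_measurable borel"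
    by (rule borel_measurable_continuous_onI) fact
  show "(\<lambda>w. g (V w)) \<in> borel_measurable M" by measurable
qed (use assms in auto)

text \<open>The expectation of a single cosine is the real part of the characteristic function at
  \<open>u\<close>, rotated by the phase.\<close>

lemma trig_poly_integral_tendsto:
  assumes "prob_space M" "prob_space N"
    and [measurable]: "\<And>n. S n \<in> borel_measurable M" "Z \<in> borel_measurable N"
    and conv: "\<And>u. (\<lambda>n. \<integral>w. iexp (u \<bullet> S n w) \<partial>M) \<longlonglongrightarrow> (\<integral>w. iexp (u \<bullet> Z w) \<partial>N)"
    and "trig_poly g"
  shows "(\<lambda>n. \<integral>w. g (S n w) \<partial>M) \<longlonglongrightarrow> (\<integral>w. g (Z w) \<partial>N)"
  using \<open>trig_poly g\<close>
proof induction
  interpret M: prob_space M by fact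
  interpret N: prob_space N by fact
  case (cos c u a)
  have eq: "(\<integral>w. c * cos (u \<bullet> V w + a) \<partial>K) = Re (of_real c * cis a * (\<integral>w. iexp (u \<bullet> V w) \<partial>K))"
    if "prob_space K" and [measurable]: "V \<in> borel_measurable K" for K :: "'x measure" and V
  proof -
    interpret K: prob_space K by fact
    have int: "integrable K (\<lambda>w. iexp (u \<bullet> V w))"
      by (rule K.integrable_const_bound[where B = 1]) auto
    have "of_real c * cis a * (\<integral>w. iexp (u \<bullet> V w) \<partial>K) = (\<integral>w. of_real c * cis a * iexp (u \<bullet> V w) \<partial>K)"
      using int by simp
    also have "Re \<dots> = (\<integral>w. Re (of_real c * cis a * iexp (u \<bullet> V w)) \<partial>K)"
      using int by (intro integral_Re[symmetric]) simp
    also have "(\<lambda>w. Re (of_real c * cis a * iexp (u \<bullet> V w))) = (\<lambda>w. c * cos (u \<bullet> V w + a))"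
      by (simp add: cis_conv_exp[symmetric] cis_mult mult.assoc add.commute)
    finally show ?thesis by simp
  qed
  show ?case
    unfolding eq[OF assms(1,3)] eq[OF assms(2,4)]
    by (intro tendsto_Re tendsto_mult_left conv)
next
  interpret M: prob_space M by fact
  interpret N: prob_space N by fact
  case (add f g)
  have "integrable M (\<lambda>w. f (S n w))" "integrable M (\<lambda>w. g (S n w))"
    "integrable N (\<lambda>w. f (Z w))" "integrable N (\<lambda>w. g (Z w))" for n
    using trig_poly_bounded_continuous[OF add(1)] trig_poly_bounded_continuous[OF add(2)]
    by (auto intro: M.integrable_bounded_continuous N.integrable_bounded_continuous)
  then show ?case using tendsto_add[OF add.IH] by simp
qed

lemma (in prob_space) norm_tail_small:
  fixes V :: "'a \<Rightarrow> 'b::euclidean_space"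
  assumes [measurable]: "V \<in> borel_measurable M" and "0 < e"
  shows "\<exists>R. prob {w \<in> space M. R < norm (V w)} \<le> e"
proof -
  have "(\<lambda>k. prob {w \<in> space M. real k < norm (V w)}) \<longlonglongrightarrow> prob (\<Inter>k. {w \<in> space M. real k < norm (V w)})"
    by (rule finite_Lim_measure_decseq) (auto simp: decseq_def)
  also have "(\<Inter>k. {w \<in> space M. real k < norm (V w)}) = {}"
  proof -
    have "\<exists>k. \<not> real k < norm (V w)" for w
      using real_arch_simple[of "norm (V w)"] by (auto simp: not_less)
    then show ?thesis by blast
  qed
  finally have "\<forall>\<^sub>F k in sequentially. prob {w \<in> space M. real k < norm (V w)} < e"
    using \<open>0 < e\<close> by (intro order_tendstoD) auto
  then show ?thesis by (auto simp: eventually_sequentially intro: less_imp_le)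
qed

text \<open>The approximation of f by a trigonometric polynomial is good only on a ball. Tightness
  of the sequence controls the outside uniformly in n, and the single law of \<open>Z\<close> is
  tight by itself.\<close>

theorem Cramer_Wold_integral_tendsto:
  fixes f :: "real ^ 'd \<Rightarrow> real"
  assumes MN: "prob_space M" "prob_space N"
    and S[measurable]: "\<And>n. S n \<in> borel_measurable M" and Z[measurable]: "Z \<in> borel_measurable N"
    and conv: "\<And>u. (\<lambda>n. \<integral>w. iexp (u \<bullet> S n w) \<partial>M) \<longlonglongrightarrow> (\<integral>w. iexp (u \<bullet> Z w) \<partial>N)"
    and tight: "\<And>e::real. 0 < e \<Longrightarrow> \<exists>R. \<forall>n. measure M {w \<in> space M. R < norm (S n w)} \<le> e"
    and f: "continuous_on UNIV f" "\<And>x. \<bar>f x\<bar> \<le> B"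
  shows "(\<lambda>n. \<integral>w. f (S n w) \<partial>M) \<longlonglongrightarrow> (\<integral>w. f (Z w) \<partial>N)"
proof (rule LIMSEQ_I)
  interpret M: prob_space M by fact
  interpret N: prob_space N by fact
  fix r :: real assume "0 < r"
  have B: "0 \<le> B" using f(2)[of 0] by simp
  \<comment> \<open>Each of the two approximations costs (2 + 2 B) e and the convergence for the
    trigonometric polynomial costs e, in total (5 + 4 B) e.\<close>
  define e where "e = r / (5 + 4 * B)"
  have e: "0 < e" using \<open>0 < r\<close> B by (simp add: e_def)
  obtain R1 where R1: "\<And>n. measure M {w \<in> space M. R1 < norm (S n w)} \<le> e" using tight[OF e] by blast
  obtain R2 where R2: "measure N {w \<in> space N. R2 < norm (Z w)} \<le> e"
    using N.norm_tail_small[OF Z e] by blast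
  define R where "R = max 0 (max R1 R2)"
  have RS: "measure M {w \<in> space M. R < norm (S n w)} \<le> e" for n
    by (rule order_trans[OF M.finite_measure_mono R1[of n]]) (auto simp: R_def)
  have RZ: "measure N {w \<in> space N. R < norm (Z w)} \<le> e"
    by (rule order_trans[OF N.finite_measure_mono R2]) (auto simp: R_def)
  have "uniformly_continuous_on (cball 0 R) f"
    by (intro compact_uniformly_continuous continuous_on_subset[OF f(1)]) auto
  then obtain \<delta> where \<delta>: "0 < \<delta>"
    "\<And>x y. x \<in> cball 0 R \<Longrightarrow> y \<in> cball 0 R \<Longrightarrow> dist y x < \<delta> \<Longrightarrow> dist (f y) (f x) < e"
    using e unfolding uniformly_continuous_on_def by blast
  obtain L where L: "0 < L" "\<And>x :: real ^ 'd. norm x \<le> R \<Longrightarrow> norm (sine_map L x - x) < \<delta>"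
    using sine_map_close[OF \<delta>(1), of R] by (auto simp: R_def)
  have close: "\<bar>f (sine_map L x) - f x\<bar> \<le> e" if "norm x \<le> R" for x
    using \<delta>(2)[of x "sine_map L x"] L(2)[OF that] norm_sine_map_le[OF L(1), of x] that
    by (simp add: dist_norm)
  obtain p where p: "real_polynomial_function p"
    "\<And>y. y \<in> cbox (\<chi> i. - L) (\<chi> i. L) \<Longrightarrow> \<bar>f y - p y\<bar> < e"
    using Stone_Weierstrass_real_polynomial_function[OF compact_cbox continuous_on_subset[OF f(1) subset_UNIV] e]
    by metis
  define g where "g x = p (sine_map L x)" for x
  have g: "trig_poly g" unfolding g_def by (rule trig_poly_sine_map[OF p(1)])
  have "sine_map L x \<in> cbox (\<chi> i. - L) (\<chi> i. L)" for x :: "real ^ 'd"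
    using mult_left_mono[OF sin_ge_minus_one less_imp_le[OF L(1)]]
      mult_left_mono[OF sin_le_one less_imp_le[OF L(1)]]
    by (simp add: mem_box_cart sine_map_def)
  then have fg: "\<bar>f (sine_map L x) - g x\<bar> < e" for x using p(2) by (simp add: g_def)
  \<comment> \<open>Inside the ball both approximations are within e; outside, f is compared with
    its composition only through the bound B on each.\<close>
  have pointwise: "\<bar>f x - g x\<bar> \<le> 2 * e + 2 * B * indicator {x. R < norm x} x" for x
  proof (cases "norm x \<le> R")
    case True
    then show ?thesis using close[OF True] fg[of x] by (simp add: indicator_def)
  next
    case False
    then show ?thesis using fg[of x] f(2)[of x] f(2)[of "sine_map L x"] e by (simp add: indicator_def)
  qed
  have approx: "\<bar>(\<integral>w. f (V w) \<partial>K) - (\<integral>w. g (V w) \<partial>K)\<bar> \<le> (2 + 2 * B) * e"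
    if K: "prob_space K" and V[measurable]: "V \<in> borel_measurable K"
      and small: "measure K {w \<in> space K. R < norm (V w)} \<le> e" for K :: "'x measure" and V
  proof -
    interpret K: prob_space K by fact
    have intf: "integrable K (\<lambda>w. f (V w))" by (rule K.integrable_bounded_continuous[OF V f])
    have intg: "integrable K (\<lambda>w. g (V w))"
      using trig_poly_bounded_continuous[OF g] K.integrable_bounded_continuous[OF V] by blast
    have inti: "integrable K (\<lambda>w. indicator {w \<in> space K. R < norm (V w)} w :: real)"
      by (simp add: K.emeasure_eq_measure)
    have "\<bar>(\<integral>w. f (V w) \<partial>K) - (\<integral>w. g (V w) \<partial>K)\<bar> = \<bar>\<integral>w. f (V w) - g (V w) \<partial>K\<bar>"
      using intf intg by simp
    also have "\<dots> \<le> (\<integral>w. \<bar>f (V w) - g (V w)\<bar> \<partial>K)" by (rule integral_abs_bound)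
    also have "\<dots> \<le> (\<integral>w. 2 * e + 2 * B * indicator {w \<in> space K. R < norm (V w)} w \<partial>K)"
      using intf intg inti pointwise by (intro integral_mono) (auto simp: indicator_def)
    also have "\<dots> = 2 * e + 2 * B * measure K {w \<in> space K. R < norm (V w)}"
      using inti by (simp add: K.prob_space)
    also have "\<dots> \<le> 2 * e + 2 * B * e" using small B by (intro add_left_mono mult_left_mono) auto
    finally show ?thesis by (simp add: algebra_simps)
  qed
  have "(\<lambda>n. \<integral>w. g (S n w) \<partial>M) \<longlonglongrightarrow> (\<integral>w. g (Z w) \<partial>N)"
    by (rule trig_poly_integral_tendsto[OF MN S Z conv g])
  from LIMSEQ_D[OF this e] obtain n0 where
    n0: "\<And>n. n \<ge> n0 \<Longrightarrow> \<bar>(\<integral>w. g (S n w) \<partial>M) - (\<integral>w. g (Z w) \<partial>N)\<bar> < e" by auto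
  show "\<exists>n0. \<forall>n\<ge>n0. norm ((\<integral>w. f (S n w) \<partial>M) - (\<integral>w. f (Z w) \<partial>N)) < r"
  proof (intro exI allI impI)
    fix n assume "n \<ge> n0"
    have "\<bar>(\<integral>w. f (S n w) \<partial>M) - (\<integral>w. f (Z w) \<partial>N)\<bar> < (2 + 2 * B) * e + e + (2 + 2 * B) * e"
      using approx[OF MN(1) S RS, of n] approx[OF MN(2) Z RZ] n0[OF \<open>n \<ge> n0\<close>] by linarith
    also have "\<dots> = (5 + 4 * B) * e" by (simp add: algebra_simps)
    also have "\<dots> = r" using B by (simp add: e_def)
    finally show "norm ((\<integral>w. f (S n w) \<partial>M) - (\<integral>w. f (Z w) \<partial>N)) < r" by simp
  qed
qed

lemma (in prob_space) integral_iexp: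
  assumes [measurable]: "V \<in> borel_measurable M"
  shows "(\<integral>w. iexp (V w) \<partial>M) = Complex (\<integral>w. cos (V w) \<partial>M) (\<integral>w. sin (V w) \<partial>M)"
proof -
  have "integrable M (\<lambda>w. iexp (V w))" by (rule integrable_const_bound[where B = 1]) auto
  then show ?thesis
    using integral_Re[of M "\<lambda>w. iexp (V w)"] integral_Im[of M "\<lambda>w. iexp (V w)"]
    by (simp add: complex_eq_iff cis_conv_exp[symmetric])
qed

text \<open>Continuous mapping in terms of characteristic functions: \<open>g\<close> may be
  unbounded, since only its cosine and sine are integrated.\<close>

corollary Cramer_Wold_iexp_tendsto:
  fixes g :: "real ^ 'd \<Rightarrow> real"
  assumes MN: "prob_space M" "prob_space N"
    and S[measurable]: "\<And>n. S n \<in> borel_measurable M" and Z[measurable]: "Z \<in> borel_measurable N"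
    and conv: "\<And>u. (\<lambda>n. \<integral>w. iexp (u \<bullet> S n w) \<partial>M) \<longlonglongrightarrow> (\<integral>w. iexp (u \<bullet> Z w) \<partial>N)"
    and tight: "\<And>e::real. 0 < e \<Longrightarrow> \<exists>R. \<forall>n. measure M {w \<in> space M. R < norm (S n w)} \<le> e"
    and g: "continuous_on UNIV g"
  shows "(\<lambda>n. \<integral>w. iexp (g (S n w)) \<partial>M) \<longlonglongrightarrow> (\<integral>w. iexp (g (Z w)) \<partial>N)"
proof -
  have [measurable]: "g \<in> borel_measurable borel" by (rule borel_measurable_continuous_onI[OF g])
  have "(\<lambda>n. \<integral>w. cos (g (S n w)) \<partial>M) \<longlonglongrightarrow> (\<integral>w. cos (g (Z w)) \<partial>N)"
    by (rule Cramer_Wold_integral_tendsto[OF MN S Z conv tight, where B = 1 and f = "\<lambda>x. cos (g x)"])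
       (auto intro!: continuous_intros g)
  moreover have "(\<lambda>n. \<integral>w. sin (g (S n w)) \<partial>M) \<longlonglongrightarrow> (\<integral>w. sin (g (Z w)) \<partial>N)"
    by (rule Cramer_Wold_integral_tendsto[OF MN S Z conv tight, where B = 1 and f = "\<lambda>x. sin (g x)"])
       (auto intro!: continuous_intros g)
  ultimately show ?thesis
    by (simp add: prob_space.integral_iexp[OF MN(1)] prob_space.integral_iexp[OF MN(2)] tendsto_Complex)
qed


section \<open>Independent sums\<close>

text \<open>The cross terms vanish by independence and centring. The resulting linear growth in n is
  what makes the normalised sums tight.\<close>

lemma (in prob_space) second_moment_indep_sum:
  fixes a :: "nat \<Rightarrow> 'a \<Rightarrow> real"
  assumes indep: "indep_vars (\<lambda>_. borel) a UNIV"
    and mean: "\<And>i. expectation (a i) = 0" and sq: "\<And>i. integrable M (\<lambda>w. (a i w)\<^sup>2)"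
    and var: "\<And>i. expectation (\<lambda>w. (a i w)\<^sup>2) = v"
  shows "integrable M (\<lambda>w. (\<Sum>i<n. a i w)\<^sup>2) \<and> expectation (\<lambda>w. (\<Sum>i<n. a i w)\<^sup>2) = real n * v"
proof (induction n)
  case (Suc n)
  have rv[measurable]: "random_variable borel (a i)" for i
    using indep by (simp add: indep_vars_def2)
  have int: "integrable M (a i)" for i
    by (rule square_integrable_imp_integrable[OF rv sq])
  have intS: "integrable M (\<lambda>w. \<Sum>i<n. a i w)" using int by simp
  have "indep_vars (\<lambda>_. borel) a (insert n {..<n})" by (rule indep_vars_subset[OF indep]) simp
  then have ind: "indep_var borel (a n) borel (\<lambda>w. \<Sum>i<n. a i w)"
    by (intro indep_vars_sum) auto
  have prod: "integrable M (\<lambda>w. a n w * (\<Sum>i<n. a i w))"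
    "expectation (\<lambda>w. a n w * (\<Sum>i<n. a i w)) = 0"
    using indep_var_integrable[OF ind int intS] indep_var_lebesgue_integral[OF ind int intS] mean by auto
  have eq: "(\<Sum>i<Suc n. a i w)\<^sup>2 = (\<Sum>i<n. a i w)\<^sup>2 + (2 * (a n w * (\<Sum>i<n. a i w)) + (a n w)\<^sup>2)" for w
    by (simp add: power2_sum algebra_simps)
  show ?case
    unfolding eq using Suc prod sq var by (simp add: algebra_simps)
qed simp

lemma (in prob_space) iexp_indep_sum_tendsto:
  fixes a :: "nat \<Rightarrow> 'a \<Rightarrow> real"
  assumes indep: "indep_vars (\<lambda>_. borel) a UNIV"
    and mean: "\<And>i. expectation (a i) = 0" and sq: "\<And>i. integrable M (\<lambda>w. (a i w)\<^sup>2)"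
    and var: "\<And>i. expectation (\<lambda>w. (a i w)\<^sup>2) = v"
    and distr: "\<And>i. distr M borel (a i) = \<mu>"
  shows "(\<lambda>n. \<integral>w. iexp ((\<Sum>i<n. a i w) / sqrt n) \<partial>M) \<longlonglongrightarrow> of_real (exp (- v / 2))"
proof -
  have rv[measurable]: "random_variable borel (a i)" for i
    using indep by (simp add: indep_vars_def2)
  have "0 \<le> v" unfolding var[of 0, symmetric] by simp
  show ?thesis
  proof (cases "v = 0")
    case True
    have "AE w in M. (a i w)\<^sup>2 = 0" for i
      using integral_nonneg_eq_0_iff_AE[OF sq[of i]] var[of i] True by simp
    then have ae: "AE w in M. \<forall>i. a i w = 0" by (subst AE_all_countable) simp
    have "(\<integral>w. iexp ((\<Sum>i<n. a i w) / sqrt n) \<partial>M) = (\<integral>w. 1 \<partial>M)" for n :: nat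
      using ae by (intro integral_cong_AE) (auto elim!: eventually_mono)
    then show ?thesis using True by (simp add: prob_space)
  next
    case False
    define \<sigma> where "\<sigma> = sqrt v"
    have \<sigma>: "0 < \<sigma>" "\<sigma>\<^sup>2 = v" using False \<open>0 \<le> v\<close> by (auto simp: \<sigma>_def)
    have "weak_conv_m (\<lambda>n. distr M borel (\<lambda>w. (\<Sum>i<n. a i w) / sqrt (real n * \<sigma>\<^sup>2))) std_normal_distribution"
      by (rule central_limit_theorem_zero_mean[OF indep mean \<sigma>(1) sq _ distr])
         (simp add: mean var \<sigma>)
    then have "(\<lambda>n. char (distr M borel (\<lambda>w. (\<Sum>i<n. a i w) / sqrt (real n * \<sigma>\<^sup>2))) \<sigma>)
        \<longlonglongrightarrow> char std_normal_distribution \<sigma>"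
      by (intro levy_continuity1) (auto intro: real_distribution_distr real_dist_normal_dist)
    moreover have "char (distr M borel (\<lambda>w. (\<Sum>i<n. a i w) / sqrt (real n * \<sigma>\<^sup>2))) \<sigma>
        = (\<integral>w. iexp ((\<Sum>i<n. a i w) / sqrt n) \<partial>M)" for n :: nat
      unfolding char_def using \<sigma>(1) by (subst integral_distr) (auto simp: real_sqrt_mult)
    ultimately show ?thesis by (simp add: char_std_normal_distribution \<sigma>(2))
  qed
qed

lemma centered_normal_iexp:
  assumes Z: "centered_normal N Z S"
  shows "(\<integral>w. iexp (u \<bullet> Z w) \<partial>N) = of_real (exp (- (u \<bullet> (S *v u)) / 2))"
proof -
  interpret prob_space N using Z by (simp add: centered_normal_def)
  have [measurable]: "Z \<in> borel_measurable N" using Z by (simp add: centered_normal_def)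
  define v where "v = u \<bullet> (S *v u)"
  have v: "0 \<le> v" and "if v = 0 then AE w in N. u \<bullet> Z w = 0
         else distributed N lborel (\<lambda>w. u \<bullet> Z w) (\<lambda>t. ennreal (normal_density 0 (sqrt v) t))"
    using Z by (auto simp: centered_normal_def v_def Let_def)
  then consider "v = 0" "AE w in N. u \<bullet> Z w = 0"
    | "0 < v" "distributed N lborel (\<lambda>w. u \<bullet> Z w) (\<lambda>t. ennreal (normal_density 0 (sqrt v) t))"
    by (auto split: if_splits)
  then show ?thesis
  proof cases
    case 1
    have "(\<integral>w. iexp (u \<bullet> Z w) \<partial>N) = (\<integral>w. 1 \<partial>N)"
      using 1(2) by (intro integral_cong_AE) (auto elim!: eventually_mono)
    then show ?thesis using 1 by (simp add: prob_space v_def)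
  next
    case 2
    then have "distributed N lborel (\<lambda>w. (u \<bullet> Z w) / sqrt v) std_normal_density"
      using normal_standard_normal_convert[of "sqrt v" "\<lambda>w. u \<bullet> Z w" 0] by simp
    then have d: "distr N lborel (\<lambda>w. (u \<bullet> Z w) / sqrt v) = std_normal_distribution"
      by (simp add: distributed_def)
    have "(\<integral>w. iexp (u \<bullet> Z w) \<partial>N) = char (distr N lborel (\<lambda>w. (u \<bullet> Z w) / sqrt v)) (sqrt v)"
      unfolding char_def using 2(1) by (subst integral_distr) auto
    then show ?thesis unfolding d using 2(1) by (simp add: char_std_normal_distribution v_def)
  qed
qed

lemma centered_normal_quadratic_nonneg:
  "centered_normal N Z S \<Longrightarrow> 0 \<le> u \<bullet> (S *v u)"
  by (auto simp: centered_normal_def Let_def)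

section \<open>The logistic model\<close>

lemma outer_quadratic: "u \<bullet> (outer x x *v u) = (u \<bullet> x)\<^sup>2"
proof -
  have "outer x x *v u = (x \<bullet> u) *\<^sub>R x"
    by (simp add: vec_eq_iff outer_def matrix_vector_mult_def inner_vec_def sum_distrib_left sum_distrib_right mult_ac)
  then show ?thesis by (simp add: power2_eq_square inner_commute)
qed

lemma norm_outer: "norm (outer x x) = (norm x)\<^sup>2"
proof -
  have "outer x x $ i = (x $ i) *\<^sub>R x" for i by (simp add: outer_def vec_eq_iff)
  then have "norm (outer x x) = sqrt ((norm x)\<^sup>2 * (\<Sum>i\<in>UNIV. (x $ i)\<^sup>2))"
    by (simp add: norm_vec_def[of "outer x x"] L2_set_def power_mult_distrib sum_distrib_left mult.commute)
  also have "(\<Sum>i\<in>UNIV. (x $ i)\<^sup>2) = (norm x)\<^sup>2"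
    by (simp add: norm_vec_def L2_set_def sum_nonneg)
  finally show ?thesis unfolding real_sqrt_mult real_sqrt_abs by (simp add: power2_eq_square)
qed

lemma one_div_one_plus_exp_le_1 [simp]: "1 / (1 + exp t) \<le> (1 :: real)"
  by (simp add: divide_le_eq_1 add_pos_pos)

lemma abs_mult_one_div_one_plus_exp_le: "\<bar>c * (1 / (1 + exp t))\<bar> \<le> \<bar>c :: real\<bar>"
  unfolding abs_mult by (intro mult_left_le) (simp_all add: add_nonneg_nonneg)

locale logistic_design =
  fixes D :: "((real ^ 'd) \<times> real) measure" and b :: "real ^ 'd" and f :: "real ^ 'd \<Rightarrow> ennreal"
  assumes model: "logistic_model D b"
    and density: "distributed D lborel fst f" "AE x in lborel. 0 < f x"
    and second_moment: "integrable D (\<lambda>z. (norm (fst z))\<^sup>2)"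
begin

sublocale prob_space D using model by (simp add: logistic_model_def)

lemma sets_D [measurable_cong, simp]: "sets D = sets borel"
  using model by (simp add: logistic_model_def)

lemma space_D [simp]: "space D = UNIV"
  using sets_eq_imp_space_eq[OF sets_D] by simp

lemma AE_label: "AE z in D. snd z \<in> {-1, 1}"
  using model by (simp add: logistic_model_def)

lemma measurable_D: "g \<in> borel_measurable borel \<Longrightarrow> g \<in> borel_measurable D"
  by (simp add: measurable_cong_sets[OF sets_D refl])

lemma measurable_fst_snd_D [measurable]: "fst \<in> D \<rightarrow>\<^sub>M borel" "snd \<in> D \<rightarrow>\<^sub>M borel"
  by (simp_all add: measurable_cong_sets[OF sets_D refl] borel_measurable_continuous_onI continuous_on_fst continuous_on_snd continuous_on_id)

abbreviation label_prob :: "real \<Rightarrow> real ^ 'd \<Rightarrow> real" where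
  "label_prob y x \<equiv> 1 / (1 + exp (- y * (b \<bullet> x)))"

text \<open>The log-odds are inverted to obtain the conditional probability of label 1, and the
  defining identity of conditional expectation does the rest; label -1 follows by complement. This
  is the only place where the log-odds assumption enters.\<close>

lemma integral_label:
  assumes [measurable]: "g \<in> borel_measurable borel" and int: "integrable D (\<lambda>z. g (fst z))"
    and y: "y \<in> {-1, 1}"
  shows "(\<integral>z. g (fst z) * indicator {y} (snd z) \<partial>D) = (\<integral>z. g (fst z) * label_prob y (fst z) \<partial>D)"
proof -
  let ?F = "vimage_algebra UNIV fst borel :: ((real ^ 'd) \<times> real) measure"
  let ?I = "indicator {w. snd w = 1} :: (real ^ 'd) \<times> real \<Rightarrow> real"
  have fstF: "fst \<in> ?F \<rightarrow>\<^sub>M (borel :: (real ^ 'd) measure)" by (rule measurable_vimage_algebra1) simp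
  have "subalgebra D ?F"
    unfolding subalgebra_def
  proof
    show "sets ?F \<subseteq> sets D"
      unfolding sets_vimage_algebra2[of fst UNIV borel, simplified]
      using measurable_sets[OF measurable_fst_snd_D(1)] by auto
  qed simp
  then interpret C: sigma_finite_subalgebra D ?F
    by (intro finite_measure_subalgebra_is_sigma_finite)
       (simp add: finite_measure_subalgebra_def finite_measure_subalgebra_axioms_def finite_measure_axioms)
  have gF: "(\<lambda>z. g (fst z)) \<in> borel_measurable ?F"
    by (rule measurable_compose[OF fstF assms(1)])
  have I: "?I \<in> borel_measurable D" "?I = (\<lambda>z. indicator {1} (snd z))"
  proof -
    show "?I = (\<lambda>z. indicator {1} (snd z))" by (auto simp: indicator_def)
    then show "?I \<in> borel_measurable D" by simp
  qed
  have intI: "integrable D (\<lambda>z. g (fst z) * indicator A (snd z))" if "A \<in> sets borel" for A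
    using int that by (intro Bochner_Integration.integrable_bound[OF int]) (auto simp: indicator_def)
  have int': "integrable D (\<lambda>z. g (fst z) * label_prob y (fst z))" for y
  proof (rule Bochner_Integration.integrable_bound[OF int])
    show "AE z in D. norm (g (fst z) * label_prob y (fst z)) \<le> norm (g (fst z))"
      unfolding real_norm_def by (intro AE_I2 abs_mult_one_div_one_plus_exp_le)
  qed measurable
  have cond: "AE z in D. real_cond_exp D ?F ?I z = label_prob 1 (fst z)"
  proof -
    have eq: "c = 1 / (1 + exp (- t))" if "0 < c" "c < 1" "ln (c / (1 - c)) = t" for c t :: real
    proof -
      have "exp t = c / (1 - c)" using that by (simp flip: that(3))
      then show ?thesis using that(1,2) by (simp add: exp_minus field_simps)
    qed
    have "AE z in D. 0 < real_cond_exp D ?F ?I z \<and> real_cond_exp D ?F ?I z < 1 \<and>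
        ln (real_cond_exp D ?F ?I z / (1 - real_cond_exp D ?F ?I z)) = b \<bullet> fst z"
      using model unfolding logistic_model_def Let_def by blast
    then show ?thesis
    proof eventually_elim
      case (elim z)
      then show ?case using eq[of "real_cond_exp D ?F ?I z" "b \<bullet> fst z"] by simp
    qed
  qed
  have one: "(\<integral>z. g (fst z) * indicator {1} (snd z) \<partial>D) = (\<integral>z. g (fst z) * label_prob 1 (fst z) \<partial>D)"
  proof -
    have "(\<integral>z. g (fst z) * real_cond_exp D ?F ?I z \<partial>D) = (\<integral>z. g (fst z) * ?I z \<partial>D)"
      by (rule C.real_cond_exp_intg(2)[OF _ gF I(1)]) (simp add: I(2) intI)
    moreover have "(\<integral>z. g (fst z) * real_cond_exp D ?F ?I z \<partial>D) = (\<integral>z. g (fst z) * label_prob 1 (fst z) \<partial>D)"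
      using cond by (intro integral_cong_AE) (auto elim!: eventually_mono intro: measurable_from_subalg[OF C.subalg])
    ultimately show ?thesis by (simp add: I(2))
  qed
  show ?thesis
  proof (cases "y = 1")
    case False
    then have y: "y = -1" using y by simp
    have "(\<integral>z. g (fst z) * indicator {y} (snd z) \<partial>D) = (\<integral>z. g (fst z) - g (fst z) * indicator {1} (snd z) \<partial>D)"
      using AE_label y by (intro integral_cong_AE) (auto elim!: eventually_mono simp: indicator_def)
    also have "\<dots> = (\<integral>z. g (fst z) \<partial>D) - (\<integral>z. g (fst z) * label_prob 1 (fst z) \<partial>D)"
      using int intI[of "{1}"] one by simp
    also have "\<dots> = (\<integral>z. g (fst z) - g (fst z) * label_prob 1 (fst z) \<partial>D)"
      using int int'[of 1] by simp
    also have "(\<lambda>z. g (fst z) - g (fst z) * label_prob 1 (fst z)) = (\<lambda>z. g (fst z) * label_prob y (fst z))"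
      by (rule ext) (simp add: y exp_minus field_simps)
    finally show ?thesis .
  qed (use one in simp)
qed

text \<open>Given the covariate, both labels have strictly positive probability. A null set
  \<open>U \<times> {y}\<close> would therefore force the covariate to avoid U, and by positivity of
  the density U would be Lebesgue null, although it contains a ball.\<close>

lemma support_D:
  assumes U: "open U" "U \<noteq> {}" and y: "y \<in> {-1, 1}"
  shows "emeasure D (U \<times> {y}) \<noteq> 0"
proof
  assume 0: "emeasure D (U \<times> {y}) = 0"
  have [measurable]: "U \<in> sets borel" using U by simp
  let ?g = "indicator U :: real ^ 'd \<Rightarrow> real"
  have int: "integrable D (\<lambda>z. ?g (fst z))"
    by (rule integrable_const_bound[where B = 1]) auto
  have "(\<lambda>z. ?g (fst z) * indicator {y} (snd z)) = (indicator (U \<times> {y}) :: _ \<Rightarrow> real)"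
    by (auto simp: indicator_def)
  then have "(\<integral>z. ?g (fst z) * label_prob y (fst z) \<partial>D) = 0"
    using integral_label[OF _ int y] 0 by (simp add: measure_def)
  moreover have "integrable D (\<lambda>z. ?g (fst z) * label_prob y (fst z))"
    by (rule integrable_const_bound[where B = 1]) (auto intro!: AE_I2 simp: indicator_def add_nonneg_nonneg)
  ultimately have "AE z in D. ?g (fst z) * label_prob y (fst z) = 0"
    by (subst (asm) integral_nonneg_eq_0_iff_AE) (auto simp: add_nonneg_nonneg)
  then have "AE z in D. fst z \<notin> U"
    by (auto elim!: eventually_mono simp: indicator_def split: if_splits)
  then have "AE x in distr D lborel fst. x \<notin> U"
    by (subst AE_distr_iff) auto
  then have "AE x in density lborel f. x \<notin> U"
    using density(1) by (metis distributed_def)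
  then have "AE x in lborel. 0 < f x \<longrightarrow> x \<notin> U"
    by (subst (asm) AE_density) (use density(1) in \<open>auto simp: distributed_def\<close>)
  then have "AE x in lborel. x \<notin> U" using density(2) by (auto elim: eventually_elim2)
  then have "emeasure lborel U = 0" by (subst (asm) AE_iff_measurable[OF _ refl]) auto
  moreover obtain c r where "0 < r" "ball c r \<subseteq> U" using U by (metis open_contains_ball ex_in_conv)
  then have "emeasure lborel (ball c r) \<le> emeasure lborel U" by (intro emeasure_mono) auto
  moreover have "emeasure lborel (ball c r) \<noteq> 0"
    using content_ball_pos[OF \<open>0 < r\<close>, of c] by (auto simp: measure_def)
  ultimately show False by simp
qed

lemma integrable_norm_fst: "integrable D (\<lambda>z. norm (fst z))"
  by (rule square_integrable_imp_integrable) (use second_moment in auto)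

lemma integrable_fst: "integrable D (\<lambda>z. u \<bullet> fst z)"
  by (rule Bochner_Integration.integrable_bound[OF integrable_mult_right[OF integrable_norm_fst, of "norm u"]])
     (auto simp: Cauchy_Schwarz_ineq2)

lemma norm_score_le:
  assumes "snd z \<in> {-1, 1}" shows "norm (score b z) \<le> norm (fst z)"
proof -
  have "\<bar>- snd z / (1 + exp (snd z * (b \<bullet> fst z)))\<bar> \<le> 1" using assms by (auto simp: add_nonneg_nonneg)
  then show ?thesis
    unfolding logistic_h_def norm_scaleR by (intro mult_left_le_one_le) auto
qed

lemma measurable_score_D [measurable]: "score b \<in> borel_measurable D"
  by (rule measurable_D) measurable

lemma integrable_score_sq: "integrable D (\<lambda>z. (u \<bullet> score b z)\<^sup>2)"
proof (rule Bochner_Integration.integrable_bound[OF integrable_mult_right[OF second_moment, of "(norm u)\<^sup>2"]])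
  show "AE z in D. norm ((u \<bullet> score b z)\<^sup>2) \<le> norm ((norm u)\<^sup>2 * (norm (fst z))\<^sup>2)"
    using AE_label
  proof eventually_elim
    case (elim z)
    have "\<bar>u \<bullet> score b z\<bar> \<le> norm u * norm (score b z)" by (rule Cauchy_Schwarz_ineq2)
    also have "\<dots> \<le> norm u * norm (fst z)" using norm_score_le[OF elim] by (rule mult_left_mono) simp
    finally have "\<bar>u \<bullet> score b z\<bar>\<^sup>2 \<le> (norm u * norm (fst z))\<^sup>2" by (intro power_mono) auto
    then show ?case by (simp add: power_mult_distrib)
  qed
qed simp

text \<open>The factor 1 / (1 + exp (y b.x)) in the score of label y is the conditional probability
  of label -y. Multiplied by the probability of y it gives the same product for both labels, and the
  two contributions cancel because of their signs.\<close>

lemma expectation_score: "(\<integral>z. u \<bullet> score b z \<partial>D) = 0"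
proof -
  define g where "g y x = - y / (1 + exp (y * (b \<bullet> x))) * (u \<bullet> x)" for y x
  have [measurable]: "g y \<in> borel_measurable borel" for y unfolding g_def by measurable
  have int: "integrable D (\<lambda>z. g y (fst z))" if "y \<in> {-1, 1}" for y
  proof (rule Bochner_Integration.integrable_bound[OF integrable_fst[of u]])
    have "\<bar>- y / (1 + exp (y * (b \<bullet> x)))\<bar> \<le> 1" for x using that by (auto simp: add_nonneg_nonneg)
    then show "AE z in D. norm (g y (fst z)) \<le> norm (u \<bullet> fst z)"
      unfolding g_def real_norm_def abs_mult by (intro AE_I2 mult_left_le_one_le) auto
  qed measurable
  have intI: "integrable D (\<lambda>z. g y (fst z) * indicator {y} (snd z))" if "y \<in> {-1, 1}" for y
    by (intro Bochner_Integration.integrable_bound[OF int[OF that]]) (auto simp: indicator_def)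
  have intP: "integrable D (\<lambda>z. g y (fst z) * label_prob y (fst z))" if "y \<in> {-1, 1}" for y
  proof (rule Bochner_Integration.integrable_bound[OF int[OF that]])
    show "AE z in D. norm (g y (fst z) * label_prob y (fst z)) \<le> norm (g y (fst z))"
      unfolding real_norm_def by (intro AE_I2 abs_mult_one_div_one_plus_exp_le)
  qed measurable
  have "(\<integral>z. u \<bullet> score b z \<partial>D)
      = (\<integral>z. g 1 (fst z) * indicator {1} (snd z) + g (-1) (fst z) * indicator {-1} (snd z) \<partial>D)"
    using AE_label by (intro integral_cong_AE) (auto elim!: eventually_mono simp: g_def logistic_h_def)
  also have "\<dots> = (\<integral>z. g 1 (fst z) * label_prob 1 (fst z) \<partial>D) + (\<integral>z. g (-1) (fst z) * label_prob (-1) (fst z) \<partial>D)"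
    using intI[of 1] intI[of "-1"] integral_label[OF _ int, of 1 1] integral_label[OF _ int, of "-1" "-1"]
    by simp
  also have "\<dots> = (\<integral>z. g 1 (fst z) * label_prob 1 (fst z) + g (-1) (fst z) * label_prob (-1) (fst z) \<partial>D)"
    using intP[of 1] intP[of "-1"] by simp
  also have "(\<lambda>z. g 1 (fst z) * label_prob 1 (fst z) + g (-1) (fst z) * label_prob (-1) (fst z)) = (\<lambda>z. 0)"
    by (rule ext) (simp add: g_def)
  finally show ?thesis by simp
qed

text \<open>The quadratic form is a bounded linear functional of the matrix and so commutes with the
  integral, whose existence follows from the second moment.\<close>

lemma outer_integral_quadratic:
  assumes [measurable]: "c \<in> borel_measurable D" and c: "AE z in D. \<bar>c z\<bar> \<le> 1"
  shows "u \<bullet> ((\<integral>z. c z *\<^sub>R outer (fst z) (fst z) \<partial>D) *v u) = (\<integral>z. c z * (u \<bullet> fst z)\<^sup>2 \<partial>D)"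
proof -
  have "continuous_on UNIV (\<lambda>x :: real ^ 'd. outer x x)"
    unfolding outer_def by (intro continuous_intros)
  then have [measurable]: "(\<lambda>x :: real ^ 'd. outer x x) \<in> borel_measurable borel"
    by (rule borel_measurable_continuous_onI)
  have int: "integrable D (\<lambda>z. c z *\<^sub>R outer (fst z) (fst z))"
    by (rule Bochner_Integration.integrable_bound[OF second_moment])
       (use c in \<open>auto simp: norm_outer elim!: eventually_mono intro!: mult_left_le_one_le\<close>)
  have "linear (\<lambda>A :: real ^ 'd ^ 'd. u \<bullet> (A *v u))"
    by (rule linearI) (simp_all add: matrix_vector_mult_add_rdistrib inner_add_right scaleR_matrix_vector_assoc[symmetric])
  then have "bounded_linear (\<lambda>A :: real ^ 'd ^ 'd. u \<bullet> (A *v u))"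
    by (simp add: linear_conv_bounded_linear)
  from integral_bounded_linear[OF this int] show ?thesis
    by (simp add: scaleR_matrix_vector_assoc[symmetric] outer_quadratic)
qed

lemma covariance_quadratic:
  "u \<bullet> ((\<integral>(x, y). outer x x \<partial>D) *v u) = (\<integral>z. (u \<bullet> fst z)\<^sup>2 \<partial>D)"
  using outer_integral_quadratic[of "\<lambda>_. 1" u] by (simp add: case_prod_beta')

text \<open>Labels square to 1, so the covariance of the limit is the second moment matrix of the
  score.\<close>

lemma score_covariance_quadratic:
  "u \<bullet> ((\<integral>(x, y). (1 / (1 + exp (y * (b \<bullet> x)))\<^sup>2) *\<^sub>R outer x x \<partial>D) *v u) = (\<integral>z. (u \<bullet> score b z)\<^sup>2 \<partial>D)"
proof -
  let ?c = "\<lambda>z. 1 / (1 + exp (snd z * (b \<bullet> fst z)))\<^sup>2"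
  have "\<bar>?c z\<bar> \<le> 1" for z :: "(real ^ 'd) \<times> real"
    by (simp add: one_le_power)
  then have "u \<bullet> ((\<integral>z. ?c z *\<^sub>R outer (fst z) (fst z) \<partial>D) *v u) = (\<integral>z. ?c z * (u \<bullet> fst z)\<^sup>2 \<partial>D)"
    by (intro outer_integral_quadratic) auto
  also have "\<dots> = (\<integral>z. (u \<bullet> score b z)\<^sup>2 \<partial>D)"
    using AE_label
    by (intro integral_cong_AE) (auto elim!: eventually_mono simp: logistic_h_def power_mult_distrib power_divide)
  finally show ?thesis by (simp add: case_prod_beta')
qed

text \<open>The score is the covariate times a factor of modulus at most 1. This ordering of
  variances drives the stochastic domination for nonzero \<open>b\<close>.\<close>

lemma score_variance_le: "(\<integral>z. (u \<bullet> score b z)\<^sup>2 \<partial>D) \<le> (\<integral>z. (u \<bullet> fst z)\<^sup>2 \<partial>D)"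
proof (rule integral_mono_AE)
  show "integrable D (\<lambda>z. (u \<bullet> fst z)\<^sup>2)"
    by (rule Bochner_Integration.integrable_bound[OF integrable_mult_right[OF second_moment, of "(norm u)\<^sup>2"]])
       (auto simp: power_mult_distrib[symmetric] Cauchy_Schwarz_ineq2 abs_le_square_iff[symmetric] abs_mult)
  show "AE z in D. (u \<bullet> score b z)\<^sup>2 \<le> (u \<bullet> fst z)\<^sup>2"
    using AE_label
  proof eventually_elim
    case (elim z)
    have "\<bar>- snd z / (1 + exp (snd z * (b \<bullet> fst z)))\<bar> \<le> 1" using elim by (auto simp: add_nonneg_nonneg)
    then show ?case
      unfolding logistic_h_def inner_scaleR_right abs_le_square_iff[symmetric] abs_mult
      by (intro mult_left_le_one_le) auto
  qed
qed (rule integrable_score_sq)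

end


section \<open>Measurability of the profile function\<close>

lemma empirical_cong: "(\<And>i. i < n \<Longrightarrow> z i = z' i) \<Longrightarrow> empirical n z = empirical n z'"
  unfolding empirical_def by (intro distr_cong) (auto simp: space_uniform_count_measure)

text \<open>Upper semicontinuity in the covariates at fixed labels: the stability bound provides a
  continuous majorant \<open>\<Phi>\<close> that agrees with the profile at
  \<open>x0\<close>.\<close>

lemma open_profile_less:
  fixes b :: "real ^ 'd" and y :: "nat \<Rightarrow> real"
  assumes q: "1 < q" "1 / p + 1 / q = 1" and n: "0 < n"
  shows "open {x :: nat \<Rightarrow> real ^ 'd. profile q b (empirical n (\<lambda>i. (x i, y i))) < a}"
proof (subst open_subopen, rule ballI)
  have q1: "1 \<le> q" using q(1) by simp
  fix x0 :: "nat \<Rightarrow> real ^ 'd"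
  assume x0: "x0 \<in> {x. profile q b (empirical n (\<lambda>i. (x i, y i))) < a}"
  define \<Phi> where "\<Phi> x = profile q b (empirical n (\<lambda>i. (x0 i, y i)))
      + ennreal ((\<Sum>i<n. lq_norm q (x0 i - x i)) / real n)" for x
  have "profile q b (empirical n (\<lambda>i. (x i, y i))) \<le> \<Phi> x" for x :: "nat \<Rightarrow> real ^ 'd"
  proof -
    have "(\<Sum>i<n. N_cost q (x0 i, y i) (x i, y i)) * ennreal (1 / real n)
        = ennreal ((\<Sum>i<n. lq_norm q (x0 i - x i)) / real n)"
      by (simp add: N_cost_def sum_ennreal ennreal_mult'[symmetric] sum_nonneg)
    then show ?thesis
      using profile_empirical_le[OF q n, of b "\<lambda>i. (x i, y i)" "\<lambda>i. (x0 i, y i)"]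
      by (simp add: \<Phi>_def)
  qed
  then have sub: "{x. \<Phi> x < a} \<subseteq> {x. profile q b (empirical n (\<lambda>i. (x i, y i))) < a}"
    by (auto intro: le_less_trans)
  have "continuous_on UNIV \<Phi>"
    unfolding \<Phi>_def
    by (intro continuous_intros continuous_on_ennreal
        continuous_on_compose2[OF continuous_on_lq_norm[OF q1]]) (use n in auto)
  then have "open {x. \<Phi> x < a}" by (intro open_Collect_less continuous_on_const)
  moreover have "x0 \<in> {x. \<Phi> x < a}" using x0 q1 by (simp add: \<Phi>_def)
  ultimately show "\<exists>T. open T \<and> x0 \<in> T \<and> T \<subseteq> {x. profile q b (empirical n (\<lambda>i. (x i, y i))) < a}"
    using sub by blast
qed

text \<open>The profile is an infimum over an uncountable family, so measurability comes from
  semicontinuity instead. Changing a label costs \<infinity>, which is why the sample space is first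
  split along the finitely many label patterns. For n = 0 the empirical measure does not depend on
  the sample.\<close>

lemma measurable_profile:
  fixes X :: "nat \<Rightarrow> 'w \<Rightarrow> real ^ 'd"
  assumes q: "1 < q" "1 / p + 1 / q = 1"
    and [measurable]: "\<And>i. X i \<in> borel_measurable M" "\<And>i. Y i \<in> borel_measurable M"
    and labels: "\<And>i \<omega>. \<omega> \<in> space M \<Longrightarrow> Y i \<omega> \<in> {-1, 1}"
  shows "(\<lambda>\<omega>. profile q b (empirical n (\<lambda>i. (X i \<omega>, Y i \<omega>)))) \<in> borel_measurable M"
proof (cases "n = 0")
  case True
  then show ?thesis by (subst empirical_cong[where z' = "\<lambda>i. undefined"]) auto
next
  case False
  show ?thesis
  proof (rule borel_measurableI_less)
    fix a
    define W where "W y = {x. profile q b (empirical n (\<lambda>i. (x i, y i :: real))) < a}" for y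
    have [measurable]: "W y \<in> sets borel" for y
      unfolding W_def using open_profile_less[OF q] False by (intro borel_open) simp
    have [measurable]: "(\<lambda>\<omega> i. X i \<omega>) \<in> borel_measurable M"
      by (rule measurable_coordinatewise_then_product) simp
    have "{\<omega> \<in> space M. profile q b (empirical n (\<lambda>i. (X i \<omega>, Y i \<omega>))) < a}
      = (\<Union>y\<in>PiE {..<n} (\<lambda>_. {-1, 1}).
          {\<omega> \<in> space M. (\<forall>i\<in>{..<n}. Y i \<omega> = y i) \<and> (\<lambda>i. X i \<omega>) \<in> W y})" (is "?L = ?R")
    proof (intro equalityI subsetI)
      fix \<omega> assume \<omega>: "\<omega> \<in> ?L"
      define y where "y = restrict (\<lambda>i. Y i \<omega>) {..<n}"
      have "empirical n (\<lambda>i. (X i \<omega>, Y i \<omega>)) = empirical n (\<lambda>i. (X i \<omega>, y i))"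
        by (intro empirical_cong) (simp add: y_def)
      moreover have "y \<in> PiE {..<n} (\<lambda>_. {-1, 1})" using labels \<omega> by (auto simp: y_def)
      moreover have "\<forall>i\<in>{..<n}. Y i \<omega> = y i" by (simp add: y_def)
      ultimately show "\<omega> \<in> ?R" using \<omega> by (intro UN_I[of y]) (simp_all add: W_def)
    next
      fix \<omega> assume "\<omega> \<in> ?R"
      then obtain y where y: "\<omega> \<in> space M" "\<And>i. i < n \<Longrightarrow> Y i \<omega> = y i" "(\<lambda>i. X i \<omega>) \<in> W y" by auto
      then have "empirical n (\<lambda>i. (X i \<omega>, Y i \<omega>)) = empirical n (\<lambda>i. (X i \<omega>, y i))"
        by (intro empirical_cong) simp
      then show "\<omega> \<in> ?L" using y by (simp add: W_def)
    qed
    also have "\<dots> \<in> sets M" by (intro sets.finite_UN finite_PiE) auto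
    finally show "{\<omega> \<in> space M. profile q b (empirical n (\<lambda>i. (X i \<omega>, Y i \<omega>))) < a} \<in> sets M" .
  qed
qed

section \<open>The upper bound\<close>

text \<open>
  The moments reachable at cost at most \<open>c\<close> form a convex set, because mass may be split. So if
  every half-space through \<open>0\<close> is met by moving whole data points, then \<open>0\<close> itself is reachable.
\<close>

lemma profile_le_if_moves:
  fixes z :: "nat \<Rightarrow> (real ^ 'd) \<times> real"
  assumes q: "1 \<le> q" and n: "0 < n"
    and moves: "\<And>\<xi>. norm \<xi> = 1 \<Longrightarrow> \<exists>T. (\<Sum>i<n. lq_norm q (T i - fst (z i))) \<le> real n * c
        \<and> \<xi> \<bullet> (\<Sum>i<n. score b (T i, snd (z i))) < 0"
  shows "profile q b (empirical n z) \<le> ennreal c"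
proof -
  define m where "m T = (\<Sum>i<n. score b (T i, snd (z i)))" for T
  define B where "B = m ` {T. (\<Sum>i<n. lq_norm q (T i - fst (z i))) \<le> real n * c}"
  have "0 \<in> convex hull B"
  proof (rule ccontr)
    assume "0 \<notin> convex hull B"
    then obtain a where a: "a \<noteq> 0" "\<And>v. v \<in> convex hull B \<Longrightarrow> 0 \<le> a \<bullet> v"
      using separating_hyperplane_set_0[OF convex_convex_hull] by blast
    obtain T where T: "(\<Sum>i<n. lq_norm q (T i - fst (z i))) \<le> real n * c" "sgn a \<bullet> m T < 0"
      using moves[of "sgn a"] a(1) by (auto simp: norm_sgn m_def)
    have "m T \<in> convex hull B" using T(1) by (auto simp: B_def intro: hull_inc)
    then have "0 \<le> a \<bullet> m T" by (rule a(2))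
    then have "0 \<le> sgn a \<bullet> m T" by (simp add: sgn_div_norm)
    then show False using T(2) by simp
  qed
  then obtain S u where S: "finite S" "S \<subseteq> B" "\<And>v. v \<in> S \<Longrightarrow> 0 \<le> u v" "sum u S = 1"
    "(\<Sum>v\<in>S. u v *\<^sub>R v) = 0"
    unfolding convex_hull_explicit by blast
  have "\<forall>v\<in>S. \<exists>T. v = m T \<and> (\<Sum>i<n. lq_norm q (T i - fst (z i))) \<le> real n * c"
    using S(2) by (auto simp: B_def)
  then obtain T where T: "\<And>v. v \<in> S \<Longrightarrow> v = m (T v)"
    "\<And>v. v \<in> S \<Longrightarrow> (\<Sum>i<n. lq_norm q (T v i - fst (z i))) \<le> real n * c"
    by metis
  have "(\<Sum>v\<in>S. u v *\<^sub>R (\<Sum>i<n. score b (T v i, snd (z i)))) = (\<Sum>v\<in>S. u v *\<^sub>R v)"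
    using T(1) by (intro sum.cong) (auto simp: m_def)
  then show ?thesis
    using S T by (intro profile_le_mixture[OF q n, where K = S and u = u and T = T]) auto
qed

text \<open>The inequality persists on a product of neighbourhoods of (\<xi>, v) and x. The radius
  is \<open>2 * r\<close> because an observation within \<open>r\<close> of the centre will travel
  by less than \<open>r\<close>, and the slope is evaluated somewhere on its path.\<close>

lemma finite_ascent_family:
  fixes b :: "real ^ 'd"
  assumes q: "1 < q" and conj: "1 / p + 1 / q = 1" and \<epsilon>: "0 < \<epsilon>"
  shows "\<exists>K. finite K
    \<and> (\<forall>(x, y, w, r)\<in>K. y \<in> {-1, 1} \<and> lq_norm q w \<le> 1 \<and> 0 < r)
    \<and> (\<forall>\<xi> v. norm \<xi> = 1 \<longrightarrow> norm v \<le> R \<longrightarrow> (\<exists>(x, y, w, r)\<in>K. \<forall>x'\<in>ball x (2 * r).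
         \<xi> \<bullet> v < (support_fun (slope_set p b) v + \<epsilon>) * (hgrad b y \<xi> x' \<bullet> w)))"
proof -
  have p: "1 \<le> p" by (rule conj_exponent_ge_1[OF q conj])
  let ?\<sigma> = "support_fun (slope_set p b)"
  let ?S = "sphere 0 1 \<times> cball 0 R :: ((real ^ 'd) \<times> (real ^ 'd)) set"
  have cont\<sigma>: "continuous_on UNIV ?\<sigma>"
    using support_fun_lipschitz[OF slope_set_subset_cball[OF p], of b] zero_in_slope_set[OF p, of b]
    by (auto intro: lipschitz_on_continuous_on)
  define good where "good s U x y w r \<longleftrightarrow> open U \<and> s \<in> U \<and> y \<in> {-1, 1} \<and> lq_norm q w \<le> 1 \<and> 0 < r \<and>
      (\<forall>(\<xi>, v)\<in>U. \<forall>x'\<in>ball x (2 * r). \<xi> \<bullet> v < (?\<sigma> v + \<epsilon>) * (hgrad b y \<xi> x' \<bullet> w))" for s U x y w and r :: real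
  have "\<exists>U x y w r. good s U x y w r"
    if s: "s \<in> ?S" for s
  proof -
    obtain \<xi> v where sv: "s = (\<xi>, v)" by (cases s)
    have "\<xi> \<noteq> 0" using s sv by auto
    have "?\<sigma> v < ?\<sigma> v + \<epsilon>" using \<epsilon> by simp
    from exists_ascent_direction[OF q conj this \<open>\<xi> \<noteq> 0\<close>] obtain x w y where
      y: "y \<in> {-1, 1}" and w: "lq_norm q w \<le> 1" and lt: "\<xi> \<bullet> v < (?\<sigma> v + \<epsilon>) * (hgrad b y \<xi> x \<bullet> w)"
      by blast
    define E where "E = {t. fst (fst t) \<bullet> snd (fst t)
        < (?\<sigma> (snd (fst t)) + \<epsilon>) * (hgrad b y (fst (fst t)) (snd t) \<bullet> w)}"
    have "open E" unfolding E_def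
      by (intro open_Collect_less continuous_intros continuous_on_compose2[OF cont\<sigma>]) auto
    moreover have "(s, x) \<in> E" using lt by (simp add: E_def sv)
    ultimately obtain U V where UV: "open U" "open V" "(s, x) \<in> U \<times> V" "U \<times> V \<subseteq> E"
      by (rule open_prod_elim)
    obtain e where e: "0 < e" "ball x e \<subseteq> V" using UV by (metis open_contains_ball mem_Sigma_iff)
    have "\<forall>(\<xi>, v)\<in>U. \<forall>x'\<in>ball x (2 * (e / 2)). \<xi> \<bullet> v < (?\<sigma> v + \<epsilon>) * (hgrad b y \<xi> x' \<bullet> w)"
      using UV(4) e(2) by (fastforce simp: E_def)
    then have "good s U x y w (e / 2)" using UV y w e by (simp add: good_def)
    then show ?thesis by blast
  qed
  then obtain U x y w r where U: "\<And>s. s \<in> ?S \<Longrightarrow> good s (U s) (x s) (y s) (w s) (r s)"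
    by metis
  have "compact ?S" by (intro compact_Times) auto
  then obtain C where C: "C \<subseteq> ?S" "finite C" "?S \<subseteq> (\<Union>s\<in>C. U s)"
    by (rule compactE_image[where f = U and C = ?S]) (use U in \<open>auto simp: good_def\<close>)
  show ?thesis
  proof (intro exI[of _ "(\<lambda>s. (x s, y s, w s, r s)) ` C"] conjI allI impI)
    show "finite ((\<lambda>s. (x s, y s, w s, r s)) ` C)" using C by simp
    show "\<forall>(x, y, w, r)\<in>(\<lambda>s. (x s, y s, w s, r s)) ` C. y \<in> {-1, 1} \<and> lq_norm q w \<le> 1 \<and> 0 < r"
      using U C(1) unfolding good_def by blast
    fix \<xi> v :: "real ^ 'd" assume "norm \<xi> = 1" "norm v \<le> R"
    then have "(\<xi>, v) \<in> ?S" by simp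
    then obtain s where s: "s \<in> C" "(\<xi>, v) \<in> U s" using C(3) by blast
    then have "\<forall>x'\<in>ball (x s) (2 * r s). \<xi> \<bullet> v < (?\<sigma> v + \<epsilon>) * (hgrad b (y s) \<xi> x' \<bullet> w s)"
      using U[of s] C(1) unfolding good_def by blast
    then show "\<exists>(x, y, w, r)\<in>(\<lambda>s. (x s, y s, w s, r s)) ` C. \<forall>x'\<in>ball x (2 * r).
         \<xi> \<bullet> v < (?\<sigma> v + \<epsilon>) * (hgrad b y \<xi> x' \<bullet> w)"
      using s(1) by blast
  qed
qed

text \<open>
  Moving the \<open>m\<close> data points with label \<open>y\<close> near \<open>x\<close> by \<open>-t w\<close>, where \<open>t = sqrt n * c / m\<close>, costs at
  most \<open>c / sqrt n\<close> per data point and changes the moment in direction \<open>\<xi>\<close> by more than \<open>- \<xi> \<bullet> g\<close>.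
\<close>

lemma profile_le_support_fun:
  fixes z :: "nat \<Rightarrow> (real ^ 'd) \<times> real" and b :: "real ^ 'd"
  assumes q: "1 < q" and conj: "1 / p + 1 / q = 1" and n: "0 < n"
    and g: "g = (1 / sqrt (real n)) *\<^sub>R (\<Sum>i<n. score b (z i))"
    and c: "0 \<le> c"
    and family: "\<And>\<xi>. norm \<xi> = 1 \<Longrightarrow> \<exists>(x, y, w, r)\<in>K. \<forall>x'\<in>ball x (2 * r). \<xi> \<bullet> g < c * (hgrad b y \<xi> x' \<bullet> w)"
    and K: "\<And>x y w r. (x, y, w, r) \<in> K \<Longrightarrow> lq_norm q w \<le> 1 \<and> 0 < r"
    and count: "\<And>x y w r. (x, y, w, r) \<in> K \<Longrightarrow> 0 < card {i\<in>{..<n}. z i \<in> ball x r \<times> {y}}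
        \<and> real CARD('d) * (sqrt (real n) * c / real (card {i\<in>{..<n}. z i \<in> ball x r \<times> {y}})) < r"
  shows "profile q b (empirical n z) \<le> ennreal (c / sqrt (real n))"
proof (rule profile_le_if_moves[OF _ n])
  have q1: "1 \<le> q" using q by simp
  then show "1 \<le> q" .
  fix \<xi> :: "real ^ 'd" assume "norm \<xi> = 1"
  from family[OF this] obtain x y w r where k: "(x, y, w, r) \<in> K"
    and asc: "\<And>x'. x' \<in> ball x (2 * r) \<Longrightarrow> \<xi> \<bullet> g < c * (hgrad b y \<xi> x' \<bullet> w)"
    by auto
  define I where "I = {i\<in>{..<n}. z i \<in> ball x r \<times> {y}}"
  define t where "t = sqrt (real n) * c / real (card I)"
  define T where "T i = (if i \<in> I then fst (z i) - t *\<^sub>R w else fst (z i))" for i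
  have m: "0 < card I" and small: "real CARD('d) * t < r" using count[OF k] by (auto simp: I_def t_def)
  have I: "I \<subseteq> {..<n}" "finite I" by (auto simp: I_def)
  have t0: "0 \<le> t" using c by (simp add: t_def)
  have w: "lq_norm q w \<le> 1" and r: "0 < r" using K[OF k] by auto
  \<comment> \<open>The cost is measured in the q-norm but the ball is Euclidean; the dimension
    compares the two norms.\<close>
  have "norm (t *\<^sub>R w) = t * norm w" using t0 by simp
  also have "\<dots> \<le> t * (real CARD('d) * lq_norm q w)"
    by (intro mult_left_mono norm_le_lq_norm q1 t0)
  also have "\<dots> \<le> t * (real CARD('d) * 1)" using w t0 by (intro mult_left_mono) auto
  finally have step: "norm (t *\<^sub>R w) < r" using small by (simp add: mult.commute)
  have sqrtn: "sqrt (real n) * sqrt (real n) = real n" by simp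
  have cost: "(\<Sum>i<n. lq_norm q (T i - fst (z i))) \<le> real n * (c / sqrt (real n))"
  proof -
    have "(\<Sum>i<n. lq_norm q (T i - fst (z i))) = (\<Sum>i<n. if i \<in> I then t * lq_norm q w else 0)"
      using q1 t0 by (intro sum.cong) (auto simp: T_def lq_norm_scaleR)
    also have "\<dots> = (\<Sum>i\<in>I. t * lq_norm q w)"
      using I(1) by (simp add: sum.If_cases Int_absorb1)
    also have "\<dots> \<le> (\<Sum>i\<in>I. t * 1)" using w t0 by (intro sum_mono mult_left_mono) auto
    also have "\<dots> = sqrt (real n) * c" using m by (simp add: t_def)
    also have "\<dots> = real n * (c / sqrt (real n))" using n by (simp add: field_simps)
    finally show ?thesis .
  qed
  \<comment> \<open>Summed over the \<open>card I\<close> moved points, these bounds exceed in size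
    exactly what is to be cancelled, as the pairing of \<open>\<xi>\<close> with the total score is
    sqrt n times its pairing with \<open>g\<close>.\<close>
  have strict: "\<xi> \<bullet> score b (T i, snd (z i)) - \<xi> \<bullet> score b (z i) < - (sqrt (real n) / real (card I)) * (\<xi> \<bullet> g)"
    if i: "i \<in> I" for i
  proof -
    have zi: "fst (z i) \<in> ball x r" "snd (z i) = y" using i by (auto simp: I_def mem_Times_iff)
    obtain x' where x': "x' \<in> closed_segment (fst (z i)) (T i)"
      "\<xi> \<bullet> logistic_h (T i) y b - \<xi> \<bullet> logistic_h (fst (z i)) y b = hgrad b y \<xi> x' \<bullet> (T i - fst (z i))"
      using logistic_h_mean_value by blast
    have "dist (fst (z i)) x' \<le> norm (t *\<^sub>R w)"
      using dist_in_closed_segment[OF x'(1)] i by (simp add: T_def dist_norm norm_minus_commute)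
    then have "dist x x' < 2 * r"
      using dist_triangle[of x x' "fst (z i)"] zi(1) step by simp
    then have "\<xi> \<bullet> g < c * (hgrad b y \<xi> x' \<bullet> w)" by (intro asc) simp
    then have "sqrt (real n) / real (card I) * (\<xi> \<bullet> g) < sqrt (real n) / real (card I) * (c * (hgrad b y \<xi> x' \<bullet> w))"
      using m n by (intro mult_strict_left_mono) auto
    also have "\<dots> = t * (hgrad b y \<xi> x' \<bullet> w)" by (simp add: t_def)
    also have "\<dots> = - (\<xi> \<bullet> score b (T i, snd (z i)) - \<xi> \<bullet> score b (z i))"
      using x'(2) i zi(2) by (simp add: T_def)
    finally show "\<xi> \<bullet> score b (T i, snd (z i)) - \<xi> \<bullet> score b (z i) < - (sqrt (real n) / real (card I)) * (\<xi> \<bullet> g)"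
      by simp
  qed
  have "\<xi> \<bullet> (\<Sum>i<n. score b (T i, snd (z i))) - \<xi> \<bullet> (\<Sum>i<n. score b (z i))
      = (\<Sum>i<n. if i \<in> I then \<xi> \<bullet> score b (T i, snd (z i)) - \<xi> \<bullet> score b (z i) else 0)"
    unfolding inner_sum_right sum_subtractf[symmetric] by (intro sum.cong) (auto simp: T_def)
  also have "\<dots> = (\<Sum>i\<in>I. \<xi> \<bullet> score b (T i, snd (z i)) - \<xi> \<bullet> score b (z i))"
    using I(1) by (simp add: sum.If_cases Int_absorb1)
  also have "\<dots> < (\<Sum>i\<in>I. - (sqrt (real n) / real (card I)) * (\<xi> \<bullet> g))"
    using I m strict by (intro sum_strict_mono) auto
  also have "\<dots> = - (sqrt (real n) * (\<xi> \<bullet> g))" using m by simp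
  also have "\<dots> = - (\<xi> \<bullet> (\<Sum>i<n. score b (z i)))" using n by (simp add: g)
  finally have "\<xi> \<bullet> (\<Sum>i<n. score b (T i, snd (z i))) < 0" by simp
  then show "\<exists>T. (\<Sum>i<n. lq_norm q (T i - fst (z i))) \<le> real n * (c / sqrt (real n))
        \<and> \<xi> \<bullet> (\<Sum>i<n. score b (T i, snd (z i))) < 0"
    using cost by blast
qed


section \<open>Asymptotics of the sample\<close>

text \<open>The exponential is 1-Lipschitz in the phase and has modulus 1, so closeness in
  probability transfers to characteristic functions.\<close>

lemma (in prob_space) iexp_tendsto_of_tendsto_prob:
  fixes U V :: "nat \<Rightarrow> 'a \<Rightarrow> real"
  assumes [measurable]: "\<And>n. U n \<in> borel_measurable M" "\<And>n. V n \<in> borel_measurable M"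
    and close: "\<And>e. 0 < e \<Longrightarrow> (\<lambda>n. prob {w \<in> space M. e < \<bar>U n w - V n w\<bar>}) \<longlonglongrightarrow> 0"
    and V: "(\<lambda>n. \<integral>w. iexp (t * V n w) \<partial>M) \<longlonglongrightarrow> l"
  shows "(\<lambda>n. \<integral>w. iexp (t * U n w) \<partial>M) \<longlonglongrightarrow> l"
proof -
  have int: "integrable M (\<lambda>w. iexp (t * W w))" if [measurable]: "W \<in> borel_measurable M" for W
    by (rule integrable_const_bound[where B = 1]) auto
  have "(\<lambda>n. (\<integral>w. iexp (t * U n w) \<partial>M) - (\<integral>w. iexp (t * V n w) \<partial>M)) \<longlonglongrightarrow> 0"
  proof (rule LIMSEQ_I)
    fix r :: real assume "0 < r"
    \<comment> \<open>The close event contributes at most r / 2, and its complement at most 2 times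
      a probability below r / 4; the added 1 covers t = 0.\<close>
    define e where "e = r / (2 * (\<bar>t\<bar> + 1))"
    have e: "0 < e" "\<bar>t\<bar> * e \<le> r / 2" using \<open>0 < r\<close> by (auto simp: e_def field_simps)
    have "\<forall>\<^sub>F n in sequentially. prob {w \<in> space M. e < \<bar>U n w - V n w\<bar>} < r / 4"
      using close[OF e(1)] \<open>0 < r\<close> by (intro order_tendstoD) auto
    then obtain n0 where n0: "\<And>n. n \<ge> n0 \<Longrightarrow> prob {w \<in> space M. e < \<bar>U n w - V n w\<bar>} < r / 4"
      by (auto simp: eventually_sequentially)
    show "\<exists>n0. \<forall>n\<ge>n0. norm ((\<integral>w. iexp (t * U n w) \<partial>M) - (\<integral>w. iexp (t * V n w) \<partial>M) - 0) < r"
    proof (intro exI allI impI)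
      fix n assume "n \<ge> n0"
      let ?E = "{w \<in> space M. e < \<bar>U n w - V n w\<bar>}"
      have pointwise: "norm (iexp (t * U n w) - iexp (t * V n w)) \<le> \<bar>t\<bar> * e + 2 * indicator ?E w"
        if "w \<in> space M" for w
      proof (cases "w \<in> ?E")
        case True
        have "norm (iexp (t * U n w) - iexp (t * V n w)) \<le> norm (iexp (t * U n w)) + norm (iexp (t * V n w))"
          by (rule norm_triangle_ineq4)
        also have "\<dots> = 2" by (simp only: norm_exp_i_times)
        finally have "norm (iexp (t * U n w) - iexp (t * V n w)) \<le> 2" .
        moreover have "0 \<le> \<bar>t\<bar> * e" using e by simp
        ultimately show ?thesis using True by (simp only: indicator_simps)
      next
        case False
        have "norm (iexp (t * U n w) - iexp (t * V n w)) \<le> \<bar>t * U n w - t * V n w\<bar>"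
        proof -
          have "iexp (t * U n w) - iexp (t * V n w) = iexp (t * V n w) * (iexp (t * U n w - t * V n w) - 1)"
            by (simp add: right_diff_distrib exp_diff)
          also have "norm \<dots> = norm (iexp (t * U n w - t * V n w) - 1)"
            by (simp only: norm_mult norm_exp_i_times mult_1)
          also have "\<dots> \<le> \<bar>t * U n w - t * V n w\<bar>"
            using iexp_approx1[of "t * U n w - t * V n w" 0] by simp
          finally show ?thesis .
        qed
        also have "\<dots> = \<bar>t\<bar> * \<bar>U n w - V n w\<bar>" by (simp only: right_diff_distrib[symmetric] abs_mult)
        also have "\<dots> \<le> \<bar>t\<bar> * e" using False that by (intro mult_left_mono) auto
        finally show ?thesis using False by simp
      qed
      have intE: "integrable M (\<lambda>w. indicator ?E w :: real)" by (simp add: emeasure_eq_measure)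
      have "norm ((\<integral>w. iexp (t * U n w) \<partial>M) - (\<integral>w. iexp (t * V n w) \<partial>M))
          = norm (\<integral>w. iexp (t * U n w) - iexp (t * V n w) \<partial>M)"
        using int[of "U n"] int[of "V n"] by simp
      also have "\<dots> \<le> (\<integral>w. norm (iexp (t * U n w) - iexp (t * V n w)) \<partial>M)"
        by (rule integral_norm_bound)
      also have "\<dots> \<le> (\<integral>w. \<bar>t\<bar> * e + 2 * indicator ?E w \<partial>M)"
        using int[of "U n"] int[of "V n"] intE by (intro integral_mono pointwise) auto
      also have "\<dots> = \<bar>t\<bar> * e + 2 * prob ?E" using intE by (simp add: prob_space)
      also have "\<dots> < r" using e(2) n0[OF \<open>n \<ge> n0\<close>] by linarith
      finally show "norm ((\<integral>w. iexp (t * U n w) \<partial>M) - (\<integral>w. iexp (t * V n w) \<partial>M) - 0) < r" by simp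
    qed
  qed
  from tendsto_add[OF this V] show ?thesis by simp
qed

lemma weak_conv_of_iexp_tendsto:
  assumes "prob_space M" "prob_space N"
    and [measurable]: "\<And>n. U n \<in> borel_measurable M" "V \<in> borel_measurable N"
    and conv: "\<And>t. (\<lambda>n. \<integral>w. iexp (t * U n w) \<partial>M) \<longlonglongrightarrow> (\<integral>w. iexp (t * V w) \<partial>N)"
  shows "weak_conv_m (\<lambda>n. distr M borel (U n)) (distr N borel V)"
proof (rule levy_continuity)
  show "(\<lambda>n. char (distr M borel (U n)) t) \<longlonglongrightarrow> char (distr N borel V) t" for t
    unfolding char_def using conv[of t] by (simp add: integral_distr)
qed (use assms in \<open>auto intro: prob_space.real_distribution_distr\<close>)

lemma card_eq_sum_indicator:
  fixes n :: nat
  shows "real (card {i\<in>{..<n}. g i \<in> B}) = (\<Sum>i<n. indicator B (g i))"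
proof -
  have "real (card {i\<in>{..<n}. g i \<in> B}) = (\<Sum>i\<in>{i\<in>{..<n}. g i \<in> B}. 1)" by simp
  also have "\<dots> = (\<Sum>i<n. indicator B (g i))"
    unfolding sum.inter_filter[OF finite_lessThan] by (intro sum.cong) (auto simp: indicator_def)
  finally show ?thesis .
qed

section \<open>The normalised score and the profile function of a sample\<close>

locale logistic_sample = logistic_design D b f + M: prob_space M
  for D :: "((real ^ 'd) \<times> real) measure" and b f and M :: "'w measure" +
  fixes X :: "nat \<Rightarrow> 'w \<Rightarrow> real ^ 'd" and Y :: "nat \<Rightarrow> 'w \<Rightarrow> real" and p q :: ennreal
  assumes labels: "\<And>i \<omega>. \<omega> \<in> space M \<Longrightarrow> Y i \<omega> \<in> {-1, 1}"
    and sample_indep: "M.indep_vars (\<lambda>_. borel) (\<lambda>i \<omega>. (X i \<omega>, Y i \<omega>)) UNIV"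
    and sample_law: "\<And>i. distr M borel (\<lambda>\<omega>. (X i \<omega>, Y i \<omega>)) = D"
    and q: "1 < q" and conj: "1 / p + 1 / q = 1"
begin

definition score_sum :: "nat \<Rightarrow> 'w \<Rightarrow> real ^ 'd" where
  "score_sum n \<omega> = (1 / sqrt (real n)) *\<^sub>R (\<Sum>i<n. score b (X i \<omega>, Y i \<omega>))"

definition scaled_profile :: "nat \<Rightarrow> 'w \<Rightarrow> real" where
  "scaled_profile n \<omega> = sqrt (real n) * enn2real (profile q b (empirical n (\<lambda>i. (X i \<omega>, Y i \<omega>))))"

abbreviation \<sigma> :: "real ^ 'd \<Rightarrow> real" where
  "\<sigma> \<equiv> support_fun (slope_set p b)"

lemma p_ge_1: "1 \<le> p"
  by (rule conj_exponent_ge_1[OF q conj])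

lemma support_fun_slope_set_lipschitz: "(2 * real CARD('d))-lipschitz_on UNIV \<sigma>"
  using support_fun_lipschitz[OF slope_set_subset_cball[OF p_ge_1], of b] zero_in_slope_set[OF p_ge_1, of b] by blast

lemma continuous_on_support_fun_slope_set: "continuous_on UNIV \<sigma>"
  by (rule lipschitz_on_continuous_on[OF support_fun_slope_set_lipschitz])

lemma support_fun_slope_set_nonneg: "0 \<le> \<sigma> v"
  by (rule support_fun_nonneg[OF slope_set_subset_cball[OF p_ge_1] zero_in_slope_set[OF p_ge_1]])

lemma support_fun_slope_set_0: "\<sigma> 0 = 0"
  using zero_in_slope_set[OF p_ge_1, of b] by (auto simp: support_fun_def intro!: cSUP_const)

lemma support_fun_slope_set_le: "\<sigma> v \<le> 2 * real CARD('d) * norm v"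
  using lipschitz_onD[OF support_fun_slope_set_lipschitz, of v 0] support_fun_slope_set_nonneg[of v]
  by (simp add: support_fun_slope_set_0 dist_real_def)

lemma measurable_obs [measurable]: "(\<lambda>\<omega>. (X i \<omega>, Y i \<omega>)) \<in> borel_measurable M"
  using sample_indep by (simp add: M.indep_vars_def2)

lemma measurable_XY [measurable]: "X i \<in> borel_measurable M" "Y i \<in> borel_measurable M"
  using measurable_compose[OF measurable_obs[of i], of fst borel] measurable_compose[OF measurable_obs[of i], of snd borel]
  by (simp_all add: borel_measurable_continuous_onI continuous_on_fst continuous_on_snd continuous_on_id)

lemma measurable_score_sum [measurable]: "score_sum n \<in> borel_measurable M"
proof -
  have [measurable]: "(\<lambda>\<omega>. score b (X i \<omega>, Y i \<omega>)) \<in> borel_measurable M" for i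
    by (rule measurable_compose[OF measurable_obs measurable_score])
  show ?thesis unfolding score_sum_def[abs_def] by measurable
qed

lemma measurable_scaled_profile [measurable]: "scaled_profile n \<in> borel_measurable M"
  unfolding scaled_profile_def[abs_def]
  using measurable_profile[where M = M and X = X and Y = Y, OF q conj measurable_XY labels] by measurable

lemma obs_integral:
  fixes g :: "_ \<Rightarrow> real"
  assumes [measurable]: "g \<in> borel_measurable borel"
  shows "(\<integral>\<omega>. g (X i \<omega>, Y i \<omega>) \<partial>M) = (\<integral>z. g z \<partial>D)"
    and "integrable M (\<lambda>\<omega>. g (X i \<omega>, Y i \<omega>)) \<longleftrightarrow> integrable D g"
  unfolding sample_law[of i, symmetric] by (simp_all add: integral_distr integrable_distr_eq)

lemma indep_obs:
  assumes "g \<in> borel_measurable borel"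
  shows "M.indep_vars (\<lambda>_. borel) (\<lambda>i \<omega>. g (X i \<omega>, Y i \<omega>)) UNIV"
  by (rule M.indep_vars_compose2[OF sample_indep]) (rule assms)

lemma distr_obs:
  assumes "g \<in> borel_measurable borel"
  shows "distr M borel (\<lambda>\<omega>. g (X i \<omega>, Y i \<omega>)) = distr D borel g"
  unfolding sample_law[of i, symmetric] by (subst distr_distr) (simp_all add: assms o_def)

lemma score_projection:
  fixes u :: "real ^ 'd"
  defines "a \<equiv> \<lambda>i \<omega>. u \<bullet> score b (X i \<omega>, Y i \<omega>)" and "v \<equiv> \<integral>z. (u \<bullet> score b z)\<^sup>2 \<partial>D"
  shows "M.indep_vars (\<lambda>_. borel) a UNIV" "M.expectation (a i) = 0"
    "integrable M (\<lambda>\<omega>. (a i \<omega>)\<^sup>2)" "M.expectation (\<lambda>\<omega>. (a i \<omega>)\<^sup>2) = v"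
    "distr M borel (a i) = distr D borel (\<lambda>z. u \<bullet> score b z)"
proof -
  have [measurable]: "(\<lambda>z. u \<bullet> score b z) \<in> borel_measurable borel" by measurable
  then have [measurable]: "(\<lambda>z. (u \<bullet> score b z)\<^sup>2) \<in> borel_measurable borel" by measurable
  show "M.indep_vars (\<lambda>_. borel) a UNIV"
    unfolding a_def by (rule indep_obs[of "\<lambda>z. u \<bullet> score b z"]) measurable
  show "M.expectation (a i) = 0"
    unfolding a_def using obs_integral(1)[of "\<lambda>z. u \<bullet> score b z" i] expectation_score[of u] by simp
  show "integrable M (\<lambda>\<omega>. (a i \<omega>)\<^sup>2)"
    unfolding a_def using obs_integral(2)[of "\<lambda>z. (u \<bullet> score b z)\<^sup>2" i] integrable_score_sq[of u] by simp
  show "M.expectation (\<lambda>\<omega>. (a i \<omega>)\<^sup>2) = v"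
    unfolding a_def v_def using obs_integral(1)[of "\<lambda>z. (u \<bullet> score b z)\<^sup>2" i] by simp
  show "distr M borel (a i) = distr D borel (\<lambda>z. u \<bullet> score b z)"
    unfolding a_def by (rule distr_obs[of "\<lambda>z. u \<bullet> score b z"]) measurable
qed

lemma inner_score_sum: "u \<bullet> score_sum n \<omega> = (\<Sum>i<n. u \<bullet> score b (X i \<omega>, Y i \<omega>)) / sqrt (real n)"
  by (simp add: score_sum_def inner_sum_right)

lemma iexp_score_sum_tendsto:
  "(\<lambda>n. \<integral>\<omega>. iexp (u \<bullet> score_sum n \<omega>) \<partial>M) \<longlonglongrightarrow> of_real (exp (- (\<integral>z. (u \<bullet> score b z)\<^sup>2 \<partial>D) / 2))"
  unfolding inner_score_sum by (rule M.iexp_indep_sum_tendsto[OF score_projection])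

lemma score_sum_tail:
  assumes "0 < R"
  shows "measure M {\<omega> \<in> space M. R < norm (score_sum n \<omega>)}
    \<le> (\<Sum>i\<in>UNIV. \<integral>z. (axis i 1 \<bullet> score b z)\<^sup>2 \<partial>D) / R\<^sup>2"
proof -
  \<comment> \<open>For n = 0 the normalised sum is 0 by the convention on division, hence an
    inequality between the second moments.\<close>
  have comp: "integrable M (\<lambda>\<omega>. (u \<bullet> score_sum n \<omega>)\<^sup>2)
      \<and> M.expectation (\<lambda>\<omega>. (u \<bullet> score_sum n \<omega>)\<^sup>2) \<le> (\<integral>z. (u \<bullet> score b z)\<^sup>2 \<partial>D)" for u
    using M.second_moment_indep_sum[OF score_projection(1-4), of u n]
    unfolding inner_score_sum power_divide
    by (cases "n = 0") auto
  have sq: "(norm x)\<^sup>2 = (\<Sum>i\<in>UNIV. (axis i 1 \<bullet> x)\<^sup>2)" for x :: "real ^ 'd"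
    by (simp add: norm_vec_def L2_set_def sum_nonneg inner_axis')
  have int: "integrable M (\<lambda>\<omega>. (norm (score_sum n \<omega>))\<^sup>2)"
    unfolding sq using comp by (intro Bochner_Integration.integrable_sum) blast
  have "measure M {\<omega> \<in> space M. R < norm (score_sum n \<omega>)} \<le> measure M {\<omega> \<in> space M. R\<^sup>2 \<le> (norm (score_sum n \<omega>))\<^sup>2}"
    using assms by (intro M.finite_measure_mono) (auto intro: power_mono)
  also have "\<dots> \<le> M.expectation (\<lambda>\<omega>. (norm (score_sum n \<omega>))\<^sup>2) / R\<^sup>2"
    using assms by (intro integral_Markov_inequality_measure[OF int, of "{}"]) auto
  also have "M.expectation (\<lambda>\<omega>. (norm (score_sum n \<omega>))\<^sup>2) \<le> (\<Sum>i\<in>UNIV. \<integral>z. (axis i 1 \<bullet> score b z)\<^sup>2 \<partial>D)"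
    unfolding sq using comp by (subst Bochner_Integration.integral_sum) (auto intro: sum_mono)
  finally show ?thesis by (simp add: divide_right_mono)
qed

lemma score_sum_tight:
  assumes "0 < e"
  shows "\<exists>R>0. \<forall>n. measure M {\<omega> \<in> space M. R < norm (score_sum n \<omega>)} \<le> e"
proof -
  define \<kappa> where "\<kappa> = (\<Sum>i\<in>UNIV. \<integral>z. (axis i 1 \<bullet> score b z)\<^sup>2 \<partial>D)"
  have \<kappa>: "0 \<le> \<kappa>" unfolding \<kappa>_def by (intro sum_nonneg) simp
  \<comment> \<open>This is Markov's bound solved for R; the added 1 keeps R positive when \<kappa>
    = 0.\<close>
  define R where "R = sqrt (\<kappa> / e + 1)"
  have R: "0 < R" using \<kappa> assms by (simp add: R_def add_nonneg_pos)
  have "\<kappa> / R\<^sup>2 \<le> e" using \<kappa> assms by (simp add: R_def field_simps add_nonneg_pos)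
  then show ?thesis using score_sum_tail[OF R] R unfolding \<kappa>_def by (meson order_trans)
qed

text \<open>The count falls short of its mean by half of that mean. Hoeffding's inequality with this
  deviation gives the exponent -n m^2 / 2, where m is the mass of B.\<close>

lemma few_observations:
  assumes B[measurable]: "B \<in> sets borel" and pos: "0 < measure D B"
  shows "(\<lambda>n. measure M {\<omega> \<in> space M. real (card {i\<in>{..<n}. (X i \<omega>, Y i \<omega>) \<in> B}) \<le> real n * (measure D B / 2)}) \<longlonglongrightarrow> 0"
proof (rule tendsto_sandwich[where f = "\<lambda>_. 0" and h = "\<lambda>n. exp (- real n * ((measure D B)\<^sup>2 / 2))"])
  let ?I = "\<lambda>i \<omega>. indicator B (X i \<omega>, Y i \<omega>) :: real"
  have mean: "M.expectation (?I i) = measure D B" for i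
    using obs_integral(1)[of "indicator B" i] by simp
  have le: "measure M {\<omega> \<in> space M. real (card {i\<in>{..<n}. (X i \<omega>, Y i \<omega>) \<in> B}) \<le> real n * (measure D B / 2)}
      \<le> exp (- real n * ((measure D B)\<^sup>2 / 2))" if n: "0 < n" for n
  proof -
    interpret H: Hoeffding_ineq M "{..<n}" ?I "\<lambda>_. 0" "\<lambda>_. 1" "\<Sum>i<n. M.expectation (?I i)"
    proof (unfold_locales)
      have [measurable]: "(indicator B :: _ \<Rightarrow> real) \<in> borel_measurable borel" by simp
      show "M.indep_vars (\<lambda>_. borel) ?I {..<n}"
        by (rule M.indep_vars_subset[OF indep_obs]) simp_all
    qed (auto simp: indicator_def)
    have "M.prob {\<omega> \<in> space M. (\<Sum>i<n. ?I i \<omega>) \<le> (\<Sum>i<n. M.expectation (?I i)) - real n * (measure D B / 2)}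
        \<le> exp (- 2 * (real n * (measure D B / 2))\<^sup>2 / (\<Sum>i<n. (1 - 0)\<^sup>2))"
      using n by (intro H.Hoeffding_ineq_le) auto
    also have "- 2 * (real n * (measure D B / 2))\<^sup>2 / (\<Sum>i<n. (1 - 0)\<^sup>2) = - real n * ((measure D B)\<^sup>2 / 2)"
      using n by (simp add: power2_eq_square)
    also have "(\<Sum>i<n. M.expectation (?I i)) - real n * (measure D B / 2) = real n * (measure D B / 2)"
      by (simp add: mean)
    also have "(\<lambda>\<omega>. \<Sum>i<n. ?I i \<omega>) = (\<lambda>\<omega>. real (card {i\<in>{..<n}. (X i \<omega>, Y i \<omega>) \<in> B}))"
      by (simp only: card_eq_sum_indicator)
    finally show ?thesis .
  qed
  then show "\<forall>\<^sub>F n in sequentially. measure M {\<omega> \<in> space M. real (card {i\<in>{..<n}. (X i \<omega>, Y i \<omega>) \<in> B}) \<le> real n * (measure D B / 2)}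
      \<le> exp (- real n * ((measure D B)\<^sup>2 / 2))"
    using eventually_gt_at_top[of 0] by (rule eventually_mono[rotated]) 
  show "(\<lambda>n. exp (- real n * ((measure D B)\<^sup>2 / 2))) \<longlonglongrightarrow> 0"
    using pos by real_asymp
qed auto

text \<open>This bound holds pathwise and for every n, both sides being 0 at n = 0, so probability
  enters only through the upper bound.\<close>

lemma support_fun_le_scaled_profile:
  assumes "\<omega> \<in> space M"
  shows "\<sigma> (score_sum n \<omega>) \<le> scaled_profile n \<omega>"
proof (cases "n = 0")
  case True
  then show ?thesis by (simp add: score_sum_def scaled_profile_def support_fun_slope_set_0)
next
  case False
  let ?P = "profile q b (empirical n (\<lambda>i. (X i \<omega>, Y i \<omega>)))"
  have fin: "?P < \<infinity>" using False q by (intro profile_empirical_finite) auto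
  have "\<xi> \<bullet> score_sum n \<omega> \<le> scaled_profile n \<omega>" if \<xi>: "\<xi> \<in> slope_set p b" for \<xi>
  proof -
    have "ennreal (\<xi> \<bullet> ((1 / real n) *\<^sub>R (\<Sum>i<n. score b (X i \<omega>, Y i \<omega>)))) \<le> ?P"
      using labels[OF assms] by (intro profile_ge[OF q conj \<xi>]) auto
    then have "\<xi> \<bullet> ((1 / real n) *\<^sub>R (\<Sum>i<n. score b (X i \<omega>, Y i \<omega>))) \<le> enn2real ?P"
      using fin by (cases ?P) (auto simp: ennreal_le_iff2 intro: order_trans[OF _ enn2real_nonneg])
    then have "sqrt (real n) * (\<xi> \<bullet> ((1 / real n) *\<^sub>R (\<Sum>i<n. score b (X i \<omega>, Y i \<omega>)))) \<le> scaled_profile n \<omega>"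
      unfolding scaled_profile_def by (intro mult_left_mono) auto
    moreover have "sqrt (real n) * (1 / real n) = 1 / sqrt (real n)"
      using sqrt_divide_self_eq[of "real n"] by (simp add: inverse_eq_divide)
    ultimately show ?thesis
      by (simp only: score_sum_def inner_scaleR_right mult.assoc[symmetric])
  qed
  then show ?thesis
    unfolding support_fun_def[of _ "score_sum n \<omega>"]
    using zero_in_slope_set[OF p_ge_1, of b] by (intro cSUP_least) auto
qed

text \<open>The upper bound can fail only if the normalised score leaves the ball of radius R or one
  of finitely many cells receives fewer observations than half of its expected share. Tightness
  makes the former rare, and the count estimate the latter.\<close>

lemma scaled_profile_close:
  assumes \<epsilon>: "0 < \<epsilon>"
  shows "(\<lambda>n. measure M {\<omega> \<in> space M. \<epsilon> < \<bar>scaled_profile n \<omega> - \<sigma> (score_sum n \<omega>)\<bar>}) \<longlonglongrightarrow> 0"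
proof (rule LIMSEQ_I)
  fix e :: real assume "0 < e"
  then obtain R where R: "0 < R" "\<And>n. measure M {\<omega> \<in> space M. R < norm (score_sum n \<omega>)} \<le> e / 2"
    using score_sum_tight[of "e / 2"] by auto
  obtain K where K: "finite K" "\<And>x y w r. (x, y, w, r) \<in> K \<Longrightarrow> y \<in> {-1, 1} \<and> lq_norm q w \<le> 1 \<and> 0 < r"
    and asc: "\<And>\<xi> v. norm \<xi> = 1 \<Longrightarrow> norm v \<le> R \<Longrightarrow> \<exists>(x, y, w, r)\<in>K. \<forall>x'\<in>ball x (2 * r).
         \<xi> \<bullet> v < (\<sigma> v + \<epsilon>) * (hgrad b y \<xi> x' \<bullet> w)"
    using finite_ascent_family[OF q conj \<epsilon>, of R b] by fast
  define B where "B k = (case k of (x, y, w, r) \<Rightarrow> ball x r \<times> {y})" for k :: "(real ^ 'd) \<times> real \<times> (real ^ 'd) \<times> real"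
  define \<pi> where "\<pi> k = measure D (B k)" for k
  have Bm[measurable]: "B k \<in> sets borel" for k
    unfolding B_def borel_prod[symmetric] by (auto split: prod.split)
  have \<pi>: "0 < \<pi> k" if "k \<in> K" for k
  proof -
    obtain x y w r where k: "k = (x, y, w, r)" by (cases k)
    then have "emeasure D (B k) \<noteq> 0"
      using K(2)[of x y w r] that support_D[of "ball x r" y] by (auto simp: B_def)
    then show ?thesis by (simp add: \<pi>_def emeasure_eq_measure zero_less_measure_iff)
  qed
  define few where "few n k = {\<omega> \<in> space M. real (card {i\<in>{..<n}. (X i \<omega>, Y i \<omega>) \<in> B k}) \<le> real n * (\<pi> k / 2)}" for n k
  have few_m[measurable]: "few n k \<in> sets M" for n k
  proof -
    have "few n k = {\<omega> \<in> space M. (\<Sum>i<n. indicator (B k) (X i \<omega>, Y i \<omega>) :: real) \<le> real n * (\<pi> k / 2)}"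
      unfolding few_def card_eq_sum_indicator ..
    also have "\<dots> \<in> sets M" by measurable
    finally show ?thesis .
  qed
  have "(\<lambda>n. \<Sum>k\<in>K. measure M (few n k)) \<longlonglongrightarrow> (\<Sum>k\<in>K. 0)"
    unfolding few_def \<pi>_def using \<pi> by (intro tendsto_sum few_observations Bm) (auto simp: \<pi>_def)
  then have ev1: "\<forall>\<^sub>F n in sequentially. (\<Sum>k\<in>K. measure M (few n k)) < e / 2"
    using \<open>0 < e\<close> by (intro order_tendstoD) auto
  \<comment> \<open>On the ball of radius R the cost constant is at most \<open>C\<close>. A cell of
    mass \<pi> with more than n \<pi> / 2 observations then needs steps of length below 2 C / (\<pi>
    sqrt n), up to the dimension factor, which is eventually smaller than its radius.\<close>
  define C where "C = 2 * real CARD('d) * R + \<epsilon>"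
  have "\<forall>\<^sub>F n in sequentially. real CARD('d) * (2 * C / \<pi> (x, y, w, r)) / sqrt (real n) < r"
    if "(x, y, w, r) \<in> K" for x y w r
  proof -
    have "(\<lambda>n. real CARD('d) * (2 * C / \<pi> (x, y, w, r)) / sqrt (real n)) \<longlonglongrightarrow> 0" by real_asymp
    then show ?thesis using K(2)[OF that] by (intro order_tendstoD) auto
  qed
  then have ev2: "\<forall>\<^sub>F n in sequentially. \<forall>(x, y, w, r)\<in>K. real CARD('d) * (2 * C / \<pi> (x, y, w, r)) / sqrt (real n) < r"
    using K(1) by (subst eventually_ball_finite_distrib) auto
  have "\<forall>\<^sub>F n in sequentially. measure M {\<omega> \<in> space M. \<epsilon> < \<bar>scaled_profile n \<omega> - \<sigma> (score_sum n \<omega>)\<bar>} < e"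
    using ev1 ev2 eventually_gt_at_top[of 0]
  proof eventually_elim
    case (elim n)
    have "scaled_profile n \<omega> \<le> \<sigma> (score_sum n \<omega>) + \<epsilon>"
      if \<omega>: "\<omega> \<in> space M" and small: "norm (score_sum n \<omega>) \<le> R" and many: "\<And>k. k \<in> K \<Longrightarrow> \<omega> \<notin> few n k" for \<omega>
    proof -
      define c where "c = \<sigma> (score_sum n \<omega>) + \<epsilon>"
      have c0: "0 \<le> c" using support_fun_slope_set_nonneg \<epsilon> by (simp add: c_def add_nonneg_nonneg less_imp_le)
      have cC: "c \<le> C"
      proof -
        have "2 * real CARD('d) * norm (score_sum n \<omega>) \<le> 2 * real CARD('d) * R"
          using small by (intro mult_left_mono) auto
        then show ?thesis
          using support_fun_slope_set_le[of "score_sum n \<omega>"] unfolding c_def C_def by linarith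
      qed
      have "profile q b (empirical n (\<lambda>i. (X i \<omega>, Y i \<omega>))) \<le> ennreal (c / sqrt (real n))"
      proof (rule profile_le_support_fun[OF q conj elim(3) score_sum_def c0])
        show "\<exists>(x, y, w, r)\<in>K. \<forall>x'\<in>ball x (2 * r). \<xi> \<bullet> score_sum n \<omega> < c * (hgrad b y \<xi> x' \<bullet> w)"
          if "norm \<xi> = 1" for \<xi>
          unfolding c_def by (rule asc[OF that small])
        fix x y w r assume k: "(x, y, w, r) \<in> K"
        then show "lq_norm q w \<le> 1 \<and> 0 < r" using K(2) by blast
        define m where "m = real (card {i\<in>{..<n}. (X i \<omega>, Y i \<omega>) \<in> ball x r \<times> {y}})"
        have m: "real n * (\<pi> (x, y, w, r) / 2) < m"
          using many[OF k] \<omega> by (simp add: few_def B_def m_def not_le)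
        have lower: "0 < real n * (\<pi> (x, y, w, r) / 2)" using \<pi>[OF k] elim(3) by simp
        have "real CARD('d) * (sqrt (real n) * c / m) \<le> real CARD('d) * (sqrt (real n) * C / (real n * (\<pi> (x, y, w, r) / 2)))"
          using m lower c0 cC by (intro mult_left_mono frac_le) auto
        also have "sqrt (real n) * C / (real n * (\<pi> (x, y, w, r) / 2)) = (2 * C / \<pi> (x, y, w, r)) / sqrt (real n)"
          using elim(3) \<pi>[OF k] by (simp add: field_simps)
        also have "real CARD('d) * \<dots> < r" using elim(2) k by auto
        finally have "real CARD('d) * (sqrt (real n) * c / m) < r" .
        moreover have "0 < m" using m lower by linarith
        ultimately show "0 < card {i\<in>{..<n}. (X i \<omega>, Y i \<omega>) \<in> ball x r \<times> {y}}
            \<and> real CARD('d) * (sqrt (real n) * c / real (card {i\<in>{..<n}. (X i \<omega>, Y i \<omega>) \<in> ball x r \<times> {y}})) < r"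
          unfolding m_def by linarith
      qed
      then have "enn2real (profile q b (empirical n (\<lambda>i. (X i \<omega>, Y i \<omega>)))) \<le> c / sqrt (real n)"
        using c0 by (intro enn2real_leI) auto
      then have "scaled_profile n \<omega> \<le> sqrt (real n) * (c / sqrt (real n))"
        unfolding scaled_profile_def by (intro mult_left_mono) auto
      then show ?thesis using elim(3) by (simp add: c_def)
    qed
    then have "{\<omega> \<in> space M. \<epsilon> < \<bar>scaled_profile n \<omega> - \<sigma> (score_sum n \<omega>)\<bar>}
        \<subseteq> {\<omega> \<in> space M. R < norm (score_sum n \<omega>)} \<union> (\<Union>k\<in>K. few n k)"
      using support_fun_le_scaled_profile[of _ n] by (force simp: abs_le_iff not_le[symmetric])
    moreover have few_sets: "(\<Union>k\<in>K. few n k) \<in> sets M"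
      by (intro sets.finite_UN K(1) few_m)
    moreover have large_sets: "{\<omega> \<in> space M. R < norm (score_sum n \<omega>)} \<in> sets M" by measurable
    ultimately have "measure M {\<omega> \<in> space M. \<epsilon> < \<bar>scaled_profile n \<omega> - \<sigma> (score_sum n \<omega>)\<bar>}
        \<le> measure M ({\<omega> \<in> space M. R < norm (score_sum n \<omega>)} \<union> (\<Union>k\<in>K. few n k))"
      by (intro M.finite_measure_mono sets.Un)
    also have "\<dots> \<le> measure M {\<omega> \<in> space M. R < norm (score_sum n \<omega>)} + measure M (\<Union>k\<in>K. few n k)"
      by (rule measure_Un_le[OF large_sets few_sets])
    also have "measure M (\<Union>k\<in>K. few n k) \<le> (\<Sum>k\<in>K. measure M (few n k))"
      by (rule measure_UNION_le[OF K(1) few_m])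
    finally show ?case using R(2)[of n] elim(1) by linarith
  qed
  then show "\<exists>n0. \<forall>n\<ge>n0. norm (measure M {\<omega> \<in> space M. \<epsilon> < \<bar>scaled_profile n \<omega> - \<sigma> (score_sum n \<omega>)\<bar>} - 0) < e"
    by (simp add: eventually_sequentially)
qed

theorem scaled_profile_converges:
  assumes Z: "centered_normal N Z (\<integral>(x, y). (1 / (1 + exp (y * (b \<bullet> x)))\<^sup>2) *\<^sub>R outer x x \<partial>D)"
  shows "weak_conv_m (\<lambda>n. distr M borel (scaled_profile n)) (distr N borel (\<lambda>w. \<sigma> (Z w)))"
proof (rule weak_conv_of_iexp_tendsto)
  show "prob_space M" by (rule M.prob_space_axioms)
  show N: "prob_space N" using Z by (simp add: centered_normal_def)
  have [measurable]: "Z \<in> borel_measurable N" using Z by (simp add: centered_normal_def)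
  have [measurable]: "\<sigma> \<in> borel_measurable borel"
    by (rule borel_measurable_continuous_onI[OF continuous_on_support_fun_slope_set])
  show "(\<lambda>w. \<sigma> (Z w)) \<in> borel_measurable N" by measurable
  have measurable_support_fun_score_sum: "(\<lambda>\<omega>. \<sigma> (score_sum n \<omega>)) \<in> borel_measurable M" for n
    by measurable
  fix t
  have "(\<lambda>n. \<integral>\<omega>. iexp (t * \<sigma> (score_sum n \<omega>)) \<partial>M) \<longlonglongrightarrow> (\<integral>w. iexp (t * \<sigma> (Z w)) \<partial>N)"
  proof (rule Cramer_Wold_iexp_tendsto[OF M.prob_space_axioms N, where g = "\<lambda>x. t * \<sigma> x"])
    show "(\<lambda>n. \<integral>\<omega>. iexp (u \<bullet> score_sum n \<omega>) \<partial>M) \<longlonglongrightarrow> (\<integral>w. iexp (u \<bullet> Z w) \<partial>N)" for u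
      using iexp_score_sum_tendsto[of u]
      unfolding centered_normal_iexp[OF Z] score_covariance_quadratic .
    show "\<exists>R. \<forall>n. measure M {\<omega> \<in> space M. R < norm (score_sum n \<omega>)} \<le> e" if "0 < e" for e
      using score_sum_tight[OF that] by blast
  qed (auto intro!: continuous_intros continuous_on_support_fun_slope_set)
  with scaled_profile_close
  show "(\<lambda>n. \<integral>\<omega>. iexp (t * scaled_profile n \<omega>) \<partial>M) \<longlonglongrightarrow> (\<integral>w. iexp (t * \<sigma> (Z w)) \<partial>N)"
    by (rule M.iexp_tendsto_of_tendsto_prob[OF measurable_scaled_profile measurable_support_fun_score_sum])
qed measurable

end


section \<open>Stochastic domination of the limit\<close>

lemma centered_normal_tail:
  assumes Z: "centered_normal N Z S" and v: "0 < u \<bullet> (S *v u)"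
  shows "measure N {w \<in> space N. a \<le> \<bar>u \<bullet> Z w\<bar>}
    = measure std_normal_distribution {x. a / sqrt (u \<bullet> (S *v u)) \<le> \<bar>x\<bar>}"
proof -
  interpret prob_space N using Z by (simp add: centered_normal_def)
  have [measurable]: "Z \<in> borel_measurable N" using Z by (simp add: centered_normal_def)
  define s where "s = sqrt (u \<bullet> (S *v u))"
  have s: "0 < s" using v by (simp add: s_def)
  have "distributed N lborel (\<lambda>w. u \<bullet> Z w) (\<lambda>t. ennreal (normal_density 0 s t))"
    using Z v unfolding centered_normal_def Let_def s_def by (metis less_irrefl)
  then have "distributed N lborel (\<lambda>w. (u \<bullet> Z w) / s) std_normal_density"
    using normal_standard_normal_convert[OF s, of "\<lambda>w. u \<bullet> Z w" 0] by simp
  then have d: "distr N lborel (\<lambda>w. (u \<bullet> Z w) / s) = std_normal_distribution"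
    by (simp add: distributed_def)
  have "measure N {w \<in> space N. a \<le> \<bar>u \<bullet> Z w\<bar>} = measure N ((\<lambda>w. (u \<bullet> Z w) / s) -` {x. a / s \<le> \<bar>x\<bar>} \<inter> space N)"
    using s by (intro arg_cong[where f = "measure N"]) (auto simp: divide_le_cancel)
  also have "\<dots> = measure (distr N lborel (\<lambda>w. (u \<bullet> Z w) / s)) {x. a / s \<le> \<bar>x\<bar>}"
    by (rule measure_distr[symmetric]) measurable
  finally show ?thesis unfolding d unfolding s_def .
qed

text \<open>A larger variance lowers the threshold after standardisation. A degenerate normal
  variable has no mass beyond \<open>a\<close>, since \<open>a\<close> is positive.\<close>

lemma centered_normal_tail_mono:
  assumes Z: "centered_normal N Z S" and Z': "centered_normal N' Z' S'"
    and le: "u \<bullet> (S *v u) \<le> u \<bullet> (S' *v u)" and a: "0 < a"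
  shows "measure N {w \<in> space N. a \<le> \<bar>u \<bullet> Z w\<bar>} \<le> measure N' {w \<in> space N'. a \<le> \<bar>u \<bullet> Z' w\<bar>}"
proof (cases "u \<bullet> (S *v u) = 0")
  case True
  interpret prob_space N using Z by (simp add: centered_normal_def)
  have [measurable]: "Z \<in> borel_measurable N" using Z by (simp add: centered_normal_def)
  have "AE w in N. u \<bullet> Z w = 0"
    using Z True unfolding centered_normal_def Let_def by metis
  then have "measure N {w \<in> space N. a \<le> \<bar>u \<bullet> Z w\<bar>} = 0"
    using a by (subst prob_eq_0) (auto elim!: eventually_mono)
  then show ?thesis by simp
next
  case False
  then have pos: "0 < u \<bullet> (S *v u)" using centered_normal_quadratic_nonneg[OF Z, of u] by simp
  then have pos': "0 < u \<bullet> (S' *v u)" using le by simp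
  interpret std: prob_space std_normal_distribution by (rule prob_space_normal_density) simp
  have "a / sqrt (u \<bullet> (S' *v u)) \<le> a / sqrt (u \<bullet> (S *v u))"
    using a pos le by (intro divide_left_mono) auto
  then have "{x. a / sqrt (u \<bullet> (S *v u)) \<le> \<bar>x\<bar>} \<subseteq> {x. a / sqrt (u \<bullet> (S' *v u)) \<le> \<bar>x\<bar>}" by auto
  then show ?thesis
    unfolding centered_normal_tail[OF Z pos] centered_normal_tail[OF Z' pos']
    by (intro std.finite_measure_mono) simp_all
qed

context logistic_design
begin

text \<open>The variable \<open>\<tau> * \<bar>b \<bullet> v\<bar>\<close> lies between the support
  function and the q-norm: from above because every slope is a multiple of \<open>b\<close>, from
  below because its p-norm is at most 1. The two normal laws are then compared in direction
  \<open>b\<close> alone.\<close>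

lemma support_fun_dominated_nonzero:
  assumes q: "1 < q" "1 / p + 1 / q = 1" and b: "b \<noteq> 0" and t: "0 < t"
    and Z: "centered_normal N Z (\<integral>(x, y). (1 / (1 + exp (y * (b \<bullet> x)))\<^sup>2) *\<^sub>R outer x x \<partial>D)"
    and Z': "centered_normal N' Z' (\<integral>(x, y). outer x x \<partial>D)"
  shows "measure N {w \<in> space N. t \<le> support_fun (slope_set p b) (Z w)}
    \<le> measure N' {w \<in> space N'. t \<le> lq_norm q (Z' w)}"
proof -
  have p: "1 \<le> p" by (rule conj_exponent_ge_1[OF q])
  have q1: "1 \<le> q" using q by simp
  interpret N: prob_space N using Z by (simp add: centered_normal_def)
  interpret N': prob_space N' using Z' by (simp add: centered_normal_def)
  have [measurable]: "Z \<in> borel_measurable N" "Z' \<in> borel_measurable N'"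
    using Z Z' by (auto simp: centered_normal_def)
  note q1[measurable]
  define C where "C = {c. c *\<^sub>R b \<in> slope_set p b}"
  define \<tau> where "\<tau> = (SUP c\<in>C. \<bar>c\<bar>)"
  have "0 \<in> C" using zero_in_slope_set[OF p] by (simp add: C_def)
  have "\<bar>c\<bar> \<le> 2 * real CARD('d) / norm b" if "c \<in> C" for c
    using slope_set_subset_cball[OF p, of b] that b by (auto simp: C_def field_simps)
  then have bdd: "bdd_above (abs ` C)" by (intro bdd_aboveI2)
  have \<tau>: "\<bar>c\<bar> \<le> \<tau>" if "c \<in> C" for c
    unfolding \<tau>_def by (rule cSUP_upper[OF that bdd])
  have \<tau>0: "0 \<le> \<tau>" using \<tau>[OF \<open>0 \<in> C\<close>] by simp
  have upper: "support_fun (slope_set p b) v \<le> \<tau> * \<bar>b \<bullet> v\<bar>" for v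
    unfolding support_fun_def
  proof (rule cSUP_least)
    show "slope_set p b \<noteq> {}" using zero_in_slope_set[OF p, of b] by auto
    fix \<xi> assume \<xi>: "\<xi> \<in> slope_set p b"
    then obtain c where c: "\<xi> = c *\<^sub>R b" by (rule slope_set_subset_line[OF p b])
    have "\<xi> \<bullet> v \<le> \<bar>c\<bar> * \<bar>b \<bullet> v\<bar>" by (simp add: c flip: abs_mult)
    also have "\<dots> \<le> \<tau> * \<bar>b \<bullet> v\<bar>" using \<tau>[of c] \<xi> by (intro mult_right_mono) (auto simp: C_def c)
    finally show "\<xi> \<bullet> v \<le> \<tau> * \<bar>b \<bullet> v\<bar>" .
  qed
  have lower: "\<tau> * \<bar>b \<bullet> v\<bar> \<le> lq_norm q v" for v
  proof (cases "b \<bullet> v = 0")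
    case False
    have "\<bar>c\<bar> * \<bar>b \<bullet> v\<bar> \<le> lq_norm q v" if c: "c \<in> C" for c
    proof -
      have *: "(c *\<^sub>R b) \<bullet> v \<le> lq_norm q v" for v
      proof -
        have "(c *\<^sub>R b) \<bullet> v \<le> lq_norm p (c *\<^sub>R b) * lq_norm q v" by (rule lq_norm_Holder[OF q])
        also have "\<dots> \<le> 1 * lq_norm q v"
          using c lq_norm_slope_set_le_1[OF p b] by (intro mult_right_mono) (auto simp: C_def)
        finally show ?thesis by simp
      qed
      have "\<bar>c\<bar> * \<bar>b \<bullet> v\<bar> = \<bar>(c *\<^sub>R b) \<bullet> v\<bar>" by (simp add: abs_mult)
      then show ?thesis using *[of v] *[of "- v"] q1 by (simp add: abs_le_iff)
    qed
    then have "\<tau> \<le> lq_norm q v / \<bar>b \<bullet> v\<bar>"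
      unfolding \<tau>_def using \<open>0 \<in> C\<close> False by (intro cSUP_least) (auto simp: field_simps)
    then show ?thesis using False by (simp add: field_simps)
  qed simp
  show ?thesis
  \<comment> \<open>If \<tau> = 0, the support function never exceeds 0 and cannot reach t > 0;
    otherwise division by \<tau> is allowed.\<close>
  proof (cases "\<tau> = 0")
    case True
    have "{w \<in> space N. t \<le> support_fun (slope_set p b) (Z w)} = {}"
      using upper t by (auto simp: True not_le intro: le_less_trans)
    then show ?thesis by (simp only: measure_empty measure_nonneg)
  next
    case False
    then have \<tau>pos: "0 < \<tau>" using \<tau>0 by simp
    have "measure N {w \<in> space N. t \<le> support_fun (slope_set p b) (Z w)} \<le> measure N {w \<in> space N. t / \<tau> \<le> \<bar>b \<bullet> Z w\<bar>}"
    proof (rule N.finite_measure_mono)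
      have "t / \<tau> \<le> \<bar>b \<bullet> v\<bar>" if "t \<le> support_fun (slope_set p b) v" for v
        using order_trans[OF that upper] \<tau>pos by (simp add: field_simps)
      then show "{w \<in> space N. t \<le> support_fun (slope_set p b) (Z w)} \<subseteq> {w \<in> space N. t / \<tau> \<le> \<bar>b \<bullet> Z w\<bar>}"
        by blast
    qed measurable
    also have "\<dots> \<le> measure N' {w \<in> space N'. t / \<tau> \<le> \<bar>b \<bullet> Z' w\<bar>}"
      using \<tau>pos t score_variance_le[of b]
      by (intro centered_normal_tail_mono[OF Z Z']) (simp_all only: score_covariance_quadratic covariance_quadratic divide_pos_pos)
    also have "\<dots> \<le> measure N' {w \<in> space N'. t \<le> lq_norm q (Z' w)}"
    proof (rule N'.finite_measure_mono)
      have "t \<le> lq_norm q v" if "t / \<tau> \<le> \<bar>b \<bullet> v\<bar>" for v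
        using that lower[of v] \<tau>pos by (simp add: field_simps)
      then show "{w \<in> space N'. t / \<tau> \<le> \<bar>b \<bullet> Z' w\<bar>} \<subseteq> {w \<in> space N'. t \<le> lq_norm q (Z' w)}"
        by blast
    qed measurable
    finally show ?thesis .
  qed
qed

text \<open>For \<open>b = 0\<close> the score is \<open>- y x / 2\<close>, so \<open>2 Z\<close> and \<open>Z'\<close> have the same law.\<close>

lemma support_fun_dominated_zero:
  assumes q: "1 < q" "1 / p + 1 / q = 1" and b: "b = 0"
    and Z: "centered_normal N Z (\<integral>(x, y). (1 / (1 + exp (y * (b \<bullet> x)))\<^sup>2) *\<^sub>R outer x x \<partial>D)"
    and Z': "centered_normal N' Z' (\<integral>(x, y). outer x x \<partial>D)"
  shows "measure N {w \<in> space N. t \<le> support_fun (slope_set p b) (Z w)}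
    \<le> measure N' {w \<in> space N'. t \<le> lq_norm q (Z' w)}"
proof -
  have p: "1 \<le> p" by (rule conj_exponent_ge_1[OF q])
  have q1: "1 \<le> q" using q by simp
  interpret N: prob_space N using Z by (simp add: centered_normal_def)
  interpret N': prob_space N' using Z' by (simp add: centered_normal_def)
  have mZ[measurable]: "Z \<in> borel_measurable N" "Z' \<in> borel_measurable N'"
    using Z Z' by (auto simp: centered_normal_def)
  note q1[measurable]
  have upper: "support_fun (slope_set p b) v \<le> lq_norm q (2 *\<^sub>R v)" for v
    unfolding support_fun_def
  proof (rule cSUP_least)
    show "slope_set p b \<noteq> {}" using zero_in_slope_set[OF p, of b] by auto
    fix \<xi> assume \<xi>: "\<xi> \<in> slope_set p b"
    have "\<xi> \<bullet> v \<le> lq_norm p \<xi> * lq_norm q v" by (rule lq_norm_Holder[OF q])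
    also have "\<dots> \<le> 2 * lq_norm q v" using lq_norm_slope_set[OF p \<xi>] by (intro mult_right_mono) auto
    finally show "\<xi> \<bullet> v \<le> lq_norm q (2 *\<^sub>R v)" using q1 by (simp add: lq_norm_scaleR)
  qed
  have same: "(\<integral>w. iexp (u \<bullet> (2 *\<^sub>R Z w)) \<partial>N) = (\<integral>w. iexp (u \<bullet> Z' w) \<partial>N')" for u
  proof -
    have "(\<integral>w. iexp (u \<bullet> (2 *\<^sub>R Z w)) \<partial>N) = (\<integral>w. iexp ((2 *\<^sub>R u) \<bullet> Z w) \<partial>N)" by simp
    also have "\<dots> = of_real (exp (- (\<integral>z. ((2 *\<^sub>R u) \<bullet> score b z)\<^sup>2 \<partial>D) / 2))"
      unfolding centered_normal_iexp[OF Z] score_covariance_quadratic ..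
    also have "(\<integral>z. ((2 *\<^sub>R u) \<bullet> score b z)\<^sup>2 \<partial>D) = (\<integral>z. (u \<bullet> fst z)\<^sup>2 \<partial>D)"
      using AE_label by (intro integral_cong_AE) (auto elim!: eventually_mono simp: logistic_h_def b)
    finally show ?thesis unfolding centered_normal_iexp[OF Z'] covariance_quadratic .
  qed
  have "distr N borel (\<lambda>w. lq_norm q (2 *\<^sub>R Z w)) = distr N' borel (\<lambda>w. lq_norm q (Z' w))"
  proof (rule Levy_uniqueness)
    show "real_distribution (distr N borel (\<lambda>w. lq_norm q (2 *\<^sub>R Z w)))"
      by (rule N.real_distribution_distr) measurable
    show "real_distribution (distr N' borel (\<lambda>w. lq_norm q (Z' w)))"
      by (rule N'.real_distribution_distr) measurable
    have "(\<integral>w. iexp (s * lq_norm q (2 *\<^sub>R Z w)) \<partial>N) = (\<integral>w. iexp (s * lq_norm q (Z' w)) \<partial>N')" for s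
    proof -
      \<comment> \<open>Applied to a constant sequence, the Cramer-Wold device says that equal
        characteristic functions of all projections give equal laws of the norms.\<close>
      have "(\<lambda>n::nat. \<integral>w. iexp (s * lq_norm q (2 *\<^sub>R Z w)) \<partial>N) \<longlonglongrightarrow> (\<integral>w. iexp (s * lq_norm q (Z' w)) \<partial>N')"
      proof (rule Cramer_Wold_iexp_tendsto[OF N.prob_space_axioms N'.prob_space_axioms,
            where S = "\<lambda>_ w. 2 *\<^sub>R Z w" and g = "\<lambda>x. s * lq_norm q x"])
        show "continuous_on UNIV (\<lambda>x :: real ^ 'd. s * lq_norm q x)"
          by (intro continuous_intros continuous_on_lq_norm q1)
        show "\<exists>R. \<forall>n::nat. measure N {w \<in> space N. R < norm (2 *\<^sub>R Z w)} \<le> e" if "0 < e" for e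
          using N.norm_tail_small[of "\<lambda>w. 2 *\<^sub>R Z w" e] that by simp
      qed (simp_all only: same tendsto_const mZ borel_measurable_scaleR borel_measurable_const)
      then show ?thesis by (simp add: LIMSEQ_const_iff)
    qed
    then show "char (distr N borel (\<lambda>w. lq_norm q (2 *\<^sub>R Z w))) = char (distr N' borel (\<lambda>w. lq_norm q (Z' w)))"
      by (auto simp: char_def integral_distr fun_eq_iff)
  qed
  then have eq: "measure (distr N borel (\<lambda>w. lq_norm q (2 *\<^sub>R Z w))) {t..}
      = measure (distr N' borel (\<lambda>w. lq_norm q (Z' w))) {t..}" by simp
  have "measure N {w \<in> space N. t \<le> support_fun (slope_set p b) (Z w)}
      \<le> measure N {w \<in> space N. t \<le> lq_norm q (2 *\<^sub>R Z w)}"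
    using upper by (intro N.finite_measure_mono) (auto intro: order_trans)
  also have "\<dots> = measure N' {w \<in> space N'. t \<le> lq_norm q (Z' w)}"
    using eq by (subst (asm) (1 2) measure_distr) (auto simp: vimage_def Int_def conj_commute)
  finally show ?thesis .
qed

theorem support_fun_dominated:
  assumes q: "1 < q" "1 / p + 1 / q = 1"
    and Z: "centered_normal N Z (\<integral>(x, y). (1 / (1 + exp (y * (b \<bullet> x)))\<^sup>2) *\<^sub>R outer x x \<partial>D)"
    and Z': "centered_normal N' Z' (\<integral>(x, y). outer x x \<partial>D)"
  shows "stochastically_le N (\<lambda>w. support_fun (slope_set p b) (Z w)) N' (\<lambda>w. lq_norm q (Z' w))"
  unfolding stochastically_le_def
proof
  fix t
  interpret N: prob_space N using Z by (simp add: centered_normal_def)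
  interpret N': prob_space N' using Z' by (simp add: centered_normal_def)
  show "measure N {w \<in> space N. t \<le> support_fun (slope_set p b) (Z w)}
    \<le> measure N' {w \<in> space N'. t \<le> lq_norm q (Z' w)}"
  \<comment> \<open>For t at most 0 the event on the right is the whole space, because norms are
    nonnegative.\<close>
  proof (cases "0 < t")
    case True
    then show ?thesis
      using support_fun_dominated_nonzero[OF q _ True Z Z'] support_fun_dominated_zero[OF q _ Z Z'] by blast
  next
    case False
    then have "{w \<in> space N'. t \<le> lq_norm q (Z' w)} = space N'"
      using lq_norm_nonneg by (auto intro: order_trans[of t 0])
    then show ?thesis by (simp add: N'.prob_space N.prob_le_1)
  qed
qed

end

theorem theorem6:
  fixes M :: "'w measure"
    and X :: "nat \<Rightarrow> 'w \<Rightarrow> real ^ 'd" and Y :: "nat \<Rightarrow> 'w \<Rightarrow> real"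
    and D :: "((real ^ 'd) \<times> real) measure" and f :: "real ^ 'd \<Rightarrow> ennreal"
    and \<beta> :: "real ^ 'd" and p q :: ennreal
    and N :: "'v measure" and Z :: "'v \<Rightarrow> real ^ 'd"
    and N' :: "'u measure" and Z' :: "'u \<Rightarrow> real ^ 'd"
  assumes model: "logistic_model D \<beta>"
    and density: "distributed D lborel fst f" "AE x in lborel. 0 < f x"
    and second_moment: "integrable D (\<lambda>z. (norm (fst z))\<^sup>2)"
    and sample_space: "prob_space M"
    and labels: "\<And>i \<omega>. \<omega> \<in> space M \<Longrightarrow> Y i \<omega> \<in> {-1, 1}"
    and sample_indep: "prob_space.indep_vars M (\<lambda>_. borel) (\<lambda>i \<omega>. (X i \<omega>, Y i \<omega>)) UNIV"
    and sample_law: "\<And>i. distr M borel (\<lambda>\<omega>. (X i \<omega>, Y i \<omega>)) = D"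
    and q: "1 < q" and conj: "1 / p + 1 / q = 1"
    and Z: "centered_normal N Z
              (\<integral>(x, y). (1 / (1 + exp (y * (\<beta> \<bullet> x)))\<^sup>2) *\<^sub>R outer x x \<partial>D)"
    and Z': "centered_normal N' Z' (\<integral>(x, y). outer x x \<partial>D)"
  shows "converges_in_distribution
           M (\<lambda>n \<omega>. sqrt (real n) * enn2real (profile q \<beta> (empirical n (\<lambda>i. (X i \<omega>, Y i \<omega>)))))
           N (\<lambda>w. SUP \<xi>\<in>dual_set p D \<beta>. \<xi> \<bullet> Z w)
       \<and> stochastically_le
           N (\<lambda>w. SUP \<xi>\<in>dual_set p D \<beta>. \<xi> \<bullet> Z w)
           N' (\<lambda>w. lq_norm q (Z' w))"
proof -
  interpret logistic_sample D \<beta> f M X Y p q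
    by (intro logistic_sample.intro logistic_design.intro logistic_sample_axioms.intro)
       (fact model density second_moment sample_space labels sample_indep sample_law q conj)+
  have [measurable]: "Z \<in> borel_measurable N" using Z by (simp add: centered_normal_def)
  have [measurable]: "\<sigma> \<in> borel_measurable borel"
    by (rule borel_measurable_continuous_onI[OF continuous_on_support_fun_slope_set])
  have dual: "dual_set p D \<beta> = slope_set p \<beta>"
    by (rule dual_set_eq_slope_set[OF p_ge_1 sets_D AE_label support_D])
  have "converges_in_distribution M scaled_profile N (\<lambda>w. \<sigma> (Z w))"
    unfolding converges_in_distribution_def using scaled_profile_converges[OF Z] by simp
  moreover have "stochastically_le N (\<lambda>w. \<sigma> (Z w)) N' (\<lambda>w. lq_norm q (Z' w))"
    by (rule support_fun_dominated[OF q conj Z Z'])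
  ultimately show ?thesis
    unfolding dual support_fun_def scaled_profile_def[abs_def] by blast
qed

end
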